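(* Let $(\mathcal{A},\varphi)$ be a $W^*$-probability space with $\varphi$ a faithful trace, and let $d$ be a positive integer. (1) For every matrix $A=(a_{ij})_{i,j=1}^d\in M_d(\mathcal{A})$ we have $$\Phi^*(\{a_{ij},a_{ij}^*\}_{1\le i,j\le d})\ \ge\ d^3\,\Phi^*(A,A^* );$$ moreover, equality holds if $\{A,A^*\}$ is free from the subalgebra of scalar matrices $M_d(\mathbb{C}I)\subseteq M_d(\mathcal{A})$ (with $I$ the unit of $\mathcal{A}$). (2) For every selfadjoint matrix $B=(b_{ij})_{i,j=1}^d\in M_d(\mathcal{A})$ we have $$\Phi^*(\{b_{ij}\}_{1\le i,j\le d})\ \ge\ d^3\,\Phi^*(B);$$ and equality holds if $B$ is free from $M_d(\mathbb{C}I)\subseteq M_d(\mathcal{A})$.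
   Context: A $W^*$-probability space with faithful trace is a pair $(\mathcal{A},\varphi)$, with $\mathcal{A}$ a $W^*$-algebra (von Neumann algebra) with unit $I$ and $\varphi:\mathcal{A}\to\mathbb{C}$ a normal faithful trace-state. $M_d(\mathcal{A})$ is the $W^*$-algebra of $d\times d$ matrices over $\mathcal{A}$, regarded as a $W^*$-probability space with the faithful trace-state $\varphi_d(A)=\frac1d\sum_{i=1}^d\varphi(a_{ii})$; free Fisher information and freeness for elements of $M_d(\mathcal{A})$ are taken with respect to $\varphi_d$. $L^2(\mathcal{A},\varphi)$ is the completion of $\mathcal{A}$ in the norm $\|a\|_2=\varphi(a^*a)^{1/2}$; the left and right multiplication by $\mathcal A$, the adjoint and $\varphi$ extend to it by continuity. Freeness of subsets means freeness (in Voiculescu's sense) of the unital subalgebras they generate. Free Fisher information. Let $\{a_i\}_{i\in I}$ be an indexed family in $\mathcal{A}$ which is selfadjoint, i.e. there is an involutive bijection $\sigma:I\to I$ with $a_i^*=a_{\sigma(i)}$. A family $\{\xi_i\}_{i\in I}$ in $L^2(\mathcal{A},\varphi)$ is a conjugate system for $\{a_i\}_{i\in I}$ if $$\varphi(\xi_i a_{i_1}\cdots a_{i_n})=\sum_{m=1}^n\delta_{i,i_m}\,\varphi(a_{i_1}\cdots a_{i_{m-1}})\,\varphi(a_{i_{m+1}}\cdots a_{i_n})$$ for all $n\ge 0$ and $i,i_1,\dots,i_n\in I$ (empty products are the unit; for $n=0$ this says $\varphi(\xi_i)=0$), and every $\xi_i$ lies in the $\|\cdot\|_2$-closure of the unital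 algebra generated by $\{a_j\}_{j\in I}$. Such a system is unique if it exists; then $\Phi^*(\{a_i\}_{i\in I}):=\sum_i\|\xi_i\|_2^2$, and $\Phi^*(\{a_i\}_{i\in I}):=\infty$ if no conjugate system exists. $\{a_{ij},a_{ij}^*\}_{1\le i,j\le d}$ is an indexed family with $2d^2$ members, $\{b_{ij}\}_{1\le i,j\le d}$ one with $d^2$ members (selfadjoint with $\sigma(i,j)=(j,i)$ when $B=B^*$), and $\Phi^*(A,A^* )$ refers to the two-element indexed family $A_1=A$, $A_2=A^*$. *)

theory Defs
  imports "HOL-Analysis.Analysis"
begin

section \<open>Complex Hilbert spaces\<close>

class scaleC =
  fixes scaleC :: "complex \<Rightarrow> 'a \<Rightarrow> 'a"  (infixr \<open>*\<^sub>C\<close> 75)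

text \<open>
  A complex Hilbert space is viewed as a (complete) real Hilbert space for the real part of its
  complex inner product.  The complex inner product is linear in the second argument.
  The law \<open>1 *\<^sub>C x = x\<close> and positivity of \<open>cinner\<close> are consequences of the axioms.
\<close>

class chilbert_space = real_inner + complete_space + scaleC +
  fixes cinner :: "'a \<Rightarrow> 'a \<Rightarrow> complex"
  assumes scaleR_scaleC: "r *\<^sub>R x = of_real r *\<^sub>C x"
    and scaleC_add_left: "(a + b) *\<^sub>C x = a *\<^sub>C x + b *\<^sub>C x"
    and scaleC_add_right: "a *\<^sub>C (x + y) = a *\<^sub>C x + a *\<^sub>C y"
    and scaleC_scaleC: "a *\<^sub>C b *\<^sub>C x = (a * b) *\<^sub>C x"
    and cinner_commute: "cinner x y = cnj (cinner y x)"
    and cinner_add_right: "cinner x (y + z) = cinner x y + cinner x z"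
    and cinner_scaleC_right: "cinner x (a *\<^sub>C y) = a * cinner x y"
    and inner_eq_Re_cinner: "inner x y = Re (cinner x y)"

instantiation vec :: (chilbert_space, finite) chilbert_space
begin

definition scaleC_vec :: "complex \<Rightarrow> 'a ^ 'b \<Rightarrow> 'a ^ 'b"
  where "c *\<^sub>C v = (\<chi> i. c *\<^sub>C (v $ i))"

definition cinner_vec :: "'a ^ 'b \<Rightarrow> 'a ^ 'b \<Rightarrow> complex"
  where "cinner v w = (\<Sum>i\<in>UNIV. cinner (v $ i) (w $ i))"

instance
proof
  fix r :: real and a b :: complex and x y z :: "'a ^ 'b"
  show "r *\<^sub>R x = of_real r *\<^sub>C x"
    by (simp add: vec_eq_iff scaleC_vec_def scaleR_scaleC)
  show "(a + b) *\<^sub>C x = a *\<^sub>C x + b *\<^sub>C x"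
    by (simp add: vec_eq_iff scaleC_vec_def scaleC_add_left)
  show "a *\<^sub>C (x + y) = a *\<^sub>C x + a *\<^sub>C y"
    by (simp add: vec_eq_iff scaleC_vec_def scaleC_add_right)
  show "a *\<^sub>C b *\<^sub>C x = (a * b) *\<^sub>C x"
    by (simp add: vec_eq_iff scaleC_vec_def scaleC_scaleC)
  show "cinner x y = cnj (cinner y x)"
    unfolding cinner_vec_def cnj_sum by (rule sum.cong[OF refl], rule cinner_commute)
  show "cinner x (y + z) = cinner x y + cinner x z"
    by (simp add: cinner_vec_def cinner_add_right sum.distrib)
  show "cinner x (a *\<^sub>C y) = a * cinner x y"
    by (simp add: cinner_vec_def scaleC_vec_def cinner_scaleC_right sum_distrib_left)
  show "inner x y = Re (cinner x y)"
    by (simp add: cinner_vec_def inner_vec_def inner_eq_Re_cinner)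
qed

end

lemma scaleC_zero_right [simp]: "c *\<^sub>C (0 :: 'a::chilbert_space) = 0"
  using scaleC_add_right[of c 0 "0 :: 'a"] by simp

lemma scaleC_one [simp]: "1 *\<^sub>C (x :: 'a::chilbert_space) = x"
  using scaleR_scaleC[of 1 x] by simp

lemma scaleC_minus_right [simp]: "c *\<^sub>C (- x) = - (c *\<^sub>C (x :: 'a::chilbert_space))"
  using scaleC_add_right[of c x "- x"] by (simp add: eq_neg_iff_add_eq_0 add.commute)

lemma scaleC_sum_right:
  "c *\<^sub>C (\<Sum>i\<in>I. f i) = (\<Sum>i\<in>I. c *\<^sub>C (f i :: 'a::chilbert_space))"
  by (induction I rule: infinite_finite_induct) (simp_all add: scaleC_add_right)

lemma norm_scaleC: "norm (c *\<^sub>C (x :: 'a::chilbert_space)) = cmod c * norm x"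
proof -
  have *: "cinner (c *\<^sub>C x) y = cnj c * cinner x y" for y
    using cinner_commute[of "c *\<^sub>C x" y] cinner_commute[of x y] by (simp add: cinner_scaleC_right)
  have "Im (cinner x x) = 0"
    using arg_cong[OF cinner_commute[of x x], of Im] by simp
  then have "inner (c *\<^sub>C x) (c *\<^sub>C x) = Re (c * cnj c) * inner x x"
    by (simp add: inner_eq_Re_cinner * cinner_scaleC_right algebra_simps)
  then have "(norm (c *\<^sub>C x))\<^sup>2 = (cmod c * norm x)\<^sup>2"
    by (simp add: power2_norm_eq_inner[where 'a = 'a] power_mult_distrib complex_mult_cnj cmod_power2)
  then show ?thesis
    by (simp add: power2_eq_iff_nonneg)
qed

lemma bounded_linear_scaleC: "bounded_linear (\<lambda>x :: 'a::chilbert_space. c *\<^sub>C x)"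
  by (rule bounded_linear_intro[where K = "cmod c"])
    (simp_all add: scaleC_add_right scaleR_scaleC scaleC_scaleC norm_scaleC mult.commute)


section \<open>Bounded operators\<close>

typedef (overloaded) 'h bop =
  "{f :: 'h::chilbert_space \<Rightarrow> 'h. bounded_linear f \<and> (\<forall>c x. f (c *\<^sub>C x) = c *\<^sub>C f x)}"
  morphisms bop_apply Bop
  by (rule exI[of _ "\<lambda>_. 0"]) (simp add: bounded_linear_zero)

setup_lifting type_definition_bop

instantiation bop :: (chilbert_space) "{ring, monoid_mult, scaleC}"
begin

lift_definition zero_bop :: "'a bop" is "\<lambda>_. 0"
  by (simp add: bounded_linear_zero)

lift_definition one_bop :: "'a bop" is "\<lambda>x. x"
  by (simp add: bounded_linear_ident)

lift_definition plus_bop :: "'a bop \<Rightarrow> 'a bop \<Rightarrow> 'a bop" is "\<lambda>f g x. f x + g x"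
  by (simp add: bounded_linear_add scaleC_add_right)

lift_definition uminus_bop :: "'a bop \<Rightarrow> 'a bop" is "\<lambda>f x. - f x"
  by (simp add: bounded_linear_minus)

lift_definition minus_bop :: "'a bop \<Rightarrow> 'a bop \<Rightarrow> 'a bop" is "\<lambda>f g x. f x - g x"
proof -
  fix f g :: "'a \<Rightarrow> 'a"
  assume "bounded_linear f \<and> (\<forall>c x. f (c *\<^sub>C x) = c *\<^sub>C f x)"
    "bounded_linear g \<and> (\<forall>c x. g (c *\<^sub>C x) = c *\<^sub>C g x)"
  then show "bounded_linear (\<lambda>x. f x - g x) \<and> (\<forall>c x. f (c *\<^sub>C x) - g (c *\<^sub>C x) = c *\<^sub>C (f x - g x))"
    using scaleC_add_right[of _ "f _" "- g _"] by (simp add: bounded_linear_sub)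
qed

lift_definition times_bop :: "'a bop \<Rightarrow> 'a bop \<Rightarrow> 'a bop" is "\<lambda>f g x. f (g x)"
  by (simp add: bounded_linear_compose)

lift_definition scaleC_bop :: "complex \<Rightarrow> 'a bop \<Rightarrow> 'a bop" is "\<lambda>c f x. c *\<^sub>C f x"
  by (simp add: bounded_linear_compose[OF bounded_linear_scaleC] scaleC_scaleC mult.commute)

instance
proof
  fix a b c :: "'a bop"
  show "a * (b + c) = a * b + a * c"
    by transfer (simp add: linear_simps)
qed (transfer; simp add: fun_eq_iff algebra_simps)+

end

text \<open>The Hilbert space adjoint, which exists and is unique by the Riesz representation theorem.\<close>

definition adj :: "'h::chilbert_space bop \<Rightarrow> 'h bop" where
  "adj a = (THE b. \<forall>x y. cinner (bop_apply a x) y = cinner x (bop_apply b y))"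

definition selfadjoint :: "'h::chilbert_space bop \<Rightarrow> bool" where
  "selfadjoint a \<longleftrightarrow> adj a = a"

text \<open>The usual order; it is only used between selfadjoint operators, for which the quadratic forms
  are real.\<close>

definition op_le :: "'h::chilbert_space bop \<Rightarrow> 'h bop \<Rightarrow> bool" where
  "op_le a b \<longleftrightarrow> (\<forall>x. Re (cinner x (bop_apply a x)) \<le> Re (cinner x (bop_apply b x)))"


section \<open>\<open>W\<^sup>*\<close>-probability spaces\<close>

text \<open>
  \<open>W\<^sup>*\<close>-algebras are taken as von Neumann algebras acting on a complex Hilbert space \<open>'h\<close>, which is
  arbitrary.
\<close>

definition commutant :: "'h::chilbert_space bop set \<Rightarrow> 'h bop set" where
  "commutant S = {t. \<forall>s\<in>S. s * t = t * s}"

definition von_neumann_algebra :: "'h::chilbert_space bop set \<Rightarrow> bool" where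
  "von_neumann_algebra M \<longleftrightarrow> (\<forall>a\<in>M. adj a \<in> M) \<and> commutant (commutant M) = M"

text \<open>Normality of a positive functional: it preserves suprema of increasing nets (equivalently, of
  upward directed sets) of selfadjoint elements.\<close>

definition normal_on :: "'h::chilbert_space bop set \<Rightarrow> ('h bop \<Rightarrow> complex) \<Rightarrow> bool" where
  "normal_on M \<phi> \<longleftrightarrow>
    (\<forall>D s. D \<subseteq> {a\<in>M. selfadjoint a} \<and> D \<noteq> {} \<and>
       (\<forall>a\<in>D. \<forall>b\<in>D. \<exists>c\<in>D. op_le a c \<and> op_le b c) \<and>
       s \<in> M \<and> selfadjoint s \<and> (\<forall>a\<in>D. op_le a s) \<and>
       (\<forall>t\<in>M. selfadjoint t \<and> (\<forall>a\<in>D. op_le a t) \<longrightarrow> op_le s t)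
     \<longrightarrow> Re (\<phi> s) = (SUP a\<in>D. Re (\<phi> a)))"

text \<open>Only the values of \<open>\<phi>\<close> on \<open>M\<close> are relevant.\<close>

locale wstar_probability_space =
  fixes M :: "'h::chilbert_space bop set" and \<phi> :: "'h bop \<Rightarrow> complex"
  assumes von_neumann: "von_neumann_algebra M"
    and state_add: "a \<in> M \<Longrightarrow> b \<in> M \<Longrightarrow> \<phi> (a + b) = \<phi> a + \<phi> b"
    and state_scaleC: "a \<in> M \<Longrightarrow> \<phi> (c *\<^sub>C a) = c * \<phi> a"
    and state_one: "\<phi> 1 = 1"
    and state_positive: "a \<in> M \<Longrightarrow> \<phi> (adj a * a) \<in> \<real>\<^sub>\<ge>\<^sub>0"
    and state_faithful: "a \<in> M \<Longrightarrow> \<phi> (adj a * a) = 0 \<Longrightarrow> a = 0"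
    and state_trace: "a \<in> M \<Longrightarrow> b \<in> M \<Longrightarrow> \<phi> (a * b) = \<phi> (b * a)"
    and state_normal: "normal_on M \<phi>"

inductive_set alg_gen :: "'h::chilbert_space bop set \<Rightarrow> 'h bop set" for S where
  alg_gen_one: "1 \<in> alg_gen S"
| alg_gen_base: "a \<in> S \<Longrightarrow> a \<in> alg_gen S"
| alg_gen_add: "a \<in> alg_gen S \<Longrightarrow> b \<in> alg_gen S \<Longrightarrow> a + b \<in> alg_gen S"
| alg_gen_mult: "a \<in> alg_gen S \<Longrightarrow> b \<in> alg_gen S \<Longrightarrow> a * b \<in> alg_gen S"
| alg_gen_scaleC: "a \<in> alg_gen S \<Longrightarrow> c *\<^sub>C a \<in> alg_gen S"

text \<open>Freeness of a family of subsets: \<open>\<phi>\<close> vanishes on every nonempty alternating product of centred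
  elements of the generated unital subalgebras.\<close>

definition free_family :: "('h::chilbert_space bop \<Rightarrow> complex) \<Rightarrow> ('k \<Rightarrow> 'h bop set) \<Rightarrow> bool" where
  "free_family \<phi> S \<longleftrightarrow>
    (\<forall>ks as. ks \<noteq> [] \<and> length as = length ks \<and> distinct_adj ks \<and>
       (\<forall>n<length ks. as ! n \<in> alg_gen (S (ks ! n)) \<and> \<phi> (as ! n) = 0)
     \<longrightarrow> \<phi> (prod_list as) = 0)"

definition free_from ::
  "('h::chilbert_space bop \<Rightarrow> complex) \<Rightarrow> 'h bop set \<Rightarrow> 'h bop set \<Rightarrow> bool" where
  "free_from \<phi> S T \<longleftrightarrow> free_family \<phi> (\<lambda>k :: bool. if k then S else T)"


section \<open>The space \<open>L\<^sup>2(M, \<phi>)\<close>\<close>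

definition norm2 :: "('h::chilbert_space bop \<Rightarrow> complex) \<Rightarrow> 'h bop \<Rightarrow> real" where
  "norm2 \<phi> a = sqrt (Re (\<phi> (adj a * a)))"

text \<open>The completion of \<open>M\<close> is realised as the set of classes of Cauchy sequences modulo
  sequences tending to zero.\<close>

definition cauchy2 ::
  "'h::chilbert_space bop set \<Rightarrow> ('h bop \<Rightarrow> complex) \<Rightarrow> (nat \<Rightarrow> 'h bop) set" where
  "cauchy2 M \<phi> = {x. range x \<subseteq> M \<and>
     (\<forall>e>0. \<exists>N. \<forall>m\<ge>N. \<forall>n\<ge>N. norm2 \<phi> (x m - x n) < e)}"

definition l2_rel ::
  "'h::chilbert_space bop set \<Rightarrow> ('h bop \<Rightarrow> complex) \<Rightarrow> (nat \<Rightarrow> 'h bop) rel" where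
  "l2_rel M \<phi> = {(x, y). x \<in> cauchy2 M \<phi> \<and> y \<in> cauchy2 M \<phi> \<and>
     (\<lambda>n. norm2 \<phi> (x n - y n)) \<longlonglongrightarrow> 0}"

type_synonym 'h l2 = "(nat \<Rightarrow> 'h bop) set"

definition L2 :: "'h::chilbert_space bop set \<Rightarrow> ('h bop \<Rightarrow> complex) \<Rightarrow> 'h l2 set" where
  "L2 M \<phi> = cauchy2 M \<phi> // l2_rel M \<phi>"

definition l2_embed ::
  "'h::chilbert_space bop set \<Rightarrow> ('h bop \<Rightarrow> complex) \<Rightarrow> 'h bop \<Rightarrow> 'h l2" where
  "l2_embed M \<phi> a = l2_rel M \<phi> `` {\<lambda>_. a}"

definition l2_norm :: "('h::chilbert_space bop \<Rightarrow> complex) \<Rightarrow> 'h l2 \<Rightarrow> real" where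
  "l2_norm \<phi> \<xi> = (THE r. \<forall>x\<in>\<xi>. (\<lambda>n. norm2 \<phi> (x n)) \<longlonglongrightarrow> r)"

definition l2_dist :: "('h::chilbert_space bop \<Rightarrow> complex) \<Rightarrow> 'h l2 \<Rightarrow> 'h l2 \<Rightarrow> real" where
  "l2_dist \<phi> \<xi> \<eta> = (THE r. \<forall>x\<in>\<xi>. \<forall>y\<in>\<eta>. (\<lambda>n. norm2 \<phi> (x n - y n)) \<longlonglongrightarrow> r)"

definition l2_closure ::
  "'h::chilbert_space bop set \<Rightarrow> ('h bop \<Rightarrow> complex) \<Rightarrow> 'h l2 set \<Rightarrow> 'h l2 set" where
  "l2_closure M \<phi> S = {\<xi> \<in> L2 M \<phi>. \<forall>e>0. \<exists>\<eta>\<in>S. l2_dist \<phi> \<xi> \<eta> < e}"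

text \<open>\<open>\<phi>(\<xi> a)\<close> for \<open>\<xi>\<close> in \<open>L\<^sup>2\<close> and \<open>a\<close> in \<open>M\<close>: the extension by continuity of \<open>x \<mapsto> \<phi>(x a)\<close>.\<close>

definition l2_state_mult :: "('h::chilbert_space bop \<Rightarrow> complex) \<Rightarrow> 'h l2 \<Rightarrow> 'h bop \<Rightarrow> complex" where
  "l2_state_mult \<phi> \<xi> a = (THE c. \<forall>x\<in>\<xi>. (\<lambda>n. \<phi> (x n * a)) \<longlonglongrightarrow> c)"


section \<open>Free Fisher information\<close>

text \<open>
  Families are indexed by a finite type; the definitions are meant for selfadjoint families.
  For a word \<open>w\<close> in the indices, position \<open>m < length w\<close> splits the corresponding product into the
  factors strictly before and strictly after it.
\<close>

definition conjugate_system ::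
  "'h::chilbert_space bop set \<Rightarrow> ('h bop \<Rightarrow> complex) \<Rightarrow> ('i::finite \<Rightarrow> 'h bop) \<Rightarrow> ('i \<Rightarrow> 'h l2) \<Rightarrow> bool"
  where
  "conjugate_system M \<phi> a \<xi> \<longleftrightarrow>
    (\<forall>i w. l2_state_mult \<phi> (\<xi> i) (prod_list (map a w)) =
       (\<Sum>m<length w. if w ! m = i
          then \<phi> (prod_list (map a (take m w))) * \<phi> (prod_list (map a (drop (Suc m) w))) else 0)) \<and>
    (\<forall>i. \<xi> i \<in> l2_closure M \<phi> (l2_embed M \<phi> ` alg_gen (range a)))"

definition free_fisher ::
  "'h::chilbert_space bop set \<Rightarrow> ('h bop \<Rightarrow> complex) \<Rightarrow> ('i::finite \<Rightarrow> 'h bop) \<Rightarrow> ennreal" where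
  "free_fisher M \<phi> a =
    (if \<exists>\<xi>. conjugate_system M \<phi> a \<xi>
     then \<Sum>i\<in>UNIV. ennreal ((l2_norm \<phi> ((THE \<xi>. conjugate_system M \<phi> a \<xi>) i))\<^sup>2)
     else \<infinity>)"


section \<open>Matrices over \<open>M\<close>\<close>

text \<open>
  \<open>d \<times> d\<close> matrices over \<open>M\<close> are identified with operators on the Hilbert space \<open>'h ^ 'd\<close>, with
  \<open>d = CARD('d)\<close>: the entry of \<open>A\<close> at \<open>(i, j)\<close> is the compression of \<open>A\<close> from the \<open>j\<close>-th to the
  \<open>i\<close>-th summand.
\<close>

lift_definition entry :: "('h::chilbert_space ^ 'd::finite) bop \<Rightarrow> 'd \<Rightarrow> 'd \<Rightarrow> 'h bop" is
  "\<lambda>A i j x. A (axis j x) $ i"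
proof -
  fix A :: "'h ^ 'd \<Rightarrow> 'h ^ 'd" and i j :: 'd
  assume A: "bounded_linear A \<and> (\<forall>c x. A (c *\<^sub>C x) = c *\<^sub>C A x)"
  have ax: "axis j (x + y) = axis j x + axis j y" "axis j (c *\<^sub>C x) = c *\<^sub>C axis j x"
    "axis j (r *\<^sub>R x) = r *\<^sub>R axis j x" for x y :: 'h and c r
    by (simp_all add: vec_eq_iff axis_def scaleC_vec_def)
  have "bounded_linear (axis j :: 'h \<Rightarrow> 'h ^ 'd)"
    by (rule bounded_linear_intro[where K = 1]) (simp_all add: ax norm_eq_sqrt_inner inner_axis)
  then have "bounded_linear (\<lambda>x. A (axis j x) $ i)"
    using A by (intro bounded_linear_compose[OF bounded_linear_vec_nth]
        bounded_linear_compose[of A "axis j"]) auto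
  then show "bounded_linear (\<lambda>x. A (axis j x) $ i) \<and>
      (\<forall>c x. A (axis j (c *\<^sub>C x)) $ i = c *\<^sub>C A (axis j x) $ i)"
    using A by (simp add: ax scaleC_vec_def)
qed

lift_definition bop_of_matrix :: "('d::finite \<Rightarrow> 'd \<Rightarrow> 'h::chilbert_space bop) \<Rightarrow> ('h ^ 'd) bop" is
  "\<lambda>a v. \<chi> i. \<Sum>j\<in>UNIV. a i j (v $ j)"
proof -
  fix a :: "'d \<Rightarrow> 'd \<Rightarrow> 'h \<Rightarrow> 'h"
  assume "\<And>i j. bounded_linear (a i j) \<and> (\<forall>c x. a i j (c *\<^sub>C x) = c *\<^sub>C a i j x)"
  then have a: "bounded_linear (a i j)" "a i j (c *\<^sub>C x) = c *\<^sub>C a i j x" for i j c x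
    by blast+
  have "bounded_linear (\<lambda>v :: 'h ^ 'd. \<chi> i. \<Sum>j\<in>UNIV. a i j (v $ j))"
  proof (rule bounded_linear_intro)
    fix v :: "'h ^ 'd"
    have "norm (\<chi> i. \<Sum>j\<in>UNIV. a i j (v $ j)) \<le> (\<Sum>i\<in>UNIV. norm (\<Sum>j\<in>UNIV. a i j (v $ j)))"
      by (simp add: norm_vec_def L2_set_le_sum)
    also have "\<dots> \<le> (\<Sum>i\<in>UNIV. \<Sum>j\<in>UNIV. norm (a i j (v $ j)))"
      by (intro sum_mono norm_sum)
    also have "\<dots> \<le> (\<Sum>i\<in>UNIV. \<Sum>j\<in>UNIV. norm v * onorm (a i j))"
    proof (intro sum_mono)
      fix i j
      have "norm (a i j (v $ j)) \<le> onorm (a i j) * norm (v $ j)"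
        by (rule onorm[OF a(1)])
      also have "\<dots> \<le> onorm (a i j) * norm v"
        by (intro mult_left_mono Finite_Cartesian_Product.norm_nth_le onorm_pos_le a(1))
      finally show "norm (a i j (v $ j)) \<le> norm v * onorm (a i j)"
        by (simp add: mult.commute)
    qed
    also have "\<dots> = norm v * (\<Sum>i\<in>UNIV. \<Sum>j\<in>UNIV. onorm (a i j))"
      by (simp add: sum_distrib_left)
    finally show "norm (\<chi> i. \<Sum>j\<in>UNIV. a i j (v $ j)) \<le>
      norm v * (\<Sum>i\<in>UNIV. \<Sum>j\<in>UNIV. onorm (a i j))" .
  qed (simp_all add: vec_eq_iff bounded_linear.linear[OF a(1)] linear_add linear_scale
      sum.distrib scaleR_sum_right)
  then show "bounded_linear (\<lambda>v. \<chi> i. \<Sum>j\<in>UNIV. a i j (v $ j)) \<and>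
    (\<forall>c v. (\<chi> i. \<Sum>j\<in>UNIV. a i j ((c *\<^sub>C v) $ j)) = c *\<^sub>C (\<chi> i. \<Sum>j\<in>UNIV. a i j (v $ j)))"
    by (simp add: vec_eq_iff scaleC_vec_def a(2) scaleC_sum_right)
qed

lemma linear_bop_apply: "linear (bop_apply a)"
  using bop_apply[of a] by (simp add: bounded_linear.linear)

lemma bop_apply_sum: "bop_apply (\<Sum>k\<in>K. a k) x = (\<Sum>k\<in>K. bop_apply (a k) x)"
  by (induction K rule: infinite_finite_induct) (simp_all add: zero_bop.rep_eq plus_bop.rep_eq)

lemma entry_bop_of_matrix: "entry (bop_of_matrix a) i j = a i j"
proof (rule bop_apply_inject[THEN iffD1], rule ext)
  fix x
  have "(\<Sum>k\<in>UNIV. bop_apply (a i k) (axis j x $ k)) =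
    (\<Sum>k\<in>UNIV. if k = j then bop_apply (a i k) x else 0)"
    by (intro sum.cong) (auto simp: axis_def linear_0[OF linear_bop_apply])
  then show "bop_apply (entry (bop_of_matrix a) i j) x = bop_apply (a i j) x"
    by (simp add: entry.rep_eq bop_of_matrix.rep_eq)
qed

lemma bop_of_matrix_entry:
  fixes A :: "('a::chilbert_space ^ 'b::finite) bop"
  shows "bop_of_matrix (entry A) = A"
proof (rule bop_apply_inject[THEN iffD1], rule ext)
  fix v :: "'a ^ 'b"
  have v: "(\<Sum>j\<in>UNIV. axis j (v $ j)) = v"
    by (simp add: vec_eq_iff axis_def)
  have "bop_apply A (\<Sum>j\<in>UNIV. axis j (v $ j)) = (\<Sum>j\<in>UNIV. bop_apply A (axis j (v $ j)))"
    by (rule linear_sum[OF linear_bop_apply])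
  then have "bop_apply A v = (\<Sum>j\<in>UNIV. bop_apply A (axis j (v $ j)))"
    unfolding v .
  then show "bop_apply (bop_of_matrix (entry A)) v = bop_apply A v"
    by (simp add: vec_eq_iff entry.rep_eq bop_of_matrix.rep_eq)
qed

lemma entry_mult: "entry (A * B) i j = (\<Sum>k\<in>UNIV. entry A i k * entry B k j)"
proof (rule bop_apply_inject[THEN iffD1], rule ext)
  fix x
  have "bop_apply (A * B) v = bop_apply (bop_of_matrix (entry A)) (bop_apply B v)" for v
    by (simp add: bop_of_matrix_entry times_bop.rep_eq)
  then show "bop_apply (entry (A * B) i j) x = bop_apply (\<Sum>k\<in>UNIV. entry A i k * entry B k j) x"
    by (simp add: entry.rep_eq times_bop.rep_eq bop_of_matrix.rep_eq bop_apply_sum)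
qed

definition mat_alg :: "'h::chilbert_space bop set \<Rightarrow> ('h ^ 'd::finite) bop set" where
  "mat_alg M = {A. \<forall>i j. entry A i j \<in> M}"

definition mat_trace :: "('h::chilbert_space bop \<Rightarrow> complex) \<Rightarrow> ('h ^ 'd::finite) bop \<Rightarrow> complex" where
  "mat_trace \<phi> A = (\<Sum>i\<in>UNIV. \<phi> (entry A i i)) / of_nat CARD('d)"

definition scalar_matrices :: "('h::chilbert_space ^ 'd::finite) bop set" where
  "scalar_matrices = {A. \<forall>i j. \<exists>c. entry A i j = c *\<^sub>C 1}"

definition adj_pair :: "'h::chilbert_space bop \<Rightarrow> bool \<Rightarrow> 'h bop" where
  "adj_pair a k = (if k then a else adj a)"

end

theory Submission
  imports Defs
begin

text \<open>
  Both parts are instances of one statement on a finite family \<open>A\<close> of \<open>d \<times> d\<close> matrices that is closed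
  under adjoints: the family of all entries of all \<open>A k\<close> has free Fisher information at least \<open>d\<^sup>3\<close>
  times that of \<open>A\<close>, with equality if \<open>A\<close> is free from the scalar matrices.  The pair of a matrix and
  its adjoint is such a family; its entries are the \<open>a\<^bsub>ij\<^esub>\<close> and, up to transposing the indices, the
  \<open>a\<^bsub>ij\<^esub>\<^sup>*\<close>.  A selfadjoint matrix is a family with one member.

  Inequality (\<open>free_fisher_entries_ge\<close>).  Let \<open>\<xi>\<close> be a conjugate system of the entries and let \<open>\<Xi> k\<close> be
  the matrix with entry \<open>\<xi>(j, i, k) / d\<close> at \<open>(i, j)\<close>.  Expand the trace of \<open>\<Xi> k\<close> times a word in \<open>A\<close> over
  closed paths of indices.  The conjugate relation of \<open>\<xi>(j, i, k)\<close> removes one letter \<open>A k\<close> and forces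
  its indices to be \<open>j\<close> and \<open>i\<close>, which splits the path into two closed paths, that is, into two traces;
  so \<open>\<Xi>\<close> satisfies the conjugate relations of \<open>A\<close>.  It need not lie in the closure of the algebra
  generated by \<open>A\<close>, but its orthogonal projection onto that closure does, satisfies the same relations
  and has no larger norm (\<open>l2_projection\<close>).  The squared norms of the \<open>\<Xi> k\<close> add up to \<open>d\<close> to the power
  \<open>-3\<close> times those of the \<open>\<xi>(i, j, k)\<close>: a factor \<open>1/d\<^sup>2\<close> from the scaling and \<open>1/d\<close> from the
  normalised trace.

  Equality (\<open>free_fisher_entries_eq\<close>).  Conversely let \<open>\<Xi>\<close> be a conjugate system of \<open>A\<close>, and let
  \<open>\<xi>(i, j, k)\<close> be \<open>d\<close> times the entry of \<open>\<Xi> k\<close> at \<open>(j, i)\<close>.  A product of entries of \<open>A\<close>, put at the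
  place \<open>(i, j)\<close> of a matrix, is a product of matrices \<open>A k\<close> with matrix units between them.  Hence the
  conjugate relations of \<open>\<xi>\<close> are the relations of \<open>\<Xi>\<close> for words in \<open>A\<close> and scalar matrices, where the
  free difference quotient vanishes on scalar matrices.  These follow from freeness
  (\<open>mixed_conjugate_relation\<close>): modulo words in \<open>A\<close> alone, every such word is a combination of products
  \<open>p\<^sub>0 b\<^sub>1 p\<^sub>1 \<cdots> b\<^sub>r p\<^sub>r\<close> with \<open>r \<ge> 1\<close>, with all \<open>b\<^sub>j\<close> and all inner \<open>p\<^sub>j\<close> centred, and for those both
  sides of the relation vanish.  If \<open>A\<close> has no conjugate system, the inequality makes both sides infinite.

  Elements of \<open>L\<^sup>2\<close> are represented throughout by Cauchy sequences of operators.  Adjoints of operators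
  and projections in \<open>L\<^sup>2\<close> come from a single form of the Riesz theorem, \<open>riesz_representation\<close>, in
  which the representing vector is a Cauchy sequence in a space that need not be complete.
\<close>

section \<open>Semi-inner products\<close>

lemma quadratic_nonneg_imp_discriminant_le:
  fixes a b r :: real
  assumes nonneg: "\<And>t. 0 \<le> a + 2 * t * r + t\<^sup>2 * b" and b: "0 \<le> b"
  shows "r\<^sup>2 \<le> a * b"
proof (cases "b = 0")
  case True
  have "r = 0"
  proof (rule ccontr)
    assume "r \<noteq> 0"
    then have "a + 2 * (- (a + 1) / (2 * r)) * r = - 1"
      by (simp add: field_simps)
    with nonneg[of "- (a + 1) / (2 * r)"] True show False by simp
  qed
  then show ?thesis using True by simp
next
  case False
  then have b: "b > 0" using b by simp
  have "0 \<le> a + 2 * (- r / b) * r + (- r / b)\<^sup>2 * b" by (rule nonneg)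
  also have "\<dots> = a - r\<^sup>2 / b" using b by (simp add: field_simps power2_eq_square)
  finally show ?thesis using b by (simp add: field_simps)
qed

definition seminorm_of :: "('a \<Rightarrow> 'a \<Rightarrow> complex) \<Rightarrow> 'a \<Rightarrow> real" where
  "seminorm_of ip x = sqrt (Re (ip x x))"

text \<open>
  The operations are carried by a subset, and the form may be degenerate, because three kinds of spaces
  occur: a Hilbert space with \<open>cinner\<close>, an algebra of operators with \<open>\<phi> (adj a * b)\<close>, and a linear
  subspace of such an algebra.
\<close>

locale semi_inner_product =
  fixes V :: "'a::{ab_group_add,scaleC} set" and ip :: "'a \<Rightarrow> 'a \<Rightarrow> complex"
  assumes zero_mem: "0 \<in> V"
    and add_mem: "x \<in> V \<Longrightarrow> y \<in> V \<Longrightarrow> x + y \<in> V"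
    and scaleC_mem: "x \<in> V \<Longrightarrow> c *\<^sub>C x \<in> V"
    and minus_eq_scaleC: "x \<in> V \<Longrightarrow> - x = (-1) *\<^sub>C x"
    and ip_commute: "x \<in> V \<Longrightarrow> y \<in> V \<Longrightarrow> ip x y = cnj (ip y x)"
    and ip_add_right: "x \<in> V \<Longrightarrow> y \<in> V \<Longrightarrow> z \<in> V \<Longrightarrow> ip x (y + z) = ip x y + ip x z"
    and ip_scaleC_right: "x \<in> V \<Longrightarrow> y \<in> V \<Longrightarrow> ip x (c *\<^sub>C y) = c * ip x y"
    and ip_nonneg: "x \<in> V \<Longrightarrow> 0 \<le> Re (ip x x)"
begin

abbreviation snorm :: "'a \<Rightarrow> real" where "snorm \<equiv> seminorm_of ip"

lemma snorm_nonneg: "x \<in> V \<Longrightarrow> 0 \<le> snorm x"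
  by (simp add: seminorm_of_def ip_nonneg)

lemma snorm_power2: "x \<in> V \<Longrightarrow> (snorm x)\<^sup>2 = Re (ip x x)"
  by (simp add: seminorm_of_def ip_nonneg)

lemma minus_mem: "x \<in> V \<Longrightarrow> - x \<in> V"
  by (simp add: minus_eq_scaleC scaleC_mem)

lemma diff_mem: "x \<in> V \<Longrightarrow> y \<in> V \<Longrightarrow> x - y \<in> V"
  using add_mem[of x "- y"] minus_mem by simp

lemma ip_add_left: "x \<in> V \<Longrightarrow> y \<in> V \<Longrightarrow> z \<in> V \<Longrightarrow> ip (x + y) z = ip x z + ip y z"
  using ip_commute[of "x + y" z] ip_commute[of x z] ip_commute[of y z]
  by (simp add: add_mem ip_add_right)

lemma ip_scaleC_left: "x \<in> V \<Longrightarrow> y \<in> V \<Longrightarrow> ip (c *\<^sub>C x) y = cnj c * ip x y"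
  using ip_commute[of "c *\<^sub>C x" y] ip_commute[of x y] by (simp add: scaleC_mem ip_scaleC_right)

lemma ip_minus_right: "x \<in> V \<Longrightarrow> y \<in> V \<Longrightarrow> ip x (- y) = - ip x y"
  by (simp add: minus_eq_scaleC ip_scaleC_right)

lemma ip_diff_right: "x \<in> V \<Longrightarrow> y \<in> V \<Longrightarrow> z \<in> V \<Longrightarrow> ip x (y - z) = ip x y - ip x z"
  using ip_add_right[of x y "- z"] by (simp add: minus_mem ip_minus_right)

lemma ip_diff_left: "x \<in> V \<Longrightarrow> y \<in> V \<Longrightarrow> z \<in> V \<Longrightarrow> ip (x - y) z = ip x z - ip y z"
  using ip_commute[of "x - y" z] ip_commute[of x z] ip_commute[of y z]
  by (simp add: diff_mem ip_diff_right)

lemma Re_ip_commute: "x \<in> V \<Longrightarrow> y \<in> V \<Longrightarrow> Re (ip y x) = Re (ip x y)"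
  using ip_commute[of y x] by simp

lemma snorm_add_power2:
  "x \<in> V \<Longrightarrow> y \<in> V \<Longrightarrow> (snorm (x + y))\<^sup>2 = (snorm x)\<^sup>2 + 2 * Re (ip x y) + (snorm y)\<^sup>2"
  by (simp add: snorm_power2 add_mem ip_add_left ip_add_right Re_ip_commute)

lemma snorm_scaleC_power2:
  "x \<in> V \<Longrightarrow> (snorm (c *\<^sub>C x))\<^sup>2 = (cmod c)\<^sup>2 * (snorm x)\<^sup>2"
proof -
  assume x: "x \<in> V"
  have "ip (c *\<^sub>C x) (c *\<^sub>C x) = (c * cnj c) * ip x x"
    using x by (simp add: scaleC_mem ip_scaleC_left ip_scaleC_right)
  also have "c * cnj c = of_real ((cmod c)\<^sup>2)" by (simp add: complex_norm_square del: of_real_power)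
  finally show ?thesis using x by (simp add: snorm_power2 scaleC_mem)
qed

lemma snorm_scaleC: "x \<in> V \<Longrightarrow> snorm (c *\<^sub>C x) = cmod c * snorm x"
  using snorm_scaleC_power2[of x c]
  by (simp add: power_mult_distrib[symmetric] power2_eq_iff_nonneg snorm_nonneg scaleC_mem
      del: power_mult_distrib)

lemma snorm_minus: "x \<in> V \<Longrightarrow> snorm (- x) = snorm x"
  by (simp add: minus_eq_scaleC snorm_scaleC)

lemma snorm_diff_commute: "x \<in> V \<Longrightarrow> y \<in> V \<Longrightarrow> snorm (x - y) = snorm (y - x)"
  using snorm_minus[of "x - y"] by (simp add: diff_mem)

lemma snorm_zero: "snorm 0 = 0"
  using ip_add_right[of 0 0 0] zero_mem by (simp add: seminorm_of_def)

lemma parallelogram: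
  assumes "x \<in> V" "y \<in> V"
  shows "(snorm (x + y))\<^sup>2 + (snorm (x - y))\<^sup>2 = 2 * (snorm x)\<^sup>2 + 2 * (snorm y)\<^sup>2"
  using snorm_add_power2[of x y] snorm_add_power2[of x "- y"] assms
  by (simp add: minus_mem ip_minus_right snorm_minus)

lemma snorm_add_scale_power2:
  assumes "x \<in> V" "y \<in> V"
  shows "(snorm (x + of_real t *\<^sub>C y))\<^sup>2 = (snorm x)\<^sup>2 + 2 * t * Re (ip x y) + t\<^sup>2 * (snorm y)\<^sup>2"
  using assms by (simp add: snorm_add_power2 scaleC_mem ip_scaleC_right snorm_scaleC_power2)

text \<open>The quadratic polynomial \<open>t \<mapsto> (snorm (x + t y))\<^sup>2\<close> is nonnegative.\<close>

lemma Re_cauchy_schwarz: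
  assumes "x \<in> V" "y \<in> V"
  shows "Re (ip x y) \<le> snorm x * snorm y"
proof -
  have "(Re (ip x y))\<^sup>2 \<le> (snorm x)\<^sup>2 * (snorm y)\<^sup>2"
    by (rule quadratic_nonneg_imp_discriminant_le)
      (simp_all add: snorm_add_scale_power2[OF assms, symmetric])
  then have "\<bar>Re (ip x y)\<bar> \<le> \<bar>snorm x * snorm y\<bar>"
    by (simp only: abs_le_square_iff power_mult_distrib)
  then show ?thesis using snorm_nonneg assms by (simp add: abs_mult)
qed

lemma cauchy_schwarz:
  assumes xy: "x \<in> V" "y \<in> V"
  shows "cmod (ip x y) \<le> snorm x * snorm y"
proof (cases "ip x y = 0")
  case False
  \<comment> \<open>a phase that makes the inner product real and nonnegative\<close>
  define c where "c = cnj (ip x y) / cmod (ip x y)"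
  have c: "cmod c = 1" using False by (simp add: c_def norm_divide)
  have "c * ip x y = cmod (ip x y)"
    using False
    by (simp add: c_def field_simps) (metis complex_norm_square mult.commute power2_eq_square of_real_mult)
  then have "cmod (ip x y) = Re (ip x (c *\<^sub>C y))" using xy by (simp add: ip_scaleC_right)
  also have "\<dots> \<le> snorm x * snorm (c *\<^sub>C y)" using xy by (intro Re_cauchy_schwarz scaleC_mem)
  finally show ?thesis using xy c by (simp add: snorm_scaleC)
qed (simp add: snorm_nonneg xy)

lemma snorm_triangle:
  assumes "x \<in> V" "y \<in> V"
  shows "snorm (x + y) \<le> snorm x + snorm y"
proof (rule power2_le_imp_le)
  show "(snorm (x + y))\<^sup>2 \<le> (snorm x + snorm y)\<^sup>2"
    using Re_cauchy_schwarz[OF assms] assms by (simp add: snorm_add_power2 power2_sum)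
qed (simp add: snorm_nonneg assms)

lemma snorm_diff_triangle:
  assumes "x \<in> V" "y \<in> V" "z \<in> V"
  shows "snorm (x - z) \<le> snorm (x - y) + snorm (y - z)"
  using snorm_triangle[of "x - y" "y - z"] assms by (simp add: diff_mem)

lemma abs_snorm_diff_le:
  assumes "x \<in> V" "y \<in> V"
  shows "\<bar>snorm x - snorm y\<bar> \<le> snorm (x - y)"
  using snorm_triangle[of "x - y" y] snorm_triangle[of "y - x" x] assms
  by (simp add: diff_mem snorm_diff_commute[of y x] abs_le_iff)

definition Cauchy_seq :: "(nat \<Rightarrow> 'a) \<Rightarrow> bool" where
  "Cauchy_seq x \<longleftrightarrow> range x \<subseteq> V \<and> (\<forall>e>0. \<exists>N. \<forall>m\<ge>N. \<forall>n\<ge>N. snorm (x m - x n) < e)"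

lemma Cauchy_seq_mem: "Cauchy_seq x \<Longrightarrow> x n \<in> V"
  by (auto simp: Cauchy_seq_def)

lemma Cauchy_seq_convergent_snorm:
  assumes "Cauchy_seq x"
  shows "convergent (\<lambda>n. snorm (x n))"
proof -
  have "Cauchy (\<lambda>n. snorm (x n))"
    unfolding Cauchy_def dist_real_def
    using assms abs_snorm_diff_le[OF Cauchy_seq_mem[OF assms] Cauchy_seq_mem[OF assms]]
    by (meson Cauchy_seq_def order_le_less_trans)
  then show ?thesis by (simp add: Cauchy_convergent_iff)
qed

lemma Cauchy_seq_convergent_ip:
  assumes x: "Cauchy_seq x" and v: "v \<in> V"
  shows "convergent (\<lambda>n. ip (x n) v)"
proof -
  have "Cauchy (\<lambda>n. ip (x n) v)"
    unfolding Cauchy_def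
  proof (intro allI impI)
    fix e :: real assume e: "0 < e"
    then obtain N where N: "\<And>m n. m \<ge> N \<Longrightarrow> n \<ge> N \<Longrightarrow> snorm (x m - x n) < e / (snorm v + 1)"
      using x snorm_nonneg[OF v] unfolding Cauchy_seq_def
      by (metis add_nonneg_pos divide_pos_pos zero_less_one)
    show "\<exists>N. \<forall>m\<ge>N. \<forall>n\<ge>N. dist (ip (x m) v) (ip (x n) v) < e"
    proof (intro exI[of _ N] allI impI)
      fix m n assume mn: "m \<ge> N" "n \<ge> N"
      have "dist (ip (x m) v) (ip (x n) v) \<le> snorm (x m - x n) * snorm v"
        using cauchy_schwarz[of "x m - x n" v] Cauchy_seq_mem[OF x] v
        by (simp add: dist_norm diff_mem ip_diff_left)
      also have "\<dots> \<le> snorm (x m - x n) * (snorm v + 1)"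
        using Cauchy_seq_mem[OF x] by (intro mult_left_mono) (auto simp: snorm_nonneg diff_mem)
      also have "\<dots> < e"
        using N[OF mn] snorm_nonneg[OF v] by (simp add: field_simps)
      finally show "dist (ip (x m) v) (ip (x n) v) < e" .
    qed
  qed
  then show ?thesis by (simp add: Cauchy_convergent_iff)
qed

lemma Cauchy_seq_of_rate:
  assumes mem: "\<And>n. y n \<in> V"
    and rate: "\<And>m n. (snorm (y m - y n))\<^sup>2 \<le> 2 * inverse (real (Suc m)) + 2 * inverse (real (Suc n))"
  shows "Cauchy_seq y"
  unfolding Cauchy_seq_def
proof (intro conjI allI impI)
  fix e :: real assume "0 < e"
  then obtain N where N: "inverse (real (Suc N)) < e\<^sup>2 / 4"
    using reals_Archimedean[of "e\<^sup>2 / 4"] by auto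
  show "\<exists>N. \<forall>m\<ge>N. \<forall>n\<ge>N. snorm (y m - y n) < e"
  proof (intro exI[of _ N] allI impI)
    fix m n assume "N \<le> m" "N \<le> n"
    then have "inverse (real (Suc m)) \<le> inverse (real (Suc N))" "inverse (real (Suc n)) \<le> inverse (real (Suc N))"
      by (simp_all add: field_simps)
    then have "(snorm (y m - y n))\<^sup>2 < e\<^sup>2"
      using rate[of m n] N by linarith
    then show "snorm (y m - y n) < e"
      using \<open>0 < e\<close> by (simp add: power_less_imp_less_base)
  qed
qed (use mem in auto)

text \<open>
  The vector that represents \<open>f\<close> is the minimiser of \<open>q v = (snorm v)\<^sup>2 - 2 * Re (f v)\<close>.  A minimising
  sequence is Cauchy by the parallelogram law; since \<open>V\<close> need not be complete, the sequence itself
  takes the place of its limit.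
\<close>

lemma riesz_representation:
  assumes f_add: "\<And>u v. u \<in> V \<Longrightarrow> v \<in> V \<Longrightarrow> f (u + v) = f u + f v"
    and f_scaleC: "\<And>c v. v \<in> V \<Longrightarrow> f (c *\<^sub>C v) = c * f v"
    and f_bound: "\<And>v. v \<in> V \<Longrightarrow> cmod (f v) \<le> K * snorm v"
  obtains y where "Cauchy_seq y" "\<forall>v\<in>V. (\<lambda>n. ip (y n) v) \<longlonglongrightarrow> f v"
    "lim (\<lambda>n. snorm (y n)) \<le> \<bar>K\<bar>"
proof -
  define q where "q v = (snorm v)\<^sup>2 - 2 * Re (f v)" for v
  have q_lower: "- (K\<^sup>2) \<le> q v" if "v \<in> V" for v
  proof -
    have "Re (f v) \<le> K * snorm v"
      using f_bound[OF that] complex_Re_le_cmod[of "f v"] by linarith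
    then have "q v \<ge> (snorm v)\<^sup>2 - 2 * (K * snorm v)" unfolding q_def by simp
    moreover have "0 \<le> (snorm v - K)\<^sup>2" by simp
    ultimately show ?thesis by (simp add: power2_diff algebra_simps)
  qed
  define I where "I = Inf (q ` V)"
  have bdd: "bdd_below (q ` V)" using q_lower by (auto simp: bdd_below_def)
  have I: "I \<le> q v" if "v \<in> V" for v
    unfolding I_def using that bdd by (intro cInf_lower) auto
  have "\<exists>v\<in>V. q v < I + inverse (real (Suc n))" for n
  proof -
    have "Inf (q ` V) < I + inverse (real (Suc n))" by (simp add: I_def)
    from cInf_lessD[OF _ this] zero_mem show ?thesis by auto
  qed
  then obtain y where yV: "\<And>n. y n \<in> V" and y: "\<And>n. q (y n) < I + inverse (real (Suc n))"
    by metis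
  \<comment> \<open>the parallelogram law applied to the midpoint, at which \<open>q\<close> is at least \<open>I\<close>\<close>
  have "(snorm (u - v))\<^sup>2 \<le> 2 * (q u - I) + 2 * (q v - I)" if uv: "u \<in> V" "v \<in> V" for u v
  proof -
    define w where "w = (1 / 2 :: complex) *\<^sub>C (u + v)"
    have w: "w \<in> V" using uv by (simp add: w_def scaleC_mem add_mem)
    have "snorm w = snorm (u + v) / 2"
      using uv by (simp add: w_def snorm_scaleC add_mem norm_divide)
    then have "(snorm w)\<^sup>2 = (snorm (u + v))\<^sup>2 / 4"
      by (simp only: power_divide) simp
    moreover have "Re (f w) = (Re (f u) + Re (f v)) / 2" using uv by (simp add: w_def f_scaleC f_add add_mem)
    ultimately have "4 * q w = (snorm (u + v))\<^sup>2 - 4 * (Re (f u) + Re (f v))"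
      by (simp add: q_def field_simps)
    then show ?thesis using parallelogram[OF uv] I[OF w] by (simp add: q_def)
  qed
  from this[OF yV yV] y have rate:
    "(snorm (y m - y n))\<^sup>2 \<le> 2 * inverse (real (Suc m)) + 2 * inverse (real (Suc n))" for m n
    by (smt (verit, best))
  have Cy: "Cauchy_seq y" by (rule Cauchy_seq_of_rate[OF yV rate])
  \<comment> \<open>near the infimum of \<open>q\<close>, the derivative of \<open>q\<close> in every direction \<open>v\<close> is small\<close>
  have almost: "(Re (ip (y n) v) - Re (f v))\<^sup>2 \<le> inverse (real (Suc n)) * (snorm v)\<^sup>2"
    if v: "v \<in> V" for n v
  proof -
    have "0 \<le> (q (y n) - I) + 2 * t * (Re (ip (y n) v) - Re (f v)) + t\<^sup>2 * (snorm v)\<^sup>2" for t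
    proof -
      have "I \<le> q (y n + of_real t *\<^sub>C v)" using v yV by (intro I) (simp add: add_mem scaleC_mem)
      then show ?thesis using v yV
        by (simp add: q_def snorm_add_scale_power2 f_add f_scaleC scaleC_mem algebra_simps)
    qed
    then have "(Re (ip (y n) v) - Re (f v))\<^sup>2 \<le> (q (y n) - I) * (snorm v)\<^sup>2"
      by (rule quadratic_nonneg_imp_discriminant_le) simp
    also have "\<dots> \<le> inverse (real (Suc n)) * (snorm v)\<^sup>2"
      using y[of n] by (intro mult_right_mono) auto
    finally show ?thesis .
  qed
  have Re_lim: "(\<lambda>n. Re (ip (y n) v)) \<longlonglongrightarrow> Re (f v)" if v: "v \<in> V" for v
  proof -
    have *: "(\<lambda>n. inverse (real (Suc n)) * (snorm v)\<^sup>2) \<longlonglongrightarrow> 0"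
      by (rule tendsto_mult_left_zero[OF LIMSEQ_inverse_real_of_nat])
    have "(\<lambda>n. (Re (ip (y n) v) - Re (f v))\<^sup>2) \<longlonglongrightarrow> 0"
      by (rule tendsto_sandwich[OF _ _ tendsto_const *])
        (simp, intro always_eventually allI almost[OF v])
    from tendsto_real_sqrt[OF this] have "(\<lambda>n. Re (ip (y n) v) - Re (f v)) \<longlonglongrightarrow> 0"
      by (simp add: tendsto_rabs_zero_iff)
    then show ?thesis by (simp add: LIM_zero_iff)
  qed
  have lim: "(\<lambda>n. ip (y n) v) \<longlonglongrightarrow> f v" if v: "v \<in> V" for v
  proof -
    have "(\<lambda>n. - Re (ip (y n) (\<i> *\<^sub>C v))) \<longlonglongrightarrow> - Re (f (\<i> *\<^sub>C v))"
      using Re_lim[OF scaleC_mem[OF v]] by (intro tendsto_minus)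
    then have "(\<lambda>n. Im (ip (y n) v)) \<longlonglongrightarrow> Im (f v)"
      using v yV by (simp add: ip_scaleC_right f_scaleC)
    with Re_lim[OF v] show ?thesis by (simp add: tendsto_complex_iff)
  qed
  define L where "L = lim (\<lambda>n. snorm (y n))"
  have L: "(\<lambda>n. snorm (y n)) \<longlonglongrightarrow> L"
    unfolding L_def using Cauchy_seq_convergent_snorm[OF Cy] by (simp add: convergent_LIMSEQ_iff)
  \<comment> \<open>in the limit, \<open>f\<close> takes the value \<open>L\<^sup>2\<close> at its representing vector\<close>
  have "L\<^sup>2 \<le> K * L"
  proof -
    have "snorm (y n) ^ 2 - K * snorm (y n) \<le> sqrt (inverse (real (Suc n)) * (snorm (y n))\<^sup>2)" for n
    proof -
      have "snorm (y n) ^ 2 - K * snorm (y n) \<le> Re (ip (y n) (y n)) - Re (f (y n))"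
        using f_bound[OF yV[of n]] complex_Re_le_cmod[of "f (y n)"] snorm_power2[OF yV[of n]] by linarith
      also have "\<dots> \<le> sqrt (inverse (real (Suc n)) * (snorm (y n))\<^sup>2)"
        using almost[OF yV[of n], of n] by (intro real_le_rsqrt)
      finally show ?thesis .
    qed
    moreover have "(\<lambda>n. snorm (y n) ^ 2 - K * snorm (y n)) \<longlonglongrightarrow> L\<^sup>2 - K * L"
      by (intro tendsto_intros L)
    moreover have "(\<lambda>n. sqrt (inverse (real (Suc n)) * (snorm (y n))\<^sup>2)) \<longlonglongrightarrow> sqrt (0 * L\<^sup>2)"
      by (intro tendsto_intros L LIMSEQ_inverse_real_of_nat)
    ultimately have "L\<^sup>2 - K * L \<le> sqrt (0 * L\<^sup>2)" by (blast intro: LIMSEQ_le)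
    then show ?thesis by simp
  qed
  moreover have "L \<ge> 0" using L by (rule LIMSEQ_le_const) (auto simp: snorm_nonneg yV)
  ultimately have "L \<le> \<bar>K\<bar>"
    by (cases "L = 0") (auto simp: power2_eq_square)
  then show ?thesis using that[OF Cy] lim by (simp add: L_def)
qed

end

section \<open>Adjoints of operators\<close>

lemma Im_cinner_self [simp]: "Im (cinner (x :: 'h::chilbert_space) x) = 0"
  using arg_cong[OF cinner_commute[of x x], of Im] by simp

lemma seminorm_of_cinner: "seminorm_of cinner (x :: 'h::chilbert_space) = norm x"
  by (simp add: seminorm_of_def norm_eq_sqrt_inner inner_eq_Re_cinner)

lemma neg_eq_scaleC: "- x = (-1) *\<^sub>C (x :: 'h::chilbert_space)"
  using scaleR_scaleC[of "-1" x] by simp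

interpretation hilbert: semi_inner_product "UNIV :: 'h::chilbert_space set" cinner
proof
  fix x y :: 'h
  show "cinner x y = cnj (cinner y x)" by (rule cinner_commute)
  show "0 \<le> Re (cinner x x)" by (simp flip: inner_eq_Re_cinner)
  show "- x = (-1) *\<^sub>C x" by (rule neg_eq_scaleC)
qed (simp_all add: cinner_add_right cinner_scaleC_right)

lemma cinner_eqI:
  fixes x y :: "'h::chilbert_space"
  assumes "\<And>z. cinner x z = cinner y z"
  shows "x = y"
proof -
  have "cinner (x - y) (x - y) = 0" using assms by (simp add: hilbert.ip_diff_left)
  then have "inner (x - y) (x - y) = 0" by (simp add: inner_eq_Re_cinner)
  then show ?thesis by simp
qed

lemma cinner_axis_left: "cinner (axis i x) v = cinner x (v $ i)"
  for x :: "'h::chilbert_space" and v :: "'h ^ 'd::finite"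
proof -
  have [simp]: "cinner (0 :: 'h) z = 0" for z
    using hilbert.ip_add_left[of "0 :: 'h" 0 z] by simp
  have "cinner (axis i x) v = (\<Sum>j\<in>UNIV. if j = i then cinner x (v $ i) else 0)"
    unfolding cinner_vec_def by (intro sum.cong) (auto simp: axis_def)
  then show ?thesis by simp
qed

lemma cinner_axis_right: "cinner v (axis i x) = cinner (v $ i) x"
  for x :: "'h::chilbert_space" and v :: "'h ^ 'd::finite"
  using cinner_axis_left[of i x v] cinner_commute[of v "axis i x"] cinner_commute[of "v $ i" x] by simp

lemma riesz_hilbert:
  fixes f :: "'h::chilbert_space \<Rightarrow> complex"
  assumes "\<And>u v. f (u + v) = f u + f v" "\<And>c v. f (c *\<^sub>C v) = c * f v"
    "\<And>v. cmod (f v) \<le> K * norm v"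
  shows "\<exists>y. \<forall>v. f v = cinner y v"
proof -
  have "cmod (f v) \<le> K * seminorm_of cinner v" for v
    using assms(3) by (simp add: seminorm_of_cinner)
  from hilbert.riesz_representation[of f K, OF assms(1,2) this]
  obtain y where y: "hilbert.Cauchy_seq y" and lim: "\<forall>v\<in>UNIV. (\<lambda>n. cinner (y n) v) \<longlonglongrightarrow> f v"
    by blast
  have "Cauchy y"
    using y by (simp add: hilbert.Cauchy_seq_def seminorm_of_cinner Cauchy_def dist_norm)
  then have "convergent y" by (simp add: Cauchy_convergent_iff)
  then obtain z where z: "y \<longlonglongrightarrow> z" by (auto simp: convergent_def)
  have "f v = cinner z v" for v
  proof (rule LIMSEQ_unique[OF lim[rule_format, OF UNIV_I]])
    have lim0: "(\<lambda>n. norm (y n - z) * norm v) \<longlonglongrightarrow> 0"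
      by (intro tendsto_mult_left_zero tendsto_norm_zero LIM_zero z)
    have "\<forall>n. norm (cinner (y n) v - cinner z v) \<le> norm (y n - z) * norm v"
      using hilbert.cauchy_schwarz[of "y _ - z" v] by (simp add: seminorm_of_cinner hilbert.ip_diff_left)
    from Lim_null_comparison[OF always_eventually[OF this] lim0]
    have "(\<lambda>n. cinner (y n) v - cinner z v) \<longlonglongrightarrow> 0" .
    then show "(\<lambda>n. cinner (y n) v) \<longlonglongrightarrow> cinner z v" by (simp add: LIM_zero_iff)
  qed
  then show ?thesis by blast
qed

lemma bop_eqI: "(\<And>x. bop_apply a x = bop_apply b x) \<Longrightarrow> a = b"
  by (metis bop_apply_inject ext)

lemma bop_apply_add: "bop_apply a (x + y) = bop_apply a x + bop_apply a y"
  by (simp add: linear_add linear_bop_apply)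

lemma bop_apply_scaleC: "bop_apply a (c *\<^sub>C x) = c *\<^sub>C bop_apply a x"
  using bop_apply[of a] by simp

lemma bop_apply_bounded: obtains K where "K \<ge> 0" "\<And>x. norm (bop_apply a x) \<le> K * norm x"
  using bounded_linear.nonneg_bounded[of "bop_apply a"] bop_apply[of a] by (auto simp: mult.commute)

text \<open>For every \<open>y\<close>, the Riesz theorem applies to the functional \<open>x \<mapsto> cinner y (a x)\<close>.\<close>

lemma adj_exists:
  fixes a :: "'h::chilbert_space bop"
  shows "\<exists>b. \<forall>x y. cinner (bop_apply a x) y = cinner x (bop_apply b y)"
proof -
  obtain K where K: "K \<ge> 0" "\<And>x. norm (bop_apply a x) \<le> K * norm x"
    using bop_apply_bounded by blast
  have "\<exists>z. \<forall>x. cinner y (bop_apply a x) = cinner z x" for y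
  proof (rule riesz_hilbert[where K = "norm y * K"])
    fix v
    have "cmod (cinner y (bop_apply a v)) \<le> norm y * norm (bop_apply a v)"
      using hilbert.cauchy_schwarz[of y "bop_apply a v"] by (simp add: seminorm_of_cinner)
    also have "\<dots> \<le> norm y * (K * norm v)" by (intro mult_left_mono K) simp
    finally show "cmod (cinner y (bop_apply a v)) \<le> norm y * K * norm v" by (simp add: mult.assoc)
  qed (simp_all add: bop_apply_add bop_apply_scaleC cinner_add_right cinner_scaleC_right)
  then obtain b where b: "\<And>y x. cinner y (bop_apply a x) = cinner (b y) x" by metis
  have b_add: "b (x + y) = b x + b y" for x y
    by (rule cinner_eqI) (simp add: b[symmetric] hilbert.ip_add_left)
  have b_scaleC: "b (c *\<^sub>C x) = c *\<^sub>C b x" for c x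
    by (rule cinner_eqI) (simp add: b[symmetric] hilbert.ip_scaleC_left)
  have "norm (b y) \<le> norm y * K" for y
  proof (cases "b y = 0")
    case False
    have "(norm (b y))\<^sup>2 = Re (cinner y (bop_apply a (b y)))"
      by (simp add: b power2_norm_eq_inner inner_eq_Re_cinner)
    also have "\<dots> \<le> norm y * norm (bop_apply a (b y))"
      using hilbert.Re_cauchy_schwarz[of y "bop_apply a (b y)"] by (simp add: seminorm_of_cinner)
    also have "\<dots> \<le> norm y * (K * norm (b y))" by (intro mult_left_mono K) simp
    finally have "norm (b y) * norm (b y) \<le> (norm y * K) * norm (b y)"
      by (simp add: power2_eq_square mult.assoc)
    then show ?thesis using False by simp
  qed (use K in simp)
  then have "bounded_linear b"
    by (intro bounded_linear_intro) (auto simp: b_add b_scaleC scaleR_scaleC)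
  then have "bop_apply (Bop b) = b" by (intro Bop_inverse) (simp add: b_scaleC)
  moreover have "cinner (bop_apply a x) y = cinner x (b y)" for x y
    using b[of y x] cinner_commute[of y "bop_apply a x"] cinner_commute[of "b y" x] by simp
  ultimately show ?thesis by (intro exI[of _ "Bop b"]) simp
qed

lemma adj_unique:
  assumes b: "\<And>x y. cinner (bop_apply a x) y = cinner x (bop_apply b y)"
  shows "adj a = b"
  unfolding adj_def
proof (rule the_equality)
  fix b' assume b': "\<forall>x y. cinner (bop_apply a x) y = cinner x (bop_apply b' y)"
  show "b' = b"
  proof (rule bop_eqI, rule cinner_eqI)
    fix x z
    have "cinner z (bop_apply b' x) = cinner z (bop_apply b x)"
      using b[of z x] b'[rule_format, of z x] by (rule trans[OF sym, rotated])
    then show "cinner (bop_apply b' x) z = cinner (bop_apply b x) z"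
      using cinner_commute[of "bop_apply b' x" z] cinner_commute[of "bop_apply b x" z] by (simp only:)
  qed
qed (simp add: b)

lemma cinner_adj_right: "cinner x (bop_apply (adj a) y) = cinner (bop_apply a x) y"
  using adj_exists[of a] adj_unique by metis

lemma cinner_adj_left: "cinner (bop_apply (adj a) x) y = cinner x (bop_apply a y)"
  using cinner_adj_right[of y a x] cinner_commute[of "bop_apply (adj a) x" y]
    cinner_commute[of x "bop_apply a y"] by simp

lemma adj_adj [simp]: "adj (adj a) = a"
  by (rule adj_unique) (simp add: cinner_adj_left)

lemma adj_mult: "adj (a * b) = adj b * adj a"
  by (rule adj_unique) (simp add: times_bop.rep_eq cinner_adj_right)

lemma adj_add: "adj (a + b) = adj a + adj b"
  by (rule adj_unique)
    (simp add: plus_bop.rep_eq cinner_adj_right hilbert.ip_add_left cinner_add_right)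

lemma adj_scaleC: "adj (c *\<^sub>C a) = cnj c *\<^sub>C adj a"
  by (rule adj_unique)
    (simp add: scaleC_bop.rep_eq cinner_adj_right hilbert.ip_scaleC_left cinner_scaleC_right)

lemma adj_one [simp]: "adj 1 = 1"
  by (rule adj_unique) (simp add: one_bop.rep_eq)

lemma entry_adj: "entry (adj A) i j = adj (entry A j i)"
  by (rule adj_unique[symmetric])
    (simp add: entry.rep_eq cinner_adj_right cinner_axis_right[symmetric] cinner_axis_left[symmetric])

lemma scaleC_bop_add_right: "c *\<^sub>C (a + b) = c *\<^sub>C a + c *\<^sub>C (b :: 'h::chilbert_space bop)"
  by transfer (simp add: scaleC_add_right)

lemma scaleC_bop_scaleC: "c *\<^sub>C d *\<^sub>C a = (c * d) *\<^sub>C (a :: 'h::chilbert_space bop)"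
  by transfer (simp add: scaleC_scaleC)

lemma scaleC_bop_one [simp]: "1 *\<^sub>C a = (a :: 'h::chilbert_space bop)"
  by transfer simp

lemma scaleC_bop_zero_left [simp]: "0 *\<^sub>C a = (0 :: 'h::chilbert_space bop)"
proof (rule bop_eqI)
  fix x
  have "0 *\<^sub>C (y :: 'h) = 0" for y using scaleR_scaleC[of 0 y] by simp
  then show "bop_apply (0 *\<^sub>C a) x = bop_apply 0 x" by (simp add: scaleC_bop.rep_eq zero_bop.rep_eq)
qed

lemma neg_bop_eq_scaleC: "- a = (-1) *\<^sub>C (a :: 'h::chilbert_space bop)"
  by transfer (simp add: neg_eq_scaleC[symmetric])

lemma mult_scaleC_left: "(c *\<^sub>C a) * b = c *\<^sub>C (a * b :: 'h::chilbert_space bop)"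
  by transfer simp

lemma mult_scaleC_right: "a * (c *\<^sub>C b) = c *\<^sub>C (a * b :: 'h::chilbert_space bop)"
  by transfer simp

lemma adj_minus: "adj (- a) = - adj a"
  by (simp add: neg_bop_eq_scaleC adj_scaleC)

lemma adj_diff: "adj (a - b) = adj a - adj b"
  using adj_add[of a "- b"] by (simp add: adj_minus)

lemma entry_add: "entry (A + B) i j = entry A i j + entry B i j"
  by (rule bop_eqI) (simp add: entry.rep_eq plus_bop.rep_eq)

lemma entry_scaleC: "entry (c *\<^sub>C A) i j = c *\<^sub>C entry A i j"
  by (rule bop_eqI) (simp add: entry.rep_eq scaleC_bop.rep_eq scaleC_vec_def)

lemma entry_diff: "entry (A - B) i j = entry A i j - entry B i j"
  by (rule bop_eqI) (simp add: entry.rep_eq minus_bop.rep_eq)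

lemma entry_one: "entry 1 i j = (if i = j then 1 else 0)"
  by (rule bop_eqI) (simp add: entry.rep_eq one_bop.rep_eq zero_bop.rep_eq axis_def)

lemma matrix_eqI: "(\<And>i j. entry A i j = entry B i j) \<Longrightarrow> A = B"
  by (metis bop_of_matrix_entry ext)

section \<open>Tracial *-algebras of operators\<close>

text \<open>
  The properties that pass from \<open>M\<close> to the matrices over \<open>M\<close> by direct computation, so that everything
  below applies to both \<open>M\<close> with \<open>\<phi>\<close> and \<open>mat_alg M\<close> with \<open>mat_trace \<phi>\<close>.
\<close>

locale tracial_star_algebra =
  fixes M :: "'h::chilbert_space bop set" and \<phi> :: "'h bop \<Rightarrow> complex"
  assumes one_mem: "1 \<in> M"
    and add_mem: "a \<in> M \<Longrightarrow> b \<in> M \<Longrightarrow> a + b \<in> M"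
    and mult_mem: "a \<in> M \<Longrightarrow> b \<in> M \<Longrightarrow> a * b \<in> M"
    and scaleC_mem: "a \<in> M \<Longrightarrow> c *\<^sub>C a \<in> M"
    and adj_mem: "a \<in> M \<Longrightarrow> adj a \<in> M"
    and state_add: "a \<in> M \<Longrightarrow> b \<in> M \<Longrightarrow> \<phi> (a + b) = \<phi> a + \<phi> b"
    and state_scaleC: "a \<in> M \<Longrightarrow> \<phi> (c *\<^sub>C a) = c * \<phi> a"
    and state_one: "\<phi> 1 = 1"
    and state_positive: "a \<in> M \<Longrightarrow> \<phi> (adj a * a) \<in> \<real>\<^sub>\<ge>\<^sub>0"
    and state_trace: "a \<in> M \<Longrightarrow> b \<in> M \<Longrightarrow> \<phi> (a * b) = \<phi> (b * a)"

lemma commutant_one: "1 \<in> commutant S"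
  and commutant_add: "a \<in> commutant S \<Longrightarrow> b \<in> commutant S \<Longrightarrow> a + b \<in> commutant S"
  and commutant_mult: "a \<in> commutant S \<Longrightarrow> b \<in> commutant S \<Longrightarrow> a * b \<in> commutant S"
  and commutant_scaleC: "a \<in> commutant S \<Longrightarrow> c *\<^sub>C a \<in> commutant S"
  by (auto simp: commutant_def distrib_left distrib_right mult_scaleC_left mult_scaleC_right)
    (metis mult.assoc)

lemma (in wstar_probability_space) tracial_star_algebra: "tracial_star_algebra M \<phi>"
proof -
  have M: "M = commutant (commutant M)" and adj: "\<And>a. a \<in> M \<Longrightarrow> adj a \<in> M"
    using von_neumann by (auto simp: von_neumann_algebra_def)
  show ?thesis
  proof
    show "1 \<in> M" by (subst M) (rule commutant_one)
    show "a + b \<in> M" if "a \<in> M" "b \<in> M" for a b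
      using that commutant_add[of a "commutant M" b] M by simp
    show "a * b \<in> M" if "a \<in> M" "b \<in> M" for a b
      using that commutant_mult[of a "commutant M" b] M by simp
    show "c *\<^sub>C a \<in> M" if "a \<in> M" for a c
      using that commutant_scaleC[of a "commutant M" c] M by simp
  qed (fact adj state_add state_scaleC state_one state_positive state_trace)+
qed

context tracial_star_algebra
begin

lemma minus_mem: "a \<in> M \<Longrightarrow> - a \<in> M"
  by (simp add: neg_bop_eq_scaleC scaleC_mem)

lemma diff_mem: "a \<in> M \<Longrightarrow> b \<in> M \<Longrightarrow> a - b \<in> M"
  using add_mem[of a "- b"] by (simp add: minus_mem)

lemma zero_mem: "0 \<in> M"
  using diff_mem[OF one_mem one_mem] by simp

lemma sum_mem: "(\<And>k. k \<in> K \<Longrightarrow> f k \<in> M) \<Longrightarrow> sum f K \<in> M"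
  by (induction K rule: infinite_finite_induct) (auto simp: zero_mem add_mem)

lemma state_zero: "\<phi> 0 = 0"
  using state_add[OF zero_mem zero_mem] by simp

lemma state_minus: "a \<in> M \<Longrightarrow> \<phi> (- a) = - \<phi> a"
  by (simp add: neg_bop_eq_scaleC state_scaleC)

lemma state_diff: "a \<in> M \<Longrightarrow> b \<in> M \<Longrightarrow> \<phi> (a - b) = \<phi> a - \<phi> b"
  using state_add[of a "- b"] by (simp add: minus_mem state_minus)

lemma state_sum: "(\<And>k. k \<in> K \<Longrightarrow> f k \<in> M) \<Longrightarrow> \<phi> (sum f K) = (\<Sum>k\<in>K. \<phi> (f k))"
  by (induction K rule: infinite_finite_induct) (auto simp: state_zero state_add sum_mem)

lemma Im_state_positive: "a \<in> M \<Longrightarrow> Im (\<phi> (adj a * a)) = 0"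
  using state_positive[of a] by (simp add: complex_nonneg_Reals_iff)

text \<open>Polarisation: \<open>\<phi> ((a + c 1)\<^sup>* (a + c 1))\<close> is real for \<open>c = 1\<close> and \<open>c = \<i>\<close>.\<close>

lemma state_adj: "a \<in> M \<Longrightarrow> \<phi> (adj a) = cnj (\<phi> a)"
proof -
  assume a: "a \<in> M"
  have *: "Im (\<phi> (adj (a + c *\<^sub>C 1) * (a + c *\<^sub>C 1))) = Im (c * \<phi> (adj a) + cnj c * \<phi> a)" for c
  proof -
    have "\<phi> (adj (a + c *\<^sub>C 1) * (a + c *\<^sub>C 1)) =
        \<phi> (adj a * a) + c * \<phi> (adj a) + cnj c * \<phi> a + c * cnj c"
      using a by (simp add: adj_add adj_scaleC distrib_left distrib_right mult_scaleC_left
          mult_scaleC_right state_add state_scaleC scaleC_bop_scaleC mult_mem adj_mem scaleC_mem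
          add_mem one_mem state_one algebra_simps)
    moreover have "Im (c * cnj c) = 0" by (simp add: complex_mult_cnj)
    ultimately show ?thesis using Im_state_positive[OF a] by simp
  qed
  have "Im (\<phi> (adj (a + c *\<^sub>C 1) * (a + c *\<^sub>C 1))) = 0" for c
    using a by (intro Im_state_positive) (simp add: add_mem scaleC_mem one_mem)
  from this[of 1] this[of \<i>] show ?thesis unfolding * by (simp add: complex_eq_iff)
qed

sublocale semi_inner_product M "\<lambda>a b. \<phi> (adj a * b)"
  rewrites "seminorm_of (\<lambda>a b. \<phi> (adj a * b)) = norm2 \<phi>"
    and "semi_inner_product.Cauchy_seq M (\<lambda>a b. \<phi> (adj a * b)) x \<longleftrightarrow> x \<in> cauchy2 M \<phi>"
proof -
  show *: "semi_inner_product M (\<lambda>a b. \<phi> (adj a * b))"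
  proof
    fix x y assume xy: "x \<in> M" "y \<in> M"
    show "\<phi> (adj x * y) = cnj (\<phi> (adj y * x))"
      using xy state_adj[of "adj y * x"] by (simp add: adj_mult mult_mem adj_mem)
  qed (use state_positive in \<open>simp_all add: zero_mem add_mem scaleC_mem neg_bop_eq_scaleC distrib_left
      mult_scaleC_right state_add state_scaleC mult_mem adj_mem complex_nonneg_Reals_iff\<close>)
  show n: "seminorm_of (\<lambda>a b. \<phi> (adj a * b)) = norm2 \<phi>"
    by (simp add: fun_eq_iff seminorm_of_def norm2_def)
  show "semi_inner_product.Cauchy_seq M (\<lambda>a b. \<phi> (adj a * b)) x \<longleftrightarrow> x \<in> cauchy2 M \<phi>"
    unfolding semi_inner_product.Cauchy_seq_def[OF *] n by (simp add: cauchy2_def)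
qed

lemma norm2_adj: "a \<in> M \<Longrightarrow> norm2 \<phi> (adj a) = norm2 \<phi> a"
  by (simp add: norm2_def state_trace adj_mem)

lemma cmod_state_mult_le:
  assumes "x \<in> M" "a \<in> M"
  shows "cmod (\<phi> (x * a)) \<le> norm2 \<phi> x * norm2 \<phi> a"
  using cauchy_schwarz[of "adj x" a] assms by (simp add: adj_mem norm2_adj)

end

section \<open>Generated algebras and words\<close>

lemma alg_gen_zero: "0 \<in> alg_gen S"
  using alg_gen_scaleC[OF alg_gen_one, of 0] by simp

lemma alg_gen_minus: "a \<in> alg_gen S \<Longrightarrow> - a \<in> alg_gen S"
  by (simp add: neg_bop_eq_scaleC alg_gen_scaleC)

lemma alg_gen_diff: "a \<in> alg_gen S \<Longrightarrow> b \<in> alg_gen S \<Longrightarrow> a - b \<in> alg_gen S"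
  using alg_gen_add[of a S "- b"] by (simp add: alg_gen_minus)

lemma alg_gen_sum: "(\<And>k. k \<in> K \<Longrightarrow> f k \<in> alg_gen S) \<Longrightarrow> sum f K \<in> alg_gen S"
  by (induction K rule: infinite_finite_induct) (auto simp: alg_gen_zero alg_gen_add)

lemma alg_gen_adj:
  assumes "\<And>s. s \<in> S \<Longrightarrow> adj s \<in> S" "a \<in> alg_gen S"
  shows "adj a \<in> alg_gen S"
  using assms(2)
  by induction (auto simp: adj_add adj_mult adj_scaleC intro: alg_gen.intros assms(1))

lemma (in tracial_star_algebra) alg_gen_subset:
  assumes "S \<subseteq> M" "a \<in> alg_gen S"
  shows "a \<in> M"
  using assms(2) by induction (use assms(1) in \<open>auto intro: one_mem add_mem mult_mem scaleC_mem\<close>)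

abbreviation word :: "('i \<Rightarrow> 'h::chilbert_space bop) \<Rightarrow> 'i list \<Rightarrow> 'h bop" where
  "word a w \<equiv> prod_list (map a w)"

lemma word_mem_alg_gen: "word a w \<in> alg_gen (range a)"
  by (induction w) (auto intro: alg_gen.intros)

text \<open>
  Conjugate relations are stated for words; this linear span makes them extend to the whole algebra.
\<close>

inductive_set word_span :: "('i \<Rightarrow> 'h::chilbert_space bop) \<Rightarrow> 'h bop set" for a where
  word: "word a w \<in> word_span a"
| add: "x \<in> word_span a \<Longrightarrow> y \<in> word_span a \<Longrightarrow> x + y \<in> word_span a"
| scaleC: "x \<in> word_span a \<Longrightarrow> c *\<^sub>C x \<in> word_span a"

lemma word_span_mult:
  assumes x: "x \<in> word_span a" and y: "y \<in> word_span a"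
  shows "x * y \<in> word_span a"
  using x
proof induction
  case (word w)
  from y show ?case
  proof induction
    case (word w')
    show ?case using word_span.word[of a "w @ w'"] by simp
  qed (auto simp: distrib_left mult_scaleC_right intro: word_span.intros)
qed (auto simp: distrib_right mult_scaleC_left intro: word_span.intros)

lemma alg_gen_range_eq_word_span: "alg_gen (range a) = word_span a"
proof (intro set_eqI iffI)
  fix x assume "x \<in> alg_gen (range a)"
  then show "x \<in> word_span a"
  proof induction
    case alg_gen_one
    show ?case using word_span.word[of a "[]"] by simp
  next
    case (alg_gen_base x)
    then obtain i where "x = a i" by blast
    then show ?case using word_span.word[of a "[i]"] by simp
  qed (auto intro: word_span.intros word_span_mult)
next
  fix x assume "x \<in> word_span a"
  then show "x \<in> alg_gen (range a)"
    by induction (auto intro: alg_gen.intros word_mem_alg_gen)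
qed

section \<open>Cauchy sequences as representatives in \<open>L\<^sup>2\<close>\<close>

lemma tendsto_of_tendsto_diff:
  fixes f g :: "nat \<Rightarrow> 'b::real_normed_vector"
  assumes f: "f \<longlonglongrightarrow> l" and h: "h \<longlonglongrightarrow> 0" and "\<And>n. norm (g n - f n) \<le> h n"
  shows "g \<longlonglongrightarrow> l"
proof -
  have "(\<lambda>n. g n - f n) \<longlonglongrightarrow> 0"
    by (rule Lim_null_comparison[OF always_eventually h]) (simp add: assms(3))
  from tendsto_add[OF this f] show ?thesis by simp
qed

context tracial_star_algebra
begin

definition l2_class :: "(nat \<Rightarrow> 'h bop) \<Rightarrow> 'h l2" where
  "l2_class x = l2_rel M \<phi> `` {x}"

lemma cauchy2_mem: "x \<in> cauchy2 M \<phi> \<Longrightarrow> x n \<in> M"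
  by (auto simp: cauchy2_def)

lemma cauchy2_const: "a \<in> M \<Longrightarrow> (\<lambda>_. a) \<in> cauchy2 M \<phi>"
  by (auto simp: cauchy2_def snorm_zero)

lemma cauchy2D:
  "x \<in> cauchy2 M \<phi> \<Longrightarrow> e > 0 \<Longrightarrow> \<exists>N. \<forall>m\<ge>N. \<forall>n\<ge>N. norm2 \<phi> (x m - x n) < e"
  by (simp add: cauchy2_def)

lemma norm2_tendsto_lim: "x \<in> cauchy2 M \<phi> \<Longrightarrow> (\<lambda>n. norm2 \<phi> (x n)) \<longlonglongrightarrow> lim (\<lambda>n. norm2 \<phi> (x n))"
  using Cauchy_seq_convergent_snorm by (simp add: convergent_LIMSEQ_iff)

lemma cauchy2_perturb:
  assumes x: "x \<in> cauchy2 M \<phi>" and y: "\<And>n. y n \<in> M" and lim: "(\<lambda>n. norm2 \<phi> (x n - y n)) \<longlonglongrightarrow> 0"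
  shows "y \<in> cauchy2 M \<phi>"
proof -
  have "\<exists>N. \<forall>m\<ge>N. \<forall>n\<ge>N. norm2 \<phi> (y m - y n) < e" if "e > 0" for e
  proof -
    from that have e: "e / 3 > 0" by simp
    obtain N1 where N1: "\<And>m n. m \<ge> N1 \<Longrightarrow> n \<ge> N1 \<Longrightarrow> norm2 \<phi> (x m - x n) < e / 3"
      using cauchy2D[OF x e] by blast
    obtain N2 where N2: "\<And>n. n \<ge> N2 \<Longrightarrow> norm2 \<phi> (x n - y n) < e / 3"
      using LIMSEQ_D[OF lim e] by force
    show ?thesis
    proof (intro exI[of _ "max N1 N2"] allI impI)
      fix m n assume mn: "max N1 N2 \<le> m" "max N1 N2 \<le> n"
      have "norm2 \<phi> (y m - y n) \<le> norm2 \<phi> (y m - x m) + norm2 \<phi> (x m - y n)"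
        by (intro snorm_diff_triangle y cauchy2_mem[OF x])
      also have "norm2 \<phi> (x m - y n) \<le> norm2 \<phi> (x m - x n) + norm2 \<phi> (x n - y n)"
        by (intro snorm_diff_triangle y cauchy2_mem[OF x])
      also have "norm2 \<phi> (y m - x m) = norm2 \<phi> (x m - y m)"
        by (intro snorm_diff_commute y cauchy2_mem[OF x])
      finally show "norm2 \<phi> (y m - y n) < e"
        using N1[of m n] N2[of m] N2[of n] mn by auto
    qed
  qed
  with y show ?thesis by (auto simp: cauchy2_def)
qed

lemma cauchy2_diff:
  assumes x: "x \<in> cauchy2 M \<phi>" and y: "y \<in> cauchy2 M \<phi>"
  shows "(\<lambda>n. x n - y n) \<in> cauchy2 M \<phi>"
proof -
  have "\<exists>N. \<forall>m\<ge>N. \<forall>n\<ge>N. norm2 \<phi> ((x m - y m) - (x n - y n)) < e" if "e > 0" for e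
  proof -
    from that have e: "e / 2 > 0" by simp
    obtain N1 where N1: "\<And>m n. m \<ge> N1 \<Longrightarrow> n \<ge> N1 \<Longrightarrow> norm2 \<phi> (x m - x n) < e / 2"
      using cauchy2D[OF x e] by blast
    obtain N2 where N2: "\<And>m n. m \<ge> N2 \<Longrightarrow> n \<ge> N2 \<Longrightarrow> norm2 \<phi> (y m - y n) < e / 2"
      using cauchy2D[OF y e] by blast
    show ?thesis
    proof (intro exI[of _ "max N1 N2"] allI impI)
      fix m n assume mn: "max N1 N2 \<le> m" "max N1 N2 \<le> n"
      have eq: "(x m - y m) - (x n - y n) = (x m - x n) + (y n - y m)" by simp
      have "norm2 \<phi> ((x m - y m) - (x n - y n)) \<le> norm2 \<phi> (x m - x n) + norm2 \<phi> (y n - y m)"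
        unfolding eq by (intro snorm_triangle diff_mem cauchy2_mem x y)
      then show "norm2 \<phi> ((x m - y m) - (x n - y n)) < e"
        using N1[of m n] N2[of n m] mn by auto
    qed
  qed
  then show ?thesis using x y by (auto simp: cauchy2_def diff_mem image_subset_iff)
qed

lemma l2_rel_iff:
  "(x, y) \<in> l2_rel M \<phi> \<longleftrightarrow>
    x \<in> cauchy2 M \<phi> \<and> y \<in> cauchy2 M \<phi> \<and> (\<lambda>n. norm2 \<phi> (x n - y n)) \<longlonglongrightarrow> 0"
  by (simp add: l2_rel_def)

lemma equiv_l2_rel: "equiv (cauchy2 M \<phi>) (l2_rel M \<phi>)"
proof (rule equivI)
  show "l2_rel M \<phi> \<subseteq> cauchy2 M \<phi> \<times> cauchy2 M \<phi>" by (auto simp: l2_rel_def)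
  show "refl_on (cauchy2 M \<phi>) (l2_rel M \<phi>)"
    by (auto simp: refl_on_def l2_rel_def snorm_zero)
  show "sym (l2_rel M \<phi>)"
  proof (rule symI)
    fix x y assume xy: "(x, y) \<in> l2_rel M \<phi>"
    then have "norm2 \<phi> (x n - y n) = norm2 \<phi> (y n - x n)" for n
      by (intro snorm_diff_commute) (auto simp: l2_rel_def cauchy2_mem)
    then show "(y, x) \<in> l2_rel M \<phi>" using xy by (simp add: l2_rel_def)
  qed
  show "trans (l2_rel M \<phi>)"
  proof (rule transI)
    fix x y z assume xy: "(x, y) \<in> l2_rel M \<phi>" and yz: "(y, z) \<in> l2_rel M \<phi>"
    have mem: "x n \<in> M" "y n \<in> M" "z n \<in> M" for n
      using xy yz by (auto simp: l2_rel_def cauchy2_mem)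
    have lim: "(\<lambda>n. norm2 \<phi> (x n - y n) + norm2 \<phi> (y n - z n)) \<longlonglongrightarrow> 0 + 0"
      using xy yz by (intro tendsto_add) (auto simp: l2_rel_def)
    have "(\<lambda>n. norm2 \<phi> (x n - z n)) \<longlonglongrightarrow> 0"
      by (rule tendsto_sandwich[OF _ _ tendsto_const lim[simplified]])
        (intro always_eventually allI snorm_nonneg diff_mem snorm_diff_triangle mem)+
    then show "(x, z) \<in> l2_rel M \<phi>" using xy yz by (simp add: l2_rel_def)
  qed
qed

lemma mem_l2_class: "y \<in> l2_class x \<longleftrightarrow> (x, y) \<in> l2_rel M \<phi>"
  by (simp add: l2_class_def)

lemma l2_class_self: "x \<in> cauchy2 M \<phi> \<Longrightarrow> x \<in> l2_class x"
  by (simp add: mem_l2_class l2_rel_iff snorm_zero)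

lemma l2_class_eq:
  "x \<in> cauchy2 M \<phi> \<Longrightarrow> y \<in> cauchy2 M \<phi> \<Longrightarrow> (\<lambda>n. norm2 \<phi> (x n - y n)) \<longlonglongrightarrow> 0 \<Longrightarrow>
    l2_class x = l2_class y"
  unfolding l2_class_def by (rule equiv_class_eq[OF equiv_l2_rel]) (simp add: l2_rel_iff)

lemma L2_eq: "L2 M \<phi> = l2_class ` cauchy2 M \<phi>"
  by (auto simp: L2_def quotient_def l2_class_def)

lemma l2_embed_eq: "l2_embed M \<phi> a = l2_class (\<lambda>_. a)"
  by (simp add: l2_embed_def l2_class_def)

text \<open>
  The next lemmas evaluate the functions on \<open>L\<^sup>2\<close>, which are defined by definite descriptions, on an
  arbitrary representative.
\<close>

lemma l2_norm_class:
  assumes x: "x \<in> cauchy2 M \<phi>"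
  shows "l2_norm \<phi> (l2_class x) = lim (\<lambda>n. norm2 \<phi> (x n))"
  unfolding l2_norm_def
proof (rule the_equality)
  show "\<forall>y\<in>l2_class x. (\<lambda>n. norm2 \<phi> (y n)) \<longlonglongrightarrow> lim (\<lambda>n. norm2 \<phi> (x n))"
  proof
    fix y assume "y \<in> l2_class x"
    then have y: "y \<in> cauchy2 M \<phi>" "(\<lambda>n. norm2 \<phi> (x n - y n)) \<longlonglongrightarrow> 0"
      by (auto simp: mem_l2_class l2_rel_iff)
    have "norm (norm2 \<phi> (y n) - norm2 \<phi> (x n)) \<le> norm2 \<phi> (x n - y n)" for n
      using abs_snorm_diff_le[of "x n" "y n"] cauchy2_mem[OF x] cauchy2_mem[OF y(1)]
      by (simp add: abs_minus_commute)
    from tendsto_of_tendsto_diff[OF norm2_tendsto_lim[OF x] y(2) this]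
    show "(\<lambda>n. norm2 \<phi> (y n)) \<longlonglongrightarrow> lim (\<lambda>n. norm2 \<phi> (x n))" .
  qed
  fix r assume "\<forall>y\<in>l2_class x. (\<lambda>n. norm2 \<phi> (y n)) \<longlonglongrightarrow> r"
  then have "(\<lambda>n. norm2 \<phi> (x n)) \<longlonglongrightarrow> r" using l2_class_self[OF x] by blast
  then show "r = lim (\<lambda>n. norm2 \<phi> (x n))" by (simp add: limI)
qed

lemma l2_dist_class:
  assumes x: "x \<in> cauchy2 M \<phi>" and y: "y \<in> cauchy2 M \<phi>"
  shows "(\<lambda>n. norm2 \<phi> (x n - y n)) \<longlonglongrightarrow> l2_dist \<phi> (l2_class x) (l2_class y)"
proof -
  define r where "r = lim (\<lambda>n. norm2 \<phi> (x n - y n))"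
  have lim: "(\<lambda>n. norm2 \<phi> (x n - y n)) \<longlonglongrightarrow> r"
    unfolding r_def by (rule norm2_tendsto_lim[OF cauchy2_diff[OF x y]])
  have "l2_dist \<phi> (l2_class x) (l2_class y) = r"
    unfolding l2_dist_def
  proof (rule the_equality)
    show "\<forall>x'\<in>l2_class x. \<forall>y'\<in>l2_class y. (\<lambda>n. norm2 \<phi> (x' n - y' n)) \<longlonglongrightarrow> r"
    proof (intro ballI)
      fix x' y' assume x'y': "x' \<in> l2_class x" "y' \<in> l2_class y"
      then have mem: "x n \<in> M" "x' n \<in> M" "y n \<in> M" "y' n \<in> M" for n
        by (auto simp: mem_l2_class l2_rel_iff cauchy2_mem)
      have h: "(\<lambda>n. norm2 \<phi> (x n - x' n) + norm2 \<phi> (y n - y' n)) \<longlonglongrightarrow> 0"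
        using x'y' tendsto_add[of "\<lambda>n. norm2 \<phi> (x n - x' n)" 0 sequentially "\<lambda>n. norm2 \<phi> (y n - y' n)" 0]
        by (simp add: mem_l2_class l2_rel_iff)
      have "norm (norm2 \<phi> (x' n - y' n) - norm2 \<phi> (x n - y n))
          \<le> norm2 \<phi> (x n - x' n) + norm2 \<phi> (y n - y' n)" for n
      proof -
        have "\<bar>norm2 \<phi> (x n - y n) - norm2 \<phi> (x' n - y' n)\<bar> \<le> norm2 \<phi> ((x n - y n) - (x' n - y' n))"
          by (intro abs_snorm_diff_le diff_mem mem)
        also have "(x n - y n) - (x' n - y' n) = (x n - x' n) + (y' n - y n)" by simp
        also have "norm2 \<phi> \<dots> \<le> norm2 \<phi> (x n - x' n) + norm2 \<phi> (y' n - y n)"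
          by (intro snorm_triangle diff_mem mem)
        also have "norm2 \<phi> (y' n - y n) = norm2 \<phi> (y n - y' n)"
          by (intro snorm_diff_commute mem)
        finally show ?thesis by (simp add: abs_minus_commute)
      qed
      from tendsto_of_tendsto_diff[OF lim h this]
      show "(\<lambda>n. norm2 \<phi> (x' n - y' n)) \<longlonglongrightarrow> r" .
    qed
    fix s assume "\<forall>x'\<in>l2_class x. \<forall>y'\<in>l2_class y. (\<lambda>n. norm2 \<phi> (x' n - y' n)) \<longlonglongrightarrow> s"
    then have "(\<lambda>n. norm2 \<phi> (x n - y n)) \<longlonglongrightarrow> s"
      using l2_class_self[OF x] l2_class_self[OF y] by blast
    then show "s = r" using lim LIMSEQ_unique by blast
  qed
  with lim show ?thesis by simp
qed

lemma state_mult_convergent: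
  assumes x: "x \<in> cauchy2 M \<phi>" and a: "a \<in> M"
  shows "convergent (\<lambda>n. \<phi> (x n * a))"
proof -
  have "convergent (\<lambda>n. cnj (\<phi> (adj (x n) * adj a)))"
    using Cauchy_seq_convergent_ip[OF x adj_mem[OF a]] by (auto simp: convergent_def intro: tendsto_cnj)
  moreover have "cnj (\<phi> (adj (x n) * adj a)) = \<phi> (x n * a)" for n
    using state_adj[of "adj (x n) * adj a"] cauchy2_mem[OF x] a
    by (simp add: adj_mult mult_mem adj_mem state_trace)
  ultimately show ?thesis by simp
qed

lemma l2_state_mult_class:
  assumes x: "x \<in> cauchy2 M \<phi>" and a: "a \<in> M"
  shows "(\<lambda>n. \<phi> (x n * a)) \<longlonglongrightarrow> l2_state_mult \<phi> (l2_class x) a"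
proof -
  obtain c where lim: "(\<lambda>n. \<phi> (x n * a)) \<longlonglongrightarrow> c"
    using state_mult_convergent[OF x a] by (auto simp: convergent_def)
  have "l2_state_mult \<phi> (l2_class x) a = c"
    unfolding l2_state_mult_def
  proof (rule the_equality)
    show "\<forall>y\<in>l2_class x. (\<lambda>n. \<phi> (y n * a)) \<longlonglongrightarrow> c"
    proof
      fix y assume "y \<in> l2_class x"
      then have y: "y \<in> cauchy2 M \<phi>" "(\<lambda>n. norm2 \<phi> (x n - y n)) \<longlonglongrightarrow> 0"
        by (auto simp: mem_l2_class l2_rel_iff)
      have "norm (\<phi> (y n * a) - \<phi> (x n * a)) \<le> norm2 \<phi> (x n - y n) * norm2 \<phi> a" for n
        using cmod_state_mult_le[of "y n - x n" a] a cauchy2_mem[OF x] cauchy2_mem[OF y(1)]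
        by (simp add: left_diff_distrib state_diff mult_mem diff_mem snorm_diff_commute)
      from tendsto_of_tendsto_diff[OF lim tendsto_mult_left_zero[OF y(2)] this]
      show "(\<lambda>n. \<phi> (y n * a)) \<longlonglongrightarrow> c" .
    qed
    fix c' assume "\<forall>y\<in>l2_class x. (\<lambda>n. \<phi> (y n * a)) \<longlonglongrightarrow> c'"
    then show "c' = c" using l2_class_self[OF x] lim LIMSEQ_unique by blast
  qed
  with lim show ?thesis by simp
qed

text \<open>
  An element of the closure has a representative in \<open>S\<close> itself: choose the \<open>n\<close>-th member of \<open>S\<close> within
  \<open>1/(n+1)\<close> of it.
\<close>

lemma l2_closure_embed:
  assumes S: "S \<subseteq> M"
  shows "l2_closure M \<phi> (l2_embed M \<phi> ` S) = l2_class ` {y \<in> cauchy2 M \<phi>. range y \<subseteq> S}"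
proof (intro equalityI subsetI)
  fix \<xi> assume \<xi>: "\<xi> \<in> l2_closure M \<phi> (l2_embed M \<phi> ` S)"
  then obtain x where x: "x \<in> cauchy2 M \<phi>" and \<xi>x: "\<xi> = l2_class x"
    by (auto simp: l2_closure_def L2_eq)
  have "\<exists>s\<in>S. l2_dist \<phi> \<xi> (l2_embed M \<phi> s) < inverse (real (Suc n))" for n
    using \<xi> by (simp add: l2_closure_def)
  then obtain s where s: "\<And>n. s n \<in> S" "\<And>n. l2_dist \<phi> \<xi> (l2_embed M \<phi> (s n)) < inverse (real (Suc n))"
    by metis
  have sM: "s n \<in> M" for n using s S by blast
  have "(\<lambda>n. norm2 \<phi> (x n - s n)) \<longlonglongrightarrow> 0"
  proof (rule LIMSEQ_I)
    fix e :: real assume "0 < e"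
    then have e: "e / 2 > 0" by simp
    obtain N1 where N1: "\<And>m n. m \<ge> N1 \<Longrightarrow> n \<ge> N1 \<Longrightarrow> norm2 \<phi> (x m - x n) < e / 2"
      using cauchy2D[OF x e] by blast
    obtain N2 where N2: "inverse (real (Suc N2)) < e / 2" using reals_Archimedean[OF e] by blast
    show "\<exists>N. \<forall>n\<ge>N. norm (norm2 \<phi> (x n - s n) - 0) < e"
    proof (intro exI[of _ "max N1 N2"] allI impI)
      fix n assume n: "max N1 N2 \<le> n"
      have "(\<lambda>k. norm2 \<phi> (x k - s n)) \<longlonglongrightarrow> l2_dist \<phi> \<xi> (l2_embed M \<phi> (s n))"
        unfolding \<xi>x l2_embed_eq by (rule l2_dist_class[OF x cauchy2_const[OF sM]])
      then have "\<forall>\<^sub>F k in sequentially. norm2 \<phi> (x k - s n) < inverse (real (Suc n))"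
        using s(2) by (rule order_tendstoD)
      then obtain k where k: "k \<ge> N1" "norm2 \<phi> (x k - s n) < inverse (real (Suc n))"
        unfolding eventually_sequentially by (metis nat_le_linear)
      have "inverse (real (Suc n)) \<le> inverse (real (Suc N2))" using n by (simp add: field_simps)
      moreover have "norm2 \<phi> (x n - s n) \<le> norm2 \<phi> (x n - x k) + norm2 \<phi> (x k - s n)"
        by (intro snorm_diff_triangle sM cauchy2_mem[OF x])
      moreover have "norm2 \<phi> (x n - x k) < e / 2" using n k by (intro N1) auto
      ultimately have "norm2 \<phi> (x n - s n) < e" using k N2 by linarith
      then show "norm (norm2 \<phi> (x n - s n) - 0) < e"
        using snorm_nonneg[of "x n - s n"] sM cauchy2_mem[OF x] by (simp add: diff_mem)
    qed
  qed
  then have "s \<in> cauchy2 M \<phi>" and "l2_class x = l2_class s"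
    using cauchy2_perturb[OF x sM] l2_class_eq[OF x, of s] by simp_all
  with s(1) show "\<xi> \<in> l2_class ` {y \<in> cauchy2 M \<phi>. range y \<subseteq> S}"
    unfolding \<xi>x by blast
next
  fix \<xi> assume "\<xi> \<in> l2_class ` {y \<in> cauchy2 M \<phi>. range y \<subseteq> S}"
  then obtain y where y: "y \<in> cauchy2 M \<phi>" "range y \<subseteq> S" and \<xi>y: "\<xi> = l2_class y" by auto
  have "\<exists>\<eta>\<in>l2_embed M \<phi> ` S. l2_dist \<phi> \<xi> \<eta> < e" if "e > 0" for e
  proof -
    from that have e: "e / 2 > 0" by simp
    obtain N where N: "\<And>m n. m \<ge> N \<Longrightarrow> n \<ge> N \<Longrightarrow> norm2 \<phi> (y m - y n) < e / 2"
      using cauchy2D[OF y(1) e] by blast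
    have "(\<lambda>n. norm2 \<phi> (y n - y N)) \<longlonglongrightarrow> l2_dist \<phi> \<xi> (l2_embed M \<phi> (y N))"
      unfolding \<xi>y l2_embed_eq by (intro l2_dist_class y cauchy2_const cauchy2_mem)
    then have "l2_dist \<phi> \<xi> (l2_embed M \<phi> (y N)) \<le> e / 2"
      by (rule LIMSEQ_le_const2) (use N in \<open>auto intro!: exI[of _ N] less_imp_le\<close>)
    then show ?thesis using y(2) e by (intro bexI[of _ "l2_embed M \<phi> (y N)"]) auto
  qed
  then show "\<xi> \<in> l2_closure M \<phi> (l2_embed M \<phi> ` S)"
    using y(1) by (auto simp: l2_closure_def L2_eq \<xi>y)
qed

text \<open>
  The limit of \<open>z\<close> in \<open>L\<^sup>2\<close> is orthogonal to itself, because the members of \<open>z\<close> and their adjoints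
  are admissible test elements.  This gives the uniqueness of conjugate systems.
\<close>

lemma norm2_tendsto_zero:
  assumes z: "z \<in> cauchy2 M \<phi>" "range z \<subseteq> S" and S: "S \<subseteq> M" "\<And>s. s \<in> S \<Longrightarrow> adj s \<in> S"
    and weak: "\<And>s. s \<in> S \<Longrightarrow> (\<lambda>n. \<phi> (z n * s)) \<longlonglongrightarrow> 0"
  shows "(\<lambda>n. norm2 \<phi> (z n)) \<longlonglongrightarrow> 0"
proof -
  define L where "L = lim (\<lambda>n. norm2 \<phi> (z n))"
  have L: "(\<lambda>n. norm2 \<phi> (z n)) \<longlonglongrightarrow> L" unfolding L_def by (rule norm2_tendsto_lim[OF z(1)])
  have zM: "z n \<in> M" for n by (rule cauchy2_mem[OF z(1)])
  have L0: "L \<ge> 0" using L by (rule LIMSEQ_le_const) (auto intro: snorm_nonneg zM)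
  have "L \<le> e" if e: "e > 0" for e
  proof -
    obtain N where N: "\<And>m n. m \<ge> N \<Longrightarrow> n \<ge> N \<Longrightarrow> norm2 \<phi> (z m - z n) < e"
      using cauchy2D[OF z(1) e] by blast
    have bound: "(norm2 \<phi> (z n))\<^sup>2 \<le> cmod (\<phi> (z n * adj (z N))) + norm2 \<phi> (z n) * e" if n: "n \<ge> N" for n
    proof -
      have "(norm2 \<phi> (z n))\<^sup>2 = Re (\<phi> (z n * adj (z n)))"
        using zM[of n] by (simp add: snorm_power2 state_trace adj_mem)
      also have "\<phi> (z n * adj (z n)) = \<phi> (z n * adj (z N)) + \<phi> (z n * adj (z n - z N))"
        using zM by (simp add: adj_diff right_diff_distrib state_diff mult_mem adj_mem)
      also have "Re \<dots> \<le> cmod (\<phi> (z n * adj (z N))) + cmod (\<phi> (z n * adj (z n - z N)))"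
        by (simp add: add_mono complex_Re_le_cmod)
      also have "cmod (\<phi> (z n * adj (z n - z N))) \<le> norm2 \<phi> (z n) * norm2 \<phi> (z n - z N)"
        using cmod_state_mult_le[of "z n" "adj (z n - z N)"] zM
        by (simp add: adj_mem diff_mem norm2_adj)
      also have "\<dots> \<le> norm2 \<phi> (z n) * e"
        using N[of n N] n zM by (intro mult_left_mono snorm_nonneg) auto
      finally show ?thesis by simp
    qed
    have "L\<^sup>2 \<le> 0 + L * e"
    proof (rule LIMSEQ_le)
      show "(\<lambda>n. (norm2 \<phi> (z n))\<^sup>2) \<longlonglongrightarrow> L\<^sup>2" by (intro tendsto_intros L)
      have "(\<lambda>n. \<phi> (z n * adj (z N))) \<longlonglongrightarrow> 0" using z(2) by (intro weak S(2)) blast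
      then show "(\<lambda>n. cmod (\<phi> (z n * adj (z N))) + norm2 \<phi> (z n) * e) \<longlonglongrightarrow> 0 + L * e"
        by (intro tendsto_add tendsto_norm_zero tendsto_mult tendsto_const L)
    qed (use bound in auto)
    then show ?thesis using L0 e by (cases "L = 0") (auto simp: power2_eq_square)
  qed
  then have "L \<le> 0" by (rule field_le_epsilon[of L 0, simplified])
  with L L0 show ?thesis by simp
qed

text \<open>
  \<open>y\<close> represents the orthogonal projection of \<open>x\<close> onto the closure of \<open>V\<close>, obtained as the Riesz
  vector in \<open>V\<close> of the functional \<open>v \<mapsto> lim \<phi> (adj (x n) * v)\<close>.  Since \<open>V\<close> is selfadjoint, orthogonality
  to \<open>V\<close> is the same as equality of \<open>\<phi> (x v)\<close> and \<open>\<phi> (y v)\<close> for \<open>v\<close> in \<open>V\<close>.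
\<close>

lemma l2_projection:
  assumes x: "x \<in> cauchy2 M \<phi>"
    and V: "V \<subseteq> M" "0 \<in> V" "\<And>a b. a \<in> V \<Longrightarrow> b \<in> V \<Longrightarrow> a + b \<in> V"
      "\<And>c a. a \<in> V \<Longrightarrow> c *\<^sub>C a \<in> V" "\<And>a. a \<in> V \<Longrightarrow> adj a \<in> V"
  obtains y where "y \<in> cauchy2 M \<phi>" "range y \<subseteq> V"
    "\<And>v c. v \<in> V \<Longrightarrow> (\<lambda>n. \<phi> (x n * v)) \<longlonglongrightarrow> c \<Longrightarrow> (\<lambda>n. \<phi> (y n * v)) \<longlonglongrightarrow> c"
    "lim (\<lambda>n. norm2 \<phi> (y n)) \<le> lim (\<lambda>n. norm2 \<phi> (x n))"
proof -
  interpret V: semi_inner_product V "\<lambda>a b. \<phi> (adj a * b)"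
    by unfold_locales
      (use V in \<open>auto intro: minus_eq_scaleC ip_commute ip_add_right ip_scaleC_right ip_nonneg\<close>)
  have V_norm: "seminorm_of (\<lambda>a b. \<phi> (adj a * b)) = norm2 \<phi>"
    by (simp add: fun_eq_iff seminorm_of_def norm2_def)
  define K where "K = lim (\<lambda>n. norm2 \<phi> (x n))"
  have K: "(\<lambda>n. norm2 \<phi> (x n)) \<longlonglongrightarrow> K" unfolding K_def by (rule norm2_tendsto_lim[OF x])
  have xM: "x n \<in> M" for n by (rule cauchy2_mem[OF x])
  have K0: "K \<ge> 0" using K by (rule LIMSEQ_le_const) (auto intro: snorm_nonneg xM)
  define f where "f v = lim (\<lambda>n. \<phi> (adj (x n) * v))" for v
  have f: "(\<lambda>n. \<phi> (adj (x n) * v)) \<longlonglongrightarrow> f v" if "v \<in> M" for v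
    unfolding f_def using Cauchy_seq_convergent_ip[OF x that] by (simp add: convergent_LIMSEQ_iff)
  have f_add: "f (u + v) = f u + f v" if "u \<in> V" "v \<in> V" for u v
  proof -
    have "(\<lambda>n. \<phi> (adj (x n) * (u + v))) \<longlonglongrightarrow> f u + f v"
      using tendsto_add[OF f f, of u v] that V(1) xM by (simp add: ip_add_right subset_eq)
    then show ?thesis unfolding f_def by (rule limI)
  qed
  have f_scaleC: "f (c *\<^sub>C v) = c * f v" if "v \<in> V" for c v
  proof -
    have "(\<lambda>n. \<phi> (adj (x n) * (c *\<^sub>C v))) \<longlonglongrightarrow> c * f v"
      using tendsto_mult_left[OF f, of v c] that V(1) xM by (simp add: ip_scaleC_right subset_eq)
    then show ?thesis unfolding f_def by (rule limI)
  qed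
  have f_bound: "cmod (f v) \<le> K * norm2 \<phi> v" if "v \<in> V" for v
  proof (rule LIMSEQ_le)
    have v: "v \<in> M" using that V(1) by blast
    show "(\<lambda>n. cmod (\<phi> (adj (x n) * v))) \<longlonglongrightarrow> cmod (f v)" by (intro tendsto_norm f v)
    show "(\<lambda>n. norm2 \<phi> (x n) * norm2 \<phi> v) \<longlonglongrightarrow> K * norm2 \<phi> v" by (intro tendsto_mult K tendsto_const)
    show "\<exists>N. \<forall>n\<ge>N. cmod (\<phi> (adj (x n) * v)) \<le> norm2 \<phi> (x n) * norm2 \<phi> v"
      using cauchy_schwarz xM v by blast
  qed
  obtain y where y: "V.Cauchy_seq y" "\<forall>v\<in>V. (\<lambda>n. \<phi> (adj (y n) * v)) \<longlonglongrightarrow> f v"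
    "lim (\<lambda>n. norm2 \<phi> (y n)) \<le> \<bar>K\<bar>"
    using V.riesz_representation[of f K, unfolded V_norm, OF f_add f_scaleC f_bound] by blast
  show ?thesis
  proof
    show "y \<in> cauchy2 M \<phi>" "range y \<subseteq> V"
      using y(1) V(1) by (auto simp: V.Cauchy_seq_def V_norm cauchy2_def)
    show "lim (\<lambda>n. norm2 \<phi> (y n)) \<le> lim (\<lambda>n. norm2 \<phi> (x n))" using y(3) K0 K_def by simp
    fix v c assume v: "v \<in> V" and c: "(\<lambda>n. \<phi> (x n * v)) \<longlonglongrightarrow> c"
    have yV: "y n \<in> V" for n using y(1) by (auto simp: V.Cauchy_seq_def)
    have flip: "cnj (\<phi> (adj a * adj v)) = \<phi> (a * v)" if "a \<in> M" for a
      using state_adj[of "adj a * adj v"] that v V(1)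
      by (simp add: adj_mult mult_mem adj_mem state_trace subset_eq)
    have "(\<lambda>n. cnj (\<phi> (adj (x n) * adj v))) \<longlonglongrightarrow> cnj (f (adj v))"
      using v V by (intro tendsto_cnj f) blast
    then have "c = cnj (f (adj v))" using c LIMSEQ_unique by (simp add: flip xM)
    moreover have "(\<lambda>n. cnj (\<phi> (adj (y n) * adj v))) \<longlonglongrightarrow> cnj (f (adj v))"
      using v V by (intro tendsto_cnj y(2)[rule_format]) blast
    ultimately show "(\<lambda>n. \<phi> (y n * v)) \<longlonglongrightarrow> c" using yV V(1) by (simp add: flip subset_eq)
  qed
qed

end

section \<open>Conjugate systems and free Fisher information\<close>

text \<open>
  The value of \<open>\<phi> \<otimes> \<phi>\<close> on \<open>u \<cdot> \<partial>\<^sub>i w \<cdot> v\<close> for the free difference quotient \<open>\<partial>\<^sub>i\<close>.  The outer factors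
  \<open>u\<close> and \<open>v\<close> make the Leibniz rule expressible for these numbers.
\<close>

definition word_derivative ::
  "('h::chilbert_space bop \<Rightarrow> complex) \<Rightarrow> ('i \<Rightarrow> 'h bop) \<Rightarrow> 'i \<Rightarrow> 'i list \<Rightarrow> 'h bop \<Rightarrow> 'h bop \<Rightarrow> complex"
  where
  "word_derivative \<phi> a i w u v = (\<Sum>m<length w. if w ! m = i
     then \<phi> (u * word a (take m w)) * \<phi> (word a (drop (Suc m) w) * v) else 0)"

lemma word_derivative_one_one:
  "word_derivative \<phi> a i w 1 1 = (\<Sum>m<length w. if w ! m = i
     then \<phi> (word a (take m w)) * \<phi> (word a (drop (Suc m) w)) else 0)"
  unfolding word_derivative_def mult_1_left mult_1_right ..

text \<open>Conjugate systems in terms of representatives inside the algebra generated by the family.\<close>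

definition conjugate_sequences ::
  "'h::chilbert_space bop set \<Rightarrow> ('h bop \<Rightarrow> complex) \<Rightarrow> ('i::finite \<Rightarrow> 'h bop) \<Rightarrow> ('i \<Rightarrow> nat \<Rightarrow> 'h bop) \<Rightarrow> bool"
  where
  "conjugate_sequences M \<phi> a X \<longleftrightarrow>
    (\<forall>i. X i \<in> cauchy2 M \<phi> \<and> range (X i) \<subseteq> alg_gen (range a)) \<and>
    (\<forall>i w. (\<lambda>n. \<phi> (X i n * word a w)) \<longlonglongrightarrow> word_derivative \<phi> a i w 1 1)"

context tracial_star_algebra
begin

lemma conjugate_system_eq_sequences:
  assumes a: "range a \<subseteq> M"
  shows "conjugate_system M \<phi> a \<xi> \<longleftrightarrow>
    (\<exists>X. conjugate_sequences M \<phi> a X \<and> \<xi> = (\<lambda>i. l2_class (X i)))"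
proof -
  have sub: "alg_gen (range a) \<subseteq> M" using alg_gen_subset[OF a] by blast
  have wM: "word a w \<in> M" for w using sub word_mem_alg_gen by blast
  have rel: "l2_state_mult \<phi> (l2_class x) (word a w) = c \<longleftrightarrow> (\<lambda>n. \<phi> (x n * word a w)) \<longlonglongrightarrow> c"
    if "x \<in> cauchy2 M \<phi>" for x w c
    using l2_state_mult_class[OF that wM] LIMSEQ_unique by blast
  show ?thesis
  proof
    assume sys: "conjugate_system M \<phi> a \<xi>"
    then have "\<forall>i. \<exists>x. x \<in> cauchy2 M \<phi> \<and> range x \<subseteq> alg_gen (range a) \<and> \<xi> i = l2_class x"
      unfolding conjugate_system_def l2_closure_embed[OF sub] by fastforce
    then obtain X where X: "\<And>i. X i \<in> cauchy2 M \<phi>" "\<And>i. range (X i) \<subseteq> alg_gen (range a)"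
      "\<And>i. \<xi> i = l2_class (X i)" by metis
    have "(\<lambda>n. \<phi> (X i n * word a w)) \<longlonglongrightarrow> word_derivative \<phi> a i w 1 1" for i w
      using sys X(1,3) by (simp add: conjugate_system_def word_derivative_one_one flip: rel)
    then have "conjugate_sequences M \<phi> a X" using X by (simp add: conjugate_sequences_def)
    then show "\<exists>X. conjugate_sequences M \<phi> a X \<and> \<xi> = (\<lambda>i. l2_class (X i))"
      using X(3) by (intro exI[of _ X]) (simp add: fun_eq_iff)
  next
    assume "\<exists>X. conjugate_sequences M \<phi> a X \<and> \<xi> = (\<lambda>i. l2_class (X i))"
    then obtain X where X: "conjugate_sequences M \<phi> a X" and \<xi>: "\<xi> = (\<lambda>i. l2_class (X i))" by blast
    have mem: "X i \<in> cauchy2 M \<phi>" "range (X i) \<subseteq> alg_gen (range a)" for i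
      using X by (simp_all add: conjugate_sequences_def)
    have "l2_state_mult \<phi> (l2_class (X i)) (word a w) = word_derivative \<phi> a i w 1 1" for i w
      using X by (subst rel[OF mem(1)]) (simp add: conjugate_sequences_def)
    then show "conjugate_system M \<phi> a \<xi>"
      unfolding conjugate_system_def l2_closure_embed[OF sub] \<xi>
      using mem by (auto simp: word_derivative_one_one)
  qed
qed

lemma conjugate_sequences_unique:
  assumes a: "range a \<subseteq> M" "\<And>i. adj (a i) \<in> range a"
    and X: "conjugate_sequences M \<phi> a X" and Y: "conjugate_sequences M \<phi> a Y"
  shows "l2_class (X i) = l2_class (Y i)"
proof -
  have sub: "alg_gen (range a) \<subseteq> M" using alg_gen_subset[OF a(1)] by blast
  have mem: "X i \<in> cauchy2 M \<phi>" "Y i \<in> cauchy2 M \<phi>"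
    "\<And>n. X i n \<in> alg_gen (range a)" "\<And>n. Y i n \<in> alg_gen (range a)"
    using X Y by (auto simp: conjugate_sequences_def image_subset_iff)
  have "(\<lambda>n. \<phi> ((X i n - Y i n) * s)) \<longlonglongrightarrow> 0" if "s \<in> alg_gen (range a)" for s
    using that unfolding alg_gen_range_eq_word_span
  proof induction
    case (word w)
    have "(\<lambda>n. \<phi> (X i n * word a w) - \<phi> (Y i n * word a w)) \<longlonglongrightarrow>
        word_derivative \<phi> a i w 1 1 - word_derivative \<phi> a i w 1 1"
      using X Y by (intro tendsto_diff) (simp_all add: conjugate_sequences_def)
    moreover have "\<phi> ((X i n - Y i n) * word a w) = \<phi> (X i n * word a w) - \<phi> (Y i n * word a w)" for n
      using mem sub word_mem_alg_gen[of a w] by (simp add: left_diff_distrib state_diff mult_mem subset_eq)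
    ultimately show ?case by simp
  next
    case (add s t)
    then have "s \<in> M" "t \<in> M" using sub by (auto simp: alg_gen_range_eq_word_span)
    then have "\<phi> ((X i n - Y i n) * (s + t)) = \<phi> ((X i n - Y i n) * s) + \<phi> ((X i n - Y i n) * t)" for n
      using mem sub by (simp add: distrib_left state_add mult_mem diff_mem subset_eq)
    then show ?case using tendsto_add[OF add.IH] by simp
  next
    case (scaleC s c)
    then have "s \<in> M" using sub by (auto simp: alg_gen_range_eq_word_span)
    then have "\<phi> ((X i n - Y i n) * (c *\<^sub>C s)) = c * \<phi> ((X i n - Y i n) * s)" for n
      using mem sub by (simp add: mult_scaleC_right state_scaleC mult_mem diff_mem subset_eq)
    then show ?case using tendsto_mult_right_zero[OF scaleC.IH, of c] by simp
  qed
  moreover have "adj s \<in> alg_gen (range a)" if "s \<in> alg_gen (range a)" for s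
    using that a(2) by (intro alg_gen_adj) auto
  ultimately have "(\<lambda>n. norm2 \<phi> (X i n - Y i n)) \<longlonglongrightarrow> 0"
    using mem sub
    by (intro norm2_tendsto_zero[where S = "alg_gen (range a)"] cauchy2_diff) (auto intro: alg_gen_diff)
  then show ?thesis by (intro l2_class_eq mem)
qed

lemma free_fisher_eq:
  assumes a: "range a \<subseteq> M" "\<And>i. adj (a i) \<in> range a" and X: "conjugate_sequences M \<phi> a X"
  shows "free_fisher M \<phi> a = (\<Sum>i\<in>UNIV. ennreal ((lim (\<lambda>n. norm2 \<phi> (X i n)))\<^sup>2))"
proof -
  let ?\<xi> = "\<lambda>i. l2_class (X i)"
  have sys: "conjugate_system M \<phi> a ?\<xi>"
    using X conjugate_system_eq_sequences[OF a(1)] by blast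
  have "(THE \<xi>. conjugate_system M \<phi> a \<xi>) = ?\<xi>"
  proof (rule the_equality[of "conjugate_system M \<phi> a", OF sys])
    fix \<xi> assume "conjugate_system M \<phi> a \<xi>"
    then show "\<xi> = ?\<xi>"
      using conjugate_system_eq_sequences[OF a(1)] conjugate_sequences_unique[OF a _ X] by auto
  qed
  moreover have "l2_norm \<phi> (?\<xi> i) = lim (\<lambda>n. norm2 \<phi> (X i n))" for i
    using X by (intro l2_norm_class) (simp add: conjugate_sequences_def)
  ultimately show ?thesis unfolding free_fisher_def using sys by auto
qed

lemma free_fisher_infinite:
  assumes "range a \<subseteq> M" "\<And>X. \<not> conjugate_sequences M \<phi> a X"
  shows "free_fisher M \<phi> a = \<infinity>"
  using assms by (simp add: free_fisher_def conjugate_system_eq_sequences)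

lemma conjugate_sequences_reindex:
  assumes f: "bij f" and X: "conjugate_sequences M \<phi> a X"
  shows "conjugate_sequences M \<phi> (\<lambda>i. a (f i)) (\<lambda>i. X (f i))"
proof -
  have range: "range (\<lambda>i. a (f i)) = range a"
    using bij_is_surj[OF f] by (metis image_image)
  have word: "word (\<lambda>i. a (f i)) w = word a (map f w)" for w
    by (simp add: comp_def)
  have "word_derivative \<phi> (\<lambda>i. a (f i)) i w 1 1 = word_derivative \<phi> a (f i) (map f w) 1 1" for i w
    unfolding word_derivative_def using bij_is_inj[OF f]
    by (intro sum.cong) (auto simp: take_map drop_map comp_def inj_eq)
  then show ?thesis using X unfolding conjugate_sequences_def range word by (simp del: map_map)
qed

lemma free_fisher_reindex:
  assumes f: "bij f" and a: "range a \<subseteq> M" "\<And>i. adj (a i) \<in> range a"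
  shows "free_fisher M \<phi> (\<lambda>i. a (f i)) = free_fisher M \<phi> a"
proof -
  have range: "range (\<lambda>i. a (f i)) = range a"
    using bij_is_surj[OF f] by (metis image_image)
  show ?thesis
  proof (cases "\<exists>X. conjugate_sequences M \<phi> a X")
    case True
    then obtain X where X: "conjugate_sequences M \<phi> a X" by blast
    have "free_fisher M \<phi> (\<lambda>i. a (f i)) = (\<Sum>i\<in>UNIV. ennreal ((lim (\<lambda>n. norm2 \<phi> (X (f i) n)))\<^sup>2))"
      using a by (intro free_fisher_eq conjugate_sequences_reindex[OF f X]) (auto simp: range)
    also have "\<dots> = (\<Sum>i\<in>UNIV. ennreal ((lim (\<lambda>n. norm2 \<phi> (X i n)))\<^sup>2))"
      by (rule sum.reindex_bij_betw[OF f])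
    also have "\<dots> = free_fisher M \<phi> a" by (rule free_fisher_eq[OF a X, symmetric])
    finally show ?thesis .
  next
    case False
    have "\<not> conjugate_sequences M \<phi> (\<lambda>i. a (f i)) X" for X
    proof
      assume "conjugate_sequences M \<phi> (\<lambda>i. a (f i)) X"
      from conjugate_sequences_reindex[OF bij_imp_bij_inv[OF f] this]
      show False using False by (simp add: surj_f_inv_f[OF bij_is_surj[OF f]])
    qed
    then show ?thesis using False a by (simp add: free_fisher_infinite range)
  qed
qed

end

section \<open>Conjugate relations of words and of free products\<close>

text \<open>
  The graph of \<open>x \<mapsto> (u, v) \<mapsto> (\<phi> \<otimes> \<phi>) (u \<cdot> \<partial>\<^sub>i x \<cdot> v)\<close> on linear combinations of words.  It is a relation
  and not a function, since the words in the operators \<open>a\<close> may be linearly dependent and then \<open>T\<close>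
  may depend on the chosen combination.
\<close>

inductive derivation ::
  "('h::chilbert_space bop \<Rightarrow> complex) \<Rightarrow> ('i \<Rightarrow> 'h bop) \<Rightarrow> 'i \<Rightarrow>
    'h bop \<Rightarrow> ('h bop \<Rightarrow> 'h bop \<Rightarrow> complex) \<Rightarrow> bool" for \<phi> a i where
  word: "derivation \<phi> a i (word a w) (word_derivative \<phi> a i w)"
| add: "derivation \<phi> a i x T \<Longrightarrow> derivation \<phi> a i y T' \<Longrightarrow>
    derivation \<phi> a i (x + y) (\<lambda>u v. T u v + T' u v)"
| scaleC: "derivation \<phi> a i x T \<Longrightarrow> derivation \<phi> a i (c *\<^sub>C x) (\<lambda>u v. c * T u v)"

lemma word_derivative_snoc:
  "word_derivative \<phi> a i (w @ [k]) u v =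
    word_derivative \<phi> a i w u (a k * v) + (if k = i then \<phi> (u * word a w) * \<phi> v else 0)"
proof -
  have "(\<Sum>m<length w. if (w @ [k]) ! m = i
      then \<phi> (u * word a (take m (w @ [k]))) * \<phi> (word a (drop (Suc m) (w @ [k])) * v) else 0) =
    word_derivative \<phi> a i w u (a k * v)"
    unfolding word_derivative_def by (intro sum.cong) (auto simp: nth_append mult.assoc)
  then show ?thesis by (simp add: word_derivative_def[of _ _ _ "w @ [k]"])
qed

lemma derivation_mem: "derivation \<phi> a i x T \<Longrightarrow> x \<in> alg_gen (range a)"
  by (induction rule: derivation.induct) (auto intro: word_mem_alg_gen alg_gen.intros)

lemma derivation_one: "derivation \<phi> a i 1 (\<lambda>u v. 0)"
proof -
  have "word_derivative \<phi> a i [] = (\<lambda>u v. 0)" by (simp add: fun_eq_iff word_derivative_def)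
  then show ?thesis using derivation.word[of \<phi> a i "[]"] by simp
qed

text \<open>Subtracting a scalar leaves \<open>T\<close> unchanged, so elements may be centred without affecting derivatives.\<close>

lemma derivation_diff_const: "derivation \<phi> a i x T \<Longrightarrow> derivation \<phi> a i (x - c *\<^sub>C 1) T"
  using derivation.add[OF _ derivation.scaleC[OF derivation_one, of _ _ _ "- c"], of \<phi> a i x T]
  by (simp add: neg_bop_eq_scaleC[of "c *\<^sub>C 1"] scaleC_bop_scaleC diff_conv_add_uminus
      del: add_uminus_conv_diff)

lemma derivation_eq_0_left:
  assumes "derivation \<phi> a i x T" "\<And>l. l \<in> alg_gen (range a) \<Longrightarrow> \<phi> (u * l) = 0"
  shows "T u v = 0"
  using assms(1)
  by induction (auto simp: word_derivative_def assms(2) word_mem_alg_gen intro!: sum.neutral)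

lemma derivation_eq_0_right:
  assumes "derivation \<phi> a i x T" "\<And>r. r \<in> alg_gen (range a) \<Longrightarrow> \<phi> (r * v) = 0"
  shows "T u v = 0"
  using assms(1)
  by induction (auto simp: word_derivative_def assms(2) word_mem_alg_gen intro!: sum.neutral)

text \<open>\<open>\<partial> (x \<cdot> b) = \<partial> x \<cdot> b\<close> for \<open>b\<close> with \<open>\<partial> b = 0\<close>.\<close>

definition act_right ::
  "('h::chilbert_space bop \<Rightarrow> 'h bop \<Rightarrow> complex) \<Rightarrow> 'h bop \<Rightarrow> 'h bop \<Rightarrow> 'h bop \<Rightarrow> complex" where
  [simp]: "act_right T b u v = T u (b * v)"

text \<open>\<open>\<partial> (x \<cdot> y) = \<partial> x \<cdot> y + x \<cdot> \<partial> y\<close>, where \<open>T\<close> belongs to \<open>x\<close> and \<open>T'\<close> to \<open>y\<close>.\<close>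

definition leibniz ::
  "'h::chilbert_space bop \<Rightarrow> ('h bop \<Rightarrow> 'h bop \<Rightarrow> complex) \<Rightarrow> 'h bop \<Rightarrow> ('h bop \<Rightarrow> 'h bop \<Rightarrow> complex) \<Rightarrow>
    'h bop \<Rightarrow> 'h bop \<Rightarrow> complex" where
  [simp]: "leibniz x T y T' u v = T u (y * v) + T' (u * x) v"

lemma derivation_zero: "derivation \<phi> a i 0 (\<lambda>u v. 0)"
  using derivation.scaleC[OF derivation_one, of \<phi> a i 0] by simp

lemma derivation_sum:
  assumes "finite K" "\<And>k. k \<in> K \<Longrightarrow> derivation \<phi> a i (x k) (T k)"
  shows "derivation \<phi> a i (sum x K) (\<lambda>u v. \<Sum>k\<in>K. T k u v)"
  using assms by (induction K rule: finite_induct) (simp_all add: derivation_zero derivation.add)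

locale variables = tracial_star_algebra M \<phi>
  for M :: "'h::chilbert_space bop set" and \<phi> +
  fixes a :: "'i::finite \<Rightarrow> 'h bop" and i :: 'i
  assumes a_mem: "range a \<subseteq> M"
begin

abbreviation "P \<equiv> alg_gen (range a)"
abbreviation "der \<equiv> derivation \<phi> a i"

lemma P_mem: "p \<in> P \<Longrightarrow> p \<in> M"
  using alg_gen_subset a_mem by blast

lemma a_in_M: "a k \<in> M"
  using a_mem by blast

text \<open>
  The Leibniz rule.  It is an identity on \<open>M\<close>, where \<open>\<phi>\<close> is linear; this is why \<open>T'\<close> is
  described by its values and not as a function.
\<close>

lemma derivation_mult_base:
  "der x T \<Longrightarrow> \<exists>T'. der (x * a k) T' \<and>
    (\<forall>u\<in>M. \<forall>v\<in>M. T' u v = T u (a k * v) + (if k = i then \<phi> (u * x) * \<phi> v else 0))"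
proof (induction rule: derivation.induct)
  case (word w)
  have "der (word a (w @ [k])) (word_derivative \<phi> a i (w @ [k]))" by (rule derivation.word)
  then show ?case unfolding word_derivative_snoc[abs_def] by (intro exI conjI) auto
next
  case (add x T y T')
  then obtain U U' where U: "der (x * a k) U" "der (y * a k) U'"
    "\<And>u v. u \<in> M \<Longrightarrow> v \<in> M \<Longrightarrow> U u v = T u (a k * v) + (if k = i then \<phi> (u * x) * \<phi> v else 0)"
    "\<And>u v. u \<in> M \<Longrightarrow> v \<in> M \<Longrightarrow> U' u v = T' u (a k * v) + (if k = i then \<phi> (u * y) * \<phi> v else 0)"
    by blast
  have "x \<in> M" "y \<in> M" using add.hyps by (auto intro: P_mem derivation_mem)
  then show ?case using derivation.add[OF U(1,2)] U(3,4)
    by (intro exI conjI) (auto simp: distrib_left distrib_right state_add mult_mem)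
next
  case (scaleC x T c)
  then obtain U where U: "der (x * a k) U"
    "\<And>u v. u \<in> M \<Longrightarrow> v \<in> M \<Longrightarrow> U u v = T u (a k * v) + (if k = i then \<phi> (u * x) * \<phi> v else 0)"
    by blast
  have "x \<in> M" using scaleC.hyps by (auto intro: P_mem derivation_mem)
  then show ?case using derivation.scaleC[OF U(1), of c] U(2)
    by (intro exI conjI)
      (auto simp: mult_scaleC_left mult_scaleC_right state_scaleC mult_mem distrib_left)
qed

theorem derivation_conjugate_relation:
  assumes X: "conjugate_sequences M \<phi> a X" and x: "der x T"
  shows "(\<lambda>n. \<phi> (X i n * x)) \<longlonglongrightarrow> T 1 1"
proof -
  have XM: "X i n \<in> M" for n
    using X by (auto simp: conjugate_sequences_def image_subset_iff intro: P_mem)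
  show ?thesis using x
  proof (induction rule: derivation.induct)
    case (word w)
    then show ?case using X by (simp add: conjugate_sequences_def)
  next
    case (add x T y T')
    have "\<phi> (X i n * (x + y)) = \<phi> (X i n * x) + \<phi> (X i n * y)" for n
      using XM P_mem derivation_mem[OF add.hyps(1)] derivation_mem[OF add.hyps(2)]
      by (simp add: distrib_left state_add mult_mem)
    then show ?case using tendsto_add[OF add.IH] by simp
  next
    case (scaleC x T c)
    have "\<phi> (X i n * (c *\<^sub>C x)) = c * \<phi> (X i n * x)" for n
      using XM P_mem derivation_mem[OF scaleC.hyps(1)]
      by (simp add: mult_scaleC_right state_scaleC mult_mem)
    then show ?case using tendsto_mult_left[OF scaleC.IH] by simp
  qed
qed

end

locale free_variables = variables M \<phi> a i
  for M :: "'h::chilbert_space bop set" and \<phi> and a :: "'i::finite \<Rightarrow> 'h bop" and i +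
  fixes S :: "'h bop set"
  assumes S_mem: "S \<subseteq> M" and free: "free_from \<phi> (range a) S"
begin

abbreviation "B \<equiv> alg_gen S"

lemma B_mem: "b \<in> B \<Longrightarrow> b \<in> M"
  using alg_gen_subset S_mem by blast

definition centred :: "'h bop set \<Rightarrow> 'h bop set" where
  "centred A = {x \<in> A. \<phi> x = 0}"

lemma centredD: "x \<in> centred A \<Longrightarrow> x \<in> A" "x \<in> centred A \<Longrightarrow> \<phi> x = 0"
  by (simp_all add: centred_def)

lemma centred_diff_state:
  assumes "R \<subseteq> M" "x \<in> alg_gen R"
  shows "x - \<phi> x *\<^sub>C 1 \<in> centred (alg_gen R)"
  using alg_gen_subset[OF assms] assms(2)
  by (auto simp: centred_def state_diff state_scaleC state_one one_mem scaleC_mem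
      intro: alg_gen_diff alg_gen.intros)

text \<open>
  Alternating products of centred factors that begin and end in \<open>B\<close>.  By traciality the outermost
  factors from \<open>P\<close> of any alternating product can be collected on one side of a chain
  (\<open>state_mult_chain\<close>), where they need not be centred.
\<close>

inductive_set chain :: "'h bop set" where
  base: "b \<in> centred B \<Longrightarrow> b \<in> chain"
| step: "z \<in> chain \<Longrightarrow> p \<in> centred P \<Longrightarrow> b \<in> centred B \<Longrightarrow> z * p * b \<in> chain"

lemma chain_mem: "z \<in> chain \<Longrightarrow> z \<in> M"
  by (induction rule: chain.induct) (auto intro: mult_mem P_mem B_mem centredD(1))

text \<open>
  Chains in the list form of \<open>free_family\<close>; the index \<open>True\<close> stands for \<open>P\<close> and \<open>False\<close> for \<open>B\<close>.
\<close>

lemma chain_list: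
  "z \<in> chain \<Longrightarrow> \<exists>ks as. ks \<noteq> [] \<and> length as = length ks \<and> distinct_adj ks \<and> \<not> hd ks \<and> \<not> last ks \<and>
    (\<forall>n<length ks. as ! n \<in> alg_gen (if ks ! n then range a else S) \<and> \<phi> (as ! n) = 0) \<and>
    prod_list as = z"
proof (induction rule: chain.induct)
  case (base b)
  then show ?case by (intro exI[of _ "[False]"] exI[of _ "[b]"]) (auto dest: centredD)
next
  case (step z p b)
  then obtain ks as where IH: "ks \<noteq> []" "length as = length ks" "distinct_adj ks" "\<not> hd ks" "\<not> last ks"
    "\<forall>n<length ks. as ! n \<in> alg_gen (if ks ! n then range a else S) \<and> \<phi> (as ! n) = 0"
    "prod_list as = z" by blast
  have "(as @ [p, b]) ! n \<in> alg_gen (if (ks @ [True, False]) ! n then range a else S) \<and>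
      \<phi> ((as @ [p, b]) ! n) = 0" if "n < length (ks @ [True, False])" for n
  proof -
    have "n < length ks \<or> n = length ks \<or> n = Suc (length ks)" using that by auto
    then show ?thesis using IH(2,6) step.hyps by (auto simp: nth_append dest: centredD)
  qed
  moreover have "distinct_adj (ks @ [True, False])"
    using IH by (auto simp: distinct_adj_append_iff)
  ultimately show ?case using IH
    by (intro exI[of _ "ks @ [True, False]"] exI[of _ "as @ [p, b]"]) (auto simp: mult.assoc)
qed

text \<open>
  Split \<open>q\<close> into its centred part and a scalar: in both cases an alternating product of centred
  elements remains, since a chain begins in \<open>B\<close>.
\<close>

lemma state_mult_chain:
  assumes q: "q \<in> P" and z: "z \<in> chain"
  shows "\<phi> (q * z) = 0"
proof -
  obtain ks as where L: "ks \<noteq> []" "length as = length ks" "distinct_adj ks" "\<not> hd ks"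
    "\<forall>n<length ks. as ! n \<in> alg_gen (if ks ! n then range a else S) \<and> \<phi> (as ! n) = 0"
    "prod_list as = z" using chain_list[OF z] by blast
  define c where "c = \<phi> q"
  define q' where "q' = q - c *\<^sub>C 1"
  have q': "q' \<in> P" "\<phi> q' = 0"
    using centred_diff_state[OF a_mem q] by (auto simp: q'_def c_def dest: centredD)
  have vanish: "\<phi> (prod_list as) = 0" if "ks \<noteq> []" "length as = length ks" "distinct_adj ks"
    "\<forall>n<length ks. as ! n \<in> alg_gen (if ks ! n then range a else S) \<and> \<phi> (as ! n) = 0" for ks as
    using free that unfolding free_from_def free_family_def by blast
  have "\<phi> z = 0" using vanish[of ks as] L by simp
  moreover have "\<phi> (prod_list (q' # as)) = 0"
  proof (rule vanish[of "True # ks"])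
    show "distinct_adj (True # ks)" using L(1,3,4) by (cases ks) auto
    show "\<forall>n<length (True # ks). (q' # as) ! n \<in> alg_gen (if (True # ks) ! n then range a else S) \<and>
        \<phi> ((q' # as) ! n) = 0"
      using L(5) q' by (auto simp: less_Suc_eq_0_disj)
  qed (use L in auto)
  moreover have "q * z = q' * z + c *\<^sub>C z"
    by (simp add: q'_def left_diff_distrib mult_scaleC_left)
  ultimately show ?thesis
    using L(6) P_mem[OF q'(1)] chain_mem[OF z] by (simp add: state_add state_scaleC mult_mem scaleC_mem)
qed

text \<open>
  What may follow a chain so that the product is again a chain times an element of \<open>P\<close>.  Tails arise
  as right factors when the Leibniz rule is applied to an alternating product.
\<close>

inductive_set tails :: "'h bop set" where
  base: "l \<in> P \<Longrightarrow> l \<in> tails"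
| step: "v \<in> tails \<Longrightarrow> p \<in> centred P \<Longrightarrow> b \<in> centred B \<Longrightarrow> p * (b * v) \<in> tails"

lemma chain_mult_tails:
  assumes "v \<in> tails" "z \<in> chain"
  shows "\<exists>z'\<in>chain. \<exists>l\<in>P. z * v = z' * l"
  using assms
proof (induction arbitrary: z rule: tails.induct)
  case (base l)
  then show ?case by blast
next
  case (step v p b)
  then have "z * p * b \<in> chain" by (intro chain.step)
  from step.IH[OF this] show ?case by (simp add: mult.assoc)
qed

lemma state_chain_tails:
  assumes "q \<in> P" "z \<in> chain" "v \<in> tails"
  shows "\<phi> (q * (z * v)) = 0"
proof -
  obtain z' l where z': "z' \<in> chain" "l \<in> P" "z * v = z' * l"
    using chain_mult_tails[OF assms(3,2)] by blast
  have "\<phi> (q * (z * v)) = \<phi> ((l * q) * z')"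
    using state_trace[of "q * z'" l] assms z'
    by (simp add: mult.assoc mult_mem P_mem chain_mem)
  also have "\<dots> = 0" using assms z' by (intro state_mult_chain alg_gen_mult)
  finally show ?thesis .
qed

text \<open>
  Products \<open>p\<^sub>0 b\<^sub>1 p\<^sub>1 \<cdots> p\<^bsub>r-1\<^esub> b\<^sub>r\<close> with all factors but \<open>p\<^sub>0\<close> centred, together with their derivatives,
  where \<open>\<partial>\<close> vanishes on \<open>B\<close>.
\<close>

inductive alternating :: "'h bop \<Rightarrow> ('h bop \<Rightarrow> 'h bop \<Rightarrow> complex) \<Rightarrow> bool" where
  base: "der p T \<Longrightarrow> b \<in> centred B \<Longrightarrow> alternating (p * b) (act_right T b)"
| step: "alternating e R \<Longrightarrow> der p T \<Longrightarrow> p \<in> centred P \<Longrightarrow> b \<in> centred B \<Longrightarrow>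
    alternating (e * p * b) (act_right (leibniz e R p T) b)"

lemma alternating_decompose: "alternating e R \<Longrightarrow> \<exists>q\<in>P. \<exists>z\<in>chain. e = q * z"
proof (induction rule: alternating.induct)
  case (base p T b)
  then show ?case
    by (intro bexI[of _ p] bexI[of _ b] refl) (auto intro: derivation_mem chain.base)
next
  case (step e R p T b)
  then obtain q z where "q \<in> P" "z \<in> chain" "e = q * z" by blast
  moreover have "z * p * b \<in> chain"
    using \<open>z \<in> chain\<close> step.hyps by (intro chain.step)
  ultimately show ?case by (intro bexI[of _ q] bexI[of _ "z * p * b"]) (auto simp: mult.assoc)
qed

lemma alternating_mem: "alternating e R \<Longrightarrow> e \<in> M"
  using alternating_decompose[of e R] by (auto intro: mult_mem P_mem chain_mem)

lemma state_alternating: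
  assumes "q \<in> P" "alternating e R" "v \<in> tails"
  shows "\<phi> (q * (e * v)) = 0"
proof -
  obtain q' z where "q' \<in> P" "z \<in> chain" "e = q' * z" using alternating_decompose[OF assms(2)] by blast
  then show ?thesis using state_chain_tails[of "q * q'" z v] assms by (simp add: mult.assoc alg_gen_mult)
qed

text \<open>
  The derivative falls on one factor \<open>p\<^sub>j\<close>, and every resulting term is a product of two states.  If
  \<open>j = r - 1\<close>, the right factor starts with an element of \<open>P\<close> followed by \<open>b\<^sub>r\<close> and a tail, so its state
  vanishes.  For smaller \<open>j\<close> the factors to the right of \<open>b\<^bsub>j+1\<^esub>\<close> are absorbed into the tail.
\<close>

lemma alternating_derivative_eq_0:
  "alternating e R \<Longrightarrow> v \<in> tails \<Longrightarrow> R 1 v = 0"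
proof (induction arbitrary: v rule: alternating.induct)
  case (base p T b)
  then show ?case
    unfolding act_right_def
    by (intro derivation_eq_0_right[OF base(1)] state_chain_tails chain.base)
next
  case (step e R p T b)
  have "R 1 (p * (b * v)) = 0"
    using step by (intro step.IH tails.step)
  moreover have "T (1 * e) (b * v) = 0"
    using step by (intro derivation_eq_0_right[OF step.hyps(2)] state_chain_tails chain.base)
  ultimately show ?case by simp
qed

definition linear_right :: "('h bop \<Rightarrow> 'h bop \<Rightarrow> complex) \<Rightarrow> bool" where
  "linear_right T \<longleftrightarrow> (\<forall>u\<in>M. \<forall>v\<in>M. \<forall>v'\<in>M. \<forall>c. T u (v + c *\<^sub>C v') = T u v + c * T u v')"

lemma linear_rightD:
  "linear_right T \<Longrightarrow> u \<in> M \<Longrightarrow> v \<in> M \<Longrightarrow> v' \<in> M \<Longrightarrow> T u (v + c *\<^sub>C v') = T u v + c * T u v'"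
  by (simp add: linear_right_def)

lemma derivation_linear_right: "der x T \<Longrightarrow> linear_right T"
proof (induction rule: derivation.induct)
  case (word w)
  have [simp]: "word a w' \<in> M" for w' by (rule P_mem[OF word_mem_alg_gen])
  show ?case
    unfolding linear_right_def word_derivative_def sum_distrib_left sum.distrib[symmetric]
    by (intro ballI allI sum.cong)
      (auto simp: distrib_left mult_scaleC_right state_add state_scaleC mult_mem scaleC_mem algebra_simps)
qed (auto simp: linear_right_def algebra_simps)

lemma alternating_linear_right: "alternating e R \<Longrightarrow> linear_right R"
proof (induction rule: alternating.induct)
  case (base p T b)
  then show ?case
    using derivation_linear_right[OF base(1)] B_mem[OF centredD(1)[OF base(2)]]
    by (auto simp: linear_right_def distrib_left mult_scaleC_right mult_mem)
next
  case (step e R p T b)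
  then show ?case
    using derivation_linear_right[OF step.hyps(2)] B_mem[OF centredD(1)[OF step.hyps(4)]] P_mem[OF derivation_mem[OF step.hyps(2)]]
      alternating_mem[OF step.hyps(1)]
    by (auto simp: linear_right_def distrib_left mult_scaleC_right mult_mem algebra_simps)
qed

text \<open>
  The linear span of the words in \<open>a\<close> and of the products \<open>e \<cdot> p\<close> with \<open>e\<close> alternating, with derivatives.
  It is closed under right multiplication by the \<open>a k\<close> (\<open>mixed_mult_base\<close>) and by \<open>B\<close>
  (\<open>mixed_mult_free\<close>), hence contains all words in \<open>a\<close> and \<open>B\<close>.  Derivatives matter only
  on \<open>M\<close>, whence the rule \<open>ext\<close>.
\<close>

inductive mixed :: "'h bop \<Rightarrow> ('h bop \<Rightarrow> 'h bop \<Rightarrow> complex) \<Rightarrow> bool" where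
  der: "der p T \<Longrightarrow> mixed p T"
| alternating_der: "alternating e R \<Longrightarrow> der p T \<Longrightarrow> mixed (e * p) (leibniz e R p T)"
| add: "mixed x T \<Longrightarrow> mixed y T' \<Longrightarrow> mixed (x + y) (\<lambda>u v. T u v + T' u v)"
| scaleC: "mixed x T \<Longrightarrow> mixed (c *\<^sub>C x) (\<lambda>u v. c * T u v)"
| ext: "mixed x T \<Longrightarrow> (\<And>u v. u \<in> M \<Longrightarrow> v \<in> M \<Longrightarrow> T' u v = T u v) \<Longrightarrow> mixed x T'"

lemma mixed_mem: "mixed x T \<Longrightarrow> x \<in> M"
  by (induction rule: mixed.induct)
    (auto intro: P_mem derivation_mem mult_mem alternating_mem add_mem scaleC_mem)

lemma alternating_mixed: "alternating e R \<Longrightarrow> mixed e R"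
proof -
  assume "alternating e R"
  from mixed.alternating_der[OF this derivation_one] have "mixed e (leibniz e R 1 (\<lambda>u v. 0))" by simp
  moreover have "leibniz e R 1 (\<lambda>u v. 0) = R" by (simp add: fun_eq_iff)
  ultimately show ?thesis by simp
qed

lemma mixed_mult_base:
  "mixed x T \<Longrightarrow> mixed (x * a k) (\<lambda>u v. T u (a k * v) + (if k = i then \<phi> (u * x) * \<phi> v else 0))"
proof (induction rule: mixed.induct)
  case (der p T)
  then show ?case using derivation_mult_base[OF der, of k] by (auto intro: mixed.der mixed.ext)
next
  case (alternating_der e R p T)
  then obtain T' where T': "der (p * a k) T'"
    "\<And>u v. u \<in> M \<Longrightarrow> v \<in> M \<Longrightarrow> T' u v = T u (a k * v) + (if k = i then \<phi> (u * p) * \<phi> v else 0)"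
    using derivation_mult_base by blast
  have "e \<in> M" by (rule alternating_mem[OF alternating_der(1)])
  then show ?case
    using mixed.ext[OF mixed.alternating_der[OF alternating_der(1) T'(1)]] T'(2)
    by (simp add: mult.assoc mult_mem)
next
  case (add x T y T')
  note xy = mixed_mem[OF add.hyps(1)] mixed_mem[OF add.hyps(2)]
  show ?case unfolding distrib_right
    by (rule mixed.ext[OF mixed.add[OF add.IH]]) (auto simp: distrib_left state_add mult_mem xy algebra_simps)
next
  case (scaleC x T c)
  note x = mixed_mem[OF scaleC.hyps(1)]
  show ?case unfolding mult_scaleC_left
    by (rule mixed.ext[OF mixed.scaleC[OF scaleC.IH]])
      (auto simp: mult_scaleC_right state_scaleC mult_mem x algebra_simps)
next
  case (ext x T T')
  show ?case by (rule mixed.ext[OF ext.IH]) (simp add: ext.hyps mult_mem a_in_M)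
qed

text \<open>
  Multiplication by \<open>b\<close> reduces to multiplication by its centred part: \<open>y b = y (b - \<phi>(b)) + \<phi>(b) y\<close>.
\<close>

lemma mixed_mult_of_centred:
  assumes alt: "\<And>b. b \<in> centred B \<Longrightarrow> alternating (y * b) (act_right R b)"
    and y: "mixed y R" and R: "linear_right R" and b: "b \<in> B"
  shows "mixed (y * b) (act_right R b)"
proof -
  define c where "c = \<phi> b"
  define b' where "b' = b - c *\<^sub>C 1"
  have b': "b' \<in> centred B"
    unfolding b'_def c_def by (rule centred_diff_state[OF S_mem b])
  have "mixed (y * b' + c *\<^sub>C y) (\<lambda>u v. act_right R b' u v + c * R u v)"
    by (intro mixed.add mixed.scaleC alternating_mixed alt b' y)
  moreover have "y * b' + c *\<^sub>C y = y * b"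
    by (simp add: b'_def right_diff_distrib mult_scaleC_right)
  moreover have "R u (b * v) = R u (b' * v) + c * R u v" if "u \<in> M" "v \<in> M" for u v
  proof -
    have "b * v = b' * v + c *\<^sub>C v" by (simp add: b'_def left_diff_distrib mult_scaleC_left)
    then show ?thesis
      using linear_rightD[OF R that(1), of "b' * v" v c] that B_mem[OF centredD(1)[OF b']]
      by (simp add: mult_mem)
  qed
  ultimately show ?thesis by (auto intro: mixed.ext)
qed

lemma alternating_der_linear_right:
  assumes "alternating e R" "der p T"
  shows "linear_right (leibniz e R p T)"
  using alternating_linear_right[OF assms(1)] derivation_linear_right[OF assms(2)]
    alternating_mem[OF assms(1)] P_mem[OF derivation_mem[OF assms(2)]]
  by (auto simp: linear_right_def distrib_left mult_scaleC_right mult_mem algebra_simps)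

lemma der_mult_mixed: "der p T \<Longrightarrow> b \<in> B \<Longrightarrow> mixed (p * b) (act_right T b)"
  by (intro mixed_mult_of_centred alternating.base mixed.der derivation_linear_right)

lemma alternating_der_mult_mixed:
  assumes "alternating e R" "der p T" "p \<in> centred P" "b \<in> B"
  shows "mixed (e * p * b) (act_right (leibniz e R p T) b)"
  by (intro mixed_mult_of_centred alternating.step mixed.alternating_der alternating_der_linear_right assms)

text \<open>The last factor \<open>b'\<close> of \<open>e\<close> and \<open>b\<close> merge into one element \<open>b' b\<close> of \<open>B\<close>, which is centred again.\<close>

lemma alternating_mult_mixed:
  assumes "alternating e R" "b \<in> B"
  shows "mixed (e * b) (act_right R b)"
  using assms(1)
proof cases
  case (base p T b')
  moreover have "act_right (act_right T b') b = act_right T (b' * b)"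
    by (simp add: fun_eq_iff mult.assoc)
  ultimately show ?thesis using der_mult_mixed[of p T "b' * b"] assms(2)
    by (simp add: mult.assoc alg_gen_mult centredD)
next
  case (step e' R' p T b')
  moreover have "act_right (act_right (leibniz e' R' p T) b') b = act_right (leibniz e' R' p T) (b' * b)"
    by (simp add: fun_eq_iff mult.assoc)
  ultimately show ?thesis
    using alternating_der_mult_mixed[of e' R' p T "b' * b"] assms(2)
    by (simp add: mult.assoc alg_gen_mult centredD)
qed

text \<open>
  In \<open>e p b\<close> the factor \<open>p\<close> becomes an inner one and has to be centred; the scalar part of \<open>p\<close> leaves
  \<open>e b\<close>, where two elements of \<open>B\<close> merge.
\<close>

lemma mixed_mult_free:
  "mixed x T \<Longrightarrow> b \<in> B \<Longrightarrow> mixed (x * b) (act_right T b)"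
proof (induction rule: mixed.induct)
  case (der p T)
  then show ?case by (intro der_mult_mixed)
next
  case (alternating_der e R p T)
  define c where "c = \<phi> p"
  define p' where "p' = p - c *\<^sub>C 1"
  have p': "der p' T" "p' \<in> centred P"
    unfolding p'_def c_def
    using derivation_diff_const[OF alternating_der(2)]
      centred_diff_state[OF a_mem derivation_mem[OF alternating_der(2)]] by simp_all
  note R = alternating_linear_right[OF alternating_der(1)]
  have "mixed (e * p' * b + c *\<^sub>C (e * b))
      (\<lambda>u v. act_right (leibniz e R p' T) b u v + c * act_right R b u v)"
    by (intro mixed.add mixed.scaleC alternating_der_mult_mixed alternating_mult_mixed alternating_der p')
  moreover have "e * p' * b + c *\<^sub>C (e * b) = e * p * b"
    by (simp add: p'_def right_diff_distrib left_diff_distrib mult_scaleC_right mult_scaleC_left)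
  moreover have "R u (p * (b * v)) = R u (p' * (b * v)) + c * R u (b * v)" if "u \<in> M" "v \<in> M" for u v
  proof -
    have "p * (b * v) = p' * (b * v) + c *\<^sub>C (b * v)"
      by (simp add: p'_def left_diff_distrib mult_scaleC_left)
    then show ?thesis
      using linear_rightD[OF R that(1), of "p' * (b * v)" "b * v" c] that B_mem[OF alternating_der(3)]
        P_mem[OF derivation_mem[OF p'(1)]]
      by (simp add: mult_mem)
  qed
  ultimately show ?case by (auto intro: mixed.ext)
next
  case (add x T y T')
  then have "mixed (x * b + y * b) (\<lambda>u v. act_right T b u v + act_right T' b u v)" by (intro mixed.add)
  then show ?case by (auto simp: distrib_right intro: mixed.ext)
next
  case (scaleC x T c)
  then have "mixed (c *\<^sub>C (x * b)) (\<lambda>u v. c * act_right T b u v)" by (intro mixed.scaleC)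
  then show ?case by (auto simp: mult_scaleC_left intro: mixed.ext)
next
  case (ext x T T')
  show ?case by (rule mixed.ext[OF ext.IH[OF ext.prems]]) (simp add: ext mult_mem B_mem)
qed

text \<open>
  Both sides are linear.  For words in \<open>a\<close> this is the conjugate relation itself; for \<open>e p\<close> with \<open>e\<close>
  alternating both sides vanish, the left one because \<open>X i n\<close> lies in \<open>P\<close> and
  joins the outer factors that are collected in front of a chain.
\<close>

theorem mixed_conjugate_relation:
  assumes X: "conjugate_sequences M \<phi> a X" and x: "mixed x T"
  shows "(\<lambda>n. \<phi> (X i n * x)) \<longlonglongrightarrow> T 1 1"
proof -
  have XP: "X i n \<in> P" for n using X by (auto simp: conjugate_sequences_def image_subset_iff)
  have XM: "X i n \<in> M" for n by (rule P_mem[OF XP])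
  show ?thesis using x
  proof (induction rule: mixed.induct)
    case (der p T)
    show ?case by (rule derivation_conjugate_relation[OF X der])
  next
    case (alternating_der e R p T)
    have p: "p \<in> P" by (rule derivation_mem[OF alternating_der(2)])
    have "\<phi> (X i n * (e * p)) = 0" for n
      by (intro state_alternating[OF XP alternating_der(1)] tails.base p)
    moreover have "R 1 (p * 1) = 0"
      using alternating_derivative_eq_0[OF alternating_der(1) tails.base[OF p]] by simp
    moreover have "T (1 * e) 1 = 0"
    proof (rule derivation_eq_0_left[OF alternating_der(2)])
      fix l assume "l \<in> P"
      then show "\<phi> (1 * e * l) = 0"
        using state_alternating[OF alg_gen_one alternating_der(1) tails.base, of l] by simp
    qed
    ultimately show ?case by simp
  next
    case (add x T y T')
    have "\<phi> (X i n * (x + y)) = \<phi> (X i n * x) + \<phi> (X i n * y)" for n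
      using XM mixed_mem[OF add.hyps(1)] mixed_mem[OF add.hyps(2)]
      by (simp add: distrib_left state_add mult_mem)
    then show ?case using tendsto_add[OF add.IH] by simp
  next
    case (scaleC x T c)
    have "\<phi> (X i n * (c *\<^sub>C x)) = c * \<phi> (X i n * x)" for n
      using XM mixed_mem[OF scaleC.hyps(1)] by (simp add: mult_scaleC_right state_scaleC mult_mem)
    then show ?case using tendsto_mult_left[OF scaleC.IH] by simp
  next
    case (ext x T T')
    then show ?case by (simp add: one_mem)
  qed
qed

end

section \<open>Matrices over a tracial algebra\<close>

definition elementary :: "'d::finite \<Rightarrow> 'd \<Rightarrow> 'h::chilbert_space bop \<Rightarrow> ('h ^ 'd) bop" where
  "elementary i j x = bop_of_matrix (\<lambda>p q. if p = i \<and> q = j then x else 0)"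

lemma entry_elementary: "entry (elementary i j x) p q = (if p = i \<and> q = j then x else 0)"
  by (simp add: elementary_def entry_bop_of_matrix)

lemma entry_mult_elementary:
  "entry (A * elementary i j x) p q = (if q = j then entry A p i * x else 0)"
proof -
  have "entry (A * elementary i j x) p q =
      (\<Sum>r\<in>UNIV. if r = i then (if q = j then entry A p i * x else 0) else 0)"
    unfolding entry_mult entry_elementary by (intro sum.cong) auto
  then show ?thesis by simp
qed

lemma elementary_mult:
  "elementary i p x * A * elementary q j y = elementary i j (x * entry A p q * y)"
proof (rule matrix_eqI)
  fix r s
  have "entry (elementary i p x * A) r q = (\<Sum>t\<in>UNIV. if t = p then (if r = i then x * entry A p q else 0) else 0)"
    for r
    unfolding entry_mult entry_elementary by (intro sum.cong) auto
  then show "entry (elementary i p x * A * elementary q j y) r s =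
      entry (elementary i j (x * entry A p q * y)) r s"
    by (simp add: entry_mult_elementary entry_elementary)
qed

lemma elementary_one_in_scalar_matrices:
  "elementary i j 1 \<in> (scalar_matrices :: ('h::chilbert_space ^ 'd::finite) bop set)"
  unfolding scalar_matrices_def
proof (intro CollectI allI)
  fix p q
  show "\<exists>c. entry (elementary i j 1 :: ('h ^ 'd) bop) p q = c *\<^sub>C 1"
    by (intro exI[of _ "if p = i \<and> q = j then 1 else 0"]) (simp add: entry_elementary)
qed

abbreviation entries ::
  "('k \<Rightarrow> ('h::chilbert_space ^ 'd::finite) bop) \<Rightarrow> 'd \<times> 'd \<times> 'k \<Rightarrow> 'h bop" where
  "entries A \<equiv> \<lambda>(i, j, k). entry (A k) i j"

lemma entry_in_alg_gen_entries:
  assumes "x \<in> alg_gen (range A)"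
  shows "entry x i j \<in> alg_gen (range (entries A))"
  using assms
proof (induction arbitrary: i j)
  case (alg_gen_base x)
  then obtain k where "x = A k" by blast
  moreover have "entries A (i, j, k) \<in> alg_gen (range (entries A))"
    by (rule alg_gen.alg_gen_base[OF rangeI])
  ultimately show ?case by simp
next
  case (alg_gen_mult x y)
  then show ?case unfolding entry_mult by (intro alg_gen_sum alg_gen.alg_gen_mult)
qed (auto simp: entry_one entry_add entry_scaleC intro: alg_gen.intros alg_gen_zero)

lemma sum_triples:
  fixes f :: "'d::finite \<Rightarrow> 'd \<Rightarrow> 'k::finite \<Rightarrow> 'b::comm_monoid_add"
  shows "(\<Sum>(i, j, k)\<in>UNIV. f i j k) = (\<Sum>k\<in>UNIV. \<Sum>i\<in>UNIV. \<Sum>j\<in>UNIV. f i j k)"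
proof -
  have "(\<Sum>(i, j, k)\<in>UNIV. f i j k) = (\<Sum>i\<in>UNIV. \<Sum>j\<in>UNIV. \<Sum>k\<in>UNIV. f i j k)"
    by (simp add: sum.cartesian_product UNIV_Times_UNIV)
  also have "\<dots> = (\<Sum>i\<in>UNIV. \<Sum>k\<in>UNIV. \<Sum>j\<in>UNIV. f i j k)"
    by (intro sum.cong refl sum.swap)
  also have "\<dots> = (\<Sum>k\<in>UNIV. \<Sum>i\<in>UNIV. \<Sum>j\<in>UNIV. f i j k)" by (rule sum.swap)
  finally show ?thesis .
qed

context tracial_star_algebra
begin

lemma mat_trace_mult:
  fixes A B :: "('h ^ 'd::finite) bop"
  assumes "A \<in> mat_alg M" "B \<in> mat_alg M"
  shows "mat_trace \<phi> (A * B) = (\<Sum>i\<in>UNIV. \<Sum>j\<in>UNIV. \<phi> (entry A i j * entry B j i)) / of_nat CARD('d)"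
  using assms by (simp add: mat_trace_def entry_mult state_sum mult_mem mat_alg_def)

lemma tracial_mat_alg: "tracial_star_algebra (mat_alg M :: ('h ^ 'd::finite) bop set) (mat_trace \<phi>)"
proof
  fix A B :: "('h ^ 'd) bop" and c :: complex
  show "1 \<in> (mat_alg M :: ('h ^ 'd) bop set)" by (simp add: mat_alg_def entry_one one_mem zero_mem)
  show "mat_trace \<phi> (1 :: ('h ^ 'd) bop) = 1" by (simp add: mat_trace_def entry_one state_one)
  assume A: "A \<in> mat_alg M"
  then have Ae: "entry A i j \<in> M" for i j by (simp add: mat_alg_def)
  show "c *\<^sub>C A \<in> mat_alg M" using Ae by (simp add: mat_alg_def entry_scaleC scaleC_mem)
  show adjA: "adj A \<in> mat_alg M" using Ae by (simp add: mat_alg_def entry_adj adj_mem)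
  show "mat_trace \<phi> (c *\<^sub>C A) = c * mat_trace \<phi> A"
    using Ae by (simp add: mat_trace_def entry_scaleC state_scaleC sum_distrib_left)
  have "mat_trace \<phi> (adj A * A) = (\<Sum>i\<in>UNIV. \<Sum>j\<in>UNIV. \<phi> (adj (entry A j i) * entry A j i)) / of_nat CARD('d)"
    by (simp add: mat_trace_mult adjA A entry_adj)
  moreover have "0 \<le> Re (\<phi> (adj (entry A j i) * entry A j i))" "Im (\<phi> (adj (entry A j i) * entry A j i)) = 0" for i j
    using state_positive[OF Ae[of j i]] by (auto simp: complex_nonneg_Reals_iff)
  ultimately show "mat_trace \<phi> (adj A * A) \<in> \<real>\<^sub>\<ge>\<^sub>0"
    by (simp add: complex_nonneg_Reals_iff sum_nonneg)
  assume B: "B \<in> mat_alg M"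
  then have Be: "entry B i j \<in> M" for i j by (simp add: mat_alg_def)
  show "A + B \<in> mat_alg M" using Ae Be by (simp add: mat_alg_def entry_add add_mem)
  show "A * B \<in> mat_alg M" using Ae Be by (simp add: mat_alg_def entry_mult sum_mem mult_mem)
  show "mat_trace \<phi> (A + B) = mat_trace \<phi> A + mat_trace \<phi> B"
    using Ae Be by (simp add: mat_trace_def entry_add state_add sum.distrib add_divide_distrib)
  have "(\<Sum>i\<in>UNIV. \<Sum>j\<in>UNIV. \<phi> (entry A i j * entry B j i)) =
      (\<Sum>j\<in>UNIV. \<Sum>i\<in>UNIV. \<phi> (entry B j i * entry A i j))"
    using Ae Be by (subst sum.swap) (simp add: state_trace)
  then show "mat_trace \<phi> (A * B) = mat_trace \<phi> (B * A)"
    using A B by (simp add: mat_trace_mult)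
qed

lemma norm2_mat_power2:
  fixes A :: "('h ^ 'd::finite) bop"
  assumes A: "A \<in> mat_alg M"
  shows "(norm2 (mat_trace \<phi>) A)\<^sup>2 = (\<Sum>i\<in>UNIV. \<Sum>j\<in>UNIV. (norm2 \<phi> (entry A i j))\<^sup>2) / real CARD('d)"
proof -
  interpret mat: tracial_star_algebra "mat_alg M :: ('h ^ 'd) bop set" "mat_trace \<phi>"
    by (rule tracial_mat_alg)
  have Ae: "entry A i j \<in> M" for i j using A by (simp add: mat_alg_def)
  have "(norm2 (mat_trace \<phi>) A)\<^sup>2 =
      (\<Sum>i\<in>UNIV. \<Sum>j\<in>UNIV. Re (\<phi> (adj (entry A j i) * entry A j i))) / real CARD('d)"
    using A by (simp add: mat.snorm_power2 mat_trace_mult mat.adj_mem entry_adj)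
  also have "(\<Sum>i\<in>UNIV. \<Sum>j\<in>UNIV. Re (\<phi> (adj (entry A j i) * entry A j i))) =
      (\<Sum>j\<in>UNIV. \<Sum>i\<in>UNIV. (norm2 \<phi> (entry A j i))\<^sup>2)"
    using Ae by (subst sum.swap) (simp add: snorm_power2)
  finally show ?thesis .
qed

lemma norm2_entry_le:
  fixes A :: "('h ^ 'd::finite) bop"
  assumes A: "A \<in> mat_alg M"
  shows "norm2 \<phi> (entry A i j) \<le> sqrt (real CARD('d)) * norm2 (mat_trace \<phi>) A"
proof -
  interpret mat: tracial_star_algebra "mat_alg M :: ('h ^ 'd) bop set" "mat_trace \<phi>"
    by (rule tracial_mat_alg)
  have "(norm2 \<phi> (entry A i j))\<^sup>2 \<le> (\<Sum>j\<in>UNIV. (norm2 \<phi> (entry A i j))\<^sup>2)"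
    by (intro member_le_sum) auto
  also have "\<dots> \<le> (\<Sum>i\<in>UNIV. \<Sum>j\<in>UNIV. (norm2 \<phi> (entry A i j))\<^sup>2)"
    by (intro member_le_sum[of i _ "\<lambda>i. \<Sum>j\<in>UNIV. (norm2 \<phi> (entry A i j))\<^sup>2"]) (auto intro: sum_nonneg)
  also have "\<dots> = real CARD('d) * (norm2 (mat_trace \<phi>) A)\<^sup>2"
    by (simp add: norm2_mat_power2[OF A])
  finally have "(norm2 \<phi> (entry A i j))\<^sup>2 \<le> (sqrt (real CARD('d)) * norm2 (mat_trace \<phi>) A)\<^sup>2"
    by (simp add: power_mult_distrib)
  then show ?thesis
    by (rule power2_le_imp_le) (simp add: mat.snorm_nonneg A)
qed

lemma norm2_mat_le:
  fixes A :: "('h ^ 'd::finite) bop"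
  assumes A: "A \<in> mat_alg M"
  shows "norm2 (mat_trace \<phi>) A \<le> (\<Sum>(i, j)\<in>UNIV. norm2 \<phi> (entry A i j))"
proof (rule power2_le_imp_le)
  let ?s = "\<Sum>(i, j)\<in>UNIV. norm2 \<phi> (entry A i j)"
  have nonneg: "0 \<le> norm2 \<phi> (entry A i j)" for i j
    using A by (intro snorm_nonneg) (simp add: mat_alg_def)
  show s: "0 \<le> ?s" by (intro sum_nonneg) (auto simp: nonneg)
  have "(norm2 (mat_trace \<phi>) A)\<^sup>2 \<le> (\<Sum>i\<in>UNIV. \<Sum>j\<in>UNIV. (norm2 \<phi> (entry A i j))\<^sup>2)"
  proof -
    have "(\<Sum>i\<in>UNIV. \<Sum>j\<in>UNIV. (norm2 \<phi> (entry A i j))\<^sup>2) / real CARD('d)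
        \<le> (\<Sum>i\<in>UNIV. \<Sum>j\<in>UNIV. (norm2 \<phi> (entry A i j))\<^sup>2) / 1"
      by (intro divide_left_mono sum_nonneg) (auto simp: Suc_le_eq)
    then show ?thesis by (simp add: norm2_mat_power2[OF A])
  qed
  also have "\<dots> = (\<Sum>(i, j)\<in>UNIV. (norm2 \<phi> (entry A i j))\<^sup>2)"
    by (simp add: sum.cartesian_product UNIV_Times_UNIV)
  also have "\<dots> \<le> (\<Sum>(i, j)\<in>UNIV. norm2 \<phi> (entry A i j) * ?s)"
  proof (intro sum_mono, clarify)
    fix i j
    have "norm2 \<phi> (entry A i j) \<le> ?s"
      using member_le_sum[of "(i, j)" UNIV "\<lambda>(i, j). norm2 \<phi> (entry A i j)"] by (auto simp: nonneg)
    then show "(norm2 \<phi> (entry A i j))\<^sup>2 \<le> norm2 \<phi> (entry A i j) * ?s"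
      unfolding power2_eq_square by (intro mult_left_mono nonneg)
  qed
  also have "\<dots> = ?s\<^sup>2"
    by (simp add: power2_eq_square sum_distrib_right case_prod_unfold)
  finally show "(norm2 (mat_trace \<phi>) A)\<^sup>2 \<le> ?s\<^sup>2" .
qed

lemma cauchy2_entry:
  fixes X :: "nat \<Rightarrow> ('h ^ 'd::finite) bop"
  assumes X: "X \<in> cauchy2 (mat_alg M) (mat_trace \<phi>)"
  shows "(\<lambda>n. entry (X n) i j) \<in> cauchy2 M \<phi>"
proof -
  interpret mat: tracial_star_algebra "mat_alg M :: ('h ^ 'd) bop set" "mat_trace \<phi>"
    by (rule tracial_mat_alg)
  have XM: "X n \<in> mat_alg M" for n by (rule mat.cauchy2_mem[OF X])
  have "\<exists>N. \<forall>m\<ge>N. \<forall>n\<ge>N. norm2 \<phi> (entry (X m) i j - entry (X n) i j) < e" if e: "e > 0" for e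
  proof -
    have d: "sqrt (real CARD('d)) > 0" by simp
    obtain N where N: "\<And>m n. m \<ge> N \<Longrightarrow> n \<ge> N \<Longrightarrow> norm2 (mat_trace \<phi>) (X m - X n) < e / sqrt (real CARD('d))"
      using mat.cauchy2D[OF X divide_pos_pos[OF e d]] by blast
    show ?thesis
    proof (intro exI[of _ N] allI impI)
      fix m n assume "N \<le> m" "N \<le> n"
      then have "sqrt (real CARD('d)) * norm2 (mat_trace \<phi>) (X m - X n) < e"
        using N[of m n] d by (simp add: pos_less_divide_eq mult.commute)
      then show "norm2 \<phi> (entry (X m) i j - entry (X n) i j) < e"
        using norm2_entry_le[OF mat.diff_mem[OF XM XM], of m n i j] by (simp add: entry_diff)
    qed
  qed
  then show ?thesis using XM by (auto simp: cauchy2_def mat_alg_def)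
qed

lemma cauchy2_mat:
  fixes X :: "nat \<Rightarrow> ('h ^ 'd::finite) bop"
  assumes X: "\<And>i j. (\<lambda>n. entry (X n) i j) \<in> cauchy2 M \<phi>"
  shows "X \<in> cauchy2 (mat_alg M) (mat_trace \<phi>)"
proof -
  interpret mat: tracial_star_algebra "mat_alg M :: ('h ^ 'd) bop set" "mat_trace \<phi>"
    by (rule tracial_mat_alg)
  have XM: "X n \<in> mat_alg M" for n using cauchy2_mem[OF X] by (simp add: mat_alg_def)
  have "\<exists>N. \<forall>m\<ge>N. \<forall>n\<ge>N. norm2 (mat_trace \<phi>) (X m - X n) < e" if e: "e > 0" for e
  proof -
    define c where "c = real CARD('d \<times> 'd)"
    have c: "c > 0" unfolding c_def by (simp only: of_nat_0_less_iff zero_less_card_finite)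
    have "\<exists>N. \<forall>m\<ge>N. \<forall>n\<ge>N. norm2 \<phi> (entry (X m) i j - entry (X n) i j) < e / c" for i j
      by (rule cauchy2D[OF X divide_pos_pos[OF e c]])
    then obtain N where N: "\<And>i j m n. m \<ge> N i j \<Longrightarrow> n \<ge> N i j \<Longrightarrow>
        norm2 \<phi> (entry (X m) i j - entry (X n) i j) < e / c" by metis
    define N0 where "N0 = Max (range (\<lambda>(i, j). N i j))"
    have N0: "N i j \<le> N0" for i j unfolding N0_def by (intro Max_ge) (auto intro: rev_image_eqI)
    show ?thesis
    proof (intro exI[of _ N0] allI impI)
      fix m n assume mn: "N0 \<le> m" "N0 \<le> n"
      have "norm2 (mat_trace \<phi>) (X m - X n) \<le> (\<Sum>(i, j)\<in>UNIV. norm2 \<phi> (entry (X m - X n) i j))"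
        by (intro norm2_mat_le mat.diff_mem XM)
      also have "\<dots> < (\<Sum>(i, j)\<in>(UNIV :: ('d \<times> 'd) set). e / c)"
        using N[OF order_trans[OF N0 mn(1)] order_trans[OF N0 mn(2)]]
        by (intro sum_strict_mono) (auto simp: entry_diff)
      also have "\<dots> = e" using c by (simp add: c_def case_prod_unfold)
      finally show "norm2 (mat_trace \<phi>) (X m - X n) < e" .
    qed
  qed
  then show ?thesis using XM by (auto simp: cauchy2_def)
qed

lemma lim_norm2_mat_power2:
  fixes X :: "nat \<Rightarrow> ('h ^ 'd::finite) bop"
  assumes X: "X \<in> cauchy2 (mat_alg M) (mat_trace \<phi>)"
  shows "(lim (\<lambda>n. norm2 (mat_trace \<phi>) (X n)))\<^sup>2 =
    (\<Sum>i\<in>UNIV. \<Sum>j\<in>UNIV. (lim (\<lambda>n. norm2 \<phi> (entry (X n) i j)))\<^sup>2) / real CARD('d)"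
proof -
  interpret mat: tracial_star_algebra "mat_alg M :: ('h ^ 'd) bop set" "mat_trace \<phi>"
    by (rule tracial_mat_alg)
  have "(\<lambda>n. (norm2 (mat_trace \<phi>) (X n))\<^sup>2) \<longlonglongrightarrow> (lim (\<lambda>n. norm2 (mat_trace \<phi>) (X n)))\<^sup>2"
    by (intro tendsto_power mat.norm2_tendsto_lim X)
  moreover have "(\<lambda>n. (\<Sum>i\<in>UNIV. \<Sum>j\<in>UNIV. (norm2 \<phi> (entry (X n) i j))\<^sup>2) / real CARD('d)) \<longlonglongrightarrow>
      (\<Sum>i\<in>UNIV. \<Sum>j\<in>UNIV. (lim (\<lambda>n. norm2 \<phi> (entry (X n) i j)))\<^sup>2) / real CARD('d)"
    by (intro tendsto_divide tendsto_sum tendsto_power tendsto_const norm2_tendsto_lim cauchy2_entry X) simp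
  ultimately show ?thesis
    using LIMSEQ_unique norm2_mat_power2[OF mat.cauchy2_mem[OF X]] by simp
qed

lemma cauchy2_scaleC:
  assumes x: "x \<in> cauchy2 M \<phi>"
  shows "(\<lambda>n. c *\<^sub>C x n) \<in> cauchy2 M \<phi>"
proof -
  have xM: "x n \<in> M" for n by (rule cauchy2_mem[OF x])
  have "\<exists>N. \<forall>m\<ge>N. \<forall>n\<ge>N. norm2 \<phi> (c *\<^sub>C x m - c *\<^sub>C x n) < e" if e: "e > 0" for e
  proof -
    have c: "cmod c + 1 > 0" using norm_ge_zero[of c] by linarith
    obtain N where N: "\<And>m n. m \<ge> N \<Longrightarrow> n \<ge> N \<Longrightarrow> norm2 \<phi> (x m - x n) < e / (cmod c + 1)"
      using cauchy2D[OF x divide_pos_pos[OF e c]] by blast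
    show ?thesis
    proof (intro exI[of _ N] allI impI)
      fix m n assume mn: "N \<le> m" "N \<le> n"
      have eq: "c *\<^sub>C x m - c *\<^sub>C x n = c *\<^sub>C (x m - x n)"
        using scaleC_bop_add_right[of c "x m - x n" "x n"] by simp
      have "norm2 \<phi> (c *\<^sub>C x m - c *\<^sub>C x n) = cmod c * norm2 \<phi> (x m - x n)"
        unfolding eq by (intro snorm_scaleC diff_mem xM)
      also have "\<dots> \<le> (cmod c + 1) * norm2 \<phi> (x m - x n)"
        by (intro mult_right_mono snorm_nonneg diff_mem xM) simp
      also have "\<dots> < e" using N[OF mn] c by (simp add: pos_less_divide_eq mult.commute)
      finally show "norm2 \<phi> (c *\<^sub>C x m - c *\<^sub>C x n) < e" .
    qed
  qed
  then show ?thesis using xM by (auto simp: cauchy2_def scaleC_mem)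
qed

lemma lim_norm2_scaleC:
  assumes x: "x \<in> cauchy2 M \<phi>"
  shows "lim (\<lambda>n. norm2 \<phi> (c *\<^sub>C x n)) = cmod c * lim (\<lambda>n. norm2 \<phi> (x n))"
proof (rule limI)
  have "norm2 \<phi> (c *\<^sub>C x n) = cmod c * norm2 \<phi> (x n)" for n
    by (rule snorm_scaleC[OF cauchy2_mem[OF x]])
  then show "(\<lambda>n. norm2 \<phi> (c *\<^sub>C x n)) \<longlonglongrightarrow> cmod c * lim (\<lambda>n. norm2 \<phi> (x n))"
    by (simp add: tendsto_mult_left norm2_tendsto_lim[OF x])
qed

text \<open>
  The expansion of an entry of a word over index paths from \<open>p\<close> to \<open>q\<close>: removing the letter \<open>A k\<close> with
  indices \<open>(i, j)\<close> leaves a path from \<open>p\<close> to \<open>i\<close> and one from \<open>j\<close> to \<open>q\<close>.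
\<close>

lemma derivation_entry_word:
  fixes A :: "'k::finite \<Rightarrow> ('h ^ 'd::finite) bop"
  assumes A: "\<And>k. A k \<in> mat_alg M"
  shows "\<exists>T. derivation \<phi> (entries A) (i, j, k) (entry (word A w) p q) T \<and>
    (\<forall>u\<in>M. \<forall>v\<in>M. T u v = (\<Sum>m<length w. if w ! m = k
      then \<phi> (u * entry (word A (take m w)) p i) * \<phi> (entry (word A (drop (Suc m) w)) j q * v) else 0))"
proof (induction w arbitrary: q rule: rev_induct)
  case Nil
  show ?case
    by (intro exI[of _ "\<lambda>u v. 0"]) (simp add: entry_one derivation_one derivation_zero)
next
  case (snoc k' w)
  have range: "range (entries A) \<subseteq> M" using A by (auto simp: mat_alg_def)
  interpret variables M \<phi> "entries A" "(i, j, k)" by unfold_locales (rule range)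
  interpret mat: tracial_star_algebra "mat_alg M :: ('h ^ 'd) bop set" "mat_trace \<phi>"
    by (rule tracial_mat_alg)
  have eM: "entry (A k) r s \<in> M" for k r s using A by (simp add: mat_alg_def)
  have "word A w \<in> mat_alg M" for w
    using mat.alg_gen_subset[OF _ word_mem_alg_gen, of A] A by blast
  then have wM: "entry (word A w) r s \<in> M" for w r s by (simp add: mat_alg_def)
  \<comment> \<open>the derivative of the part of the expansion with last step from \<open>r\<close> to \<open>q\<close>\<close>
  define F where "F r u v = (\<Sum>m<length w. if w ! m = k
      then \<phi> (u * entry (word A (take m w)) p i) *
        \<phi> (entry (word A (drop (Suc m) w)) j r * (entry (A k') r q * v)) else 0) +
     (if (r, q, k') = (i, j, k) then \<phi> (u * entry (word A w) p r) * \<phi> v else 0)" for r u v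
  have "\<exists>T. der (entry (word A w) p r * entry (A k') r q) T \<and> (\<forall>u\<in>M. \<forall>v\<in>M. T u v = F r u v)" for r
  proof -
    obtain T where T: "der (entry (word A w) p r) T" "\<And>u v. u \<in> M \<Longrightarrow> v \<in> M \<Longrightarrow>
      T u v = (\<Sum>m<length w. if w ! m = k
      then \<phi> (u * entry (word A (take m w)) p i) * \<phi> (entry (word A (drop (Suc m) w)) j r * v) else 0)"
      using snoc.IH[of r] by blast
    obtain T' where T': "der (entry (word A w) p r * entries A (r, q, k')) T'" "\<And>u v. u \<in> M \<Longrightarrow> v \<in> M \<Longrightarrow>
      T' u v = T u (entries A (r, q, k') * v) +
        (if (r, q, k') = (i, j, k) then \<phi> (u * entry (word A w) p r) * \<phi> v else 0)"
      using derivation_mult_base[OF T(1), of "(r, q, k')"] by blast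
    show ?thesis
      using T'(1) by (intro exI[of _ T'] conjI ballI) (simp_all add: T'(2) T(2) mult_mem eM F_def)
  qed
  then obtain T where T: "\<And>r. der (entry (word A w) p r * entry (A k') r q) (T r)"
    "\<And>r u v. u \<in> M \<Longrightarrow> v \<in> M \<Longrightarrow> T r u v = F r u v" by metis
  have "entry (word A (w @ [k'])) p q = (\<Sum>r\<in>UNIV. entry (word A w) p r * entry (A k') r q)"
    by (simp add: entry_mult)
  then have der: "der (entry (word A (w @ [k'])) p q) (\<lambda>u v. \<Sum>r\<in>UNIV. T r u v)"
    using derivation_sum[of UNIV \<phi> "entries A" "(i, j, k)" "\<lambda>r. entry (word A w) p r * entry (A k') r q" T] T(1)
    by simp
  have val: "(\<Sum>r\<in>UNIV. T r u v) = (\<Sum>m<length (w @ [k']). if (w @ [k']) ! m = k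
      then \<phi> (u * entry (word A (take m (w @ [k']))) p i) *
        \<phi> (entry (word A (drop (Suc m) (w @ [k']))) j q * v) else 0)" if uv: "u \<in> M" "v \<in> M" for u v
  proof -
    have "(\<Sum>r\<in>UNIV. \<phi> (entry x j r * (entry (A k') r q * v))) = \<phi> (entry (x * A k') j q * v)"
      if "\<And>r. entry x j r \<in> M" for x
    proof -
      have "entry (x * A k') j q * v = (\<Sum>r\<in>UNIV. entry x j r * (entry (A k') r q * v))"
        by (simp add: entry_mult sum_distrib_right mult.assoc)
      then show ?thesis using that uv by (simp add: state_sum mult_mem eM)
    qed
    then have contract: "(\<Sum>r\<in>UNIV. \<phi> (entry (word A x) j r * (entry (A k') r q * v))) =
        \<phi> (entry (word A x * A k') j q * v)" for x by (simp add: wM)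
    have "(\<Sum>r\<in>UNIV. \<Sum>m<length w. if w ! m = k
        then \<phi> (u * entry (word A (take m w)) p i) *
          \<phi> (entry (word A (drop (Suc m) w)) j r * (entry (A k') r q * v)) else 0) =
      (\<Sum>m<length w. if w ! m = k
        then \<phi> (u * entry (word A (take m w)) p i) *
          (\<Sum>r\<in>UNIV. \<phi> (entry (word A (drop (Suc m) w)) j r * (entry (A k') r q * v))) else 0)"
      by (subst sum.swap, intro sum.cong refl) (simp add: sum_distrib_left)
    also have "\<dots> = (\<Sum>m<length w. if (w @ [k']) ! m = k
      then \<phi> (u * entry (word A (take m (w @ [k']))) p i) *
        \<phi> (entry (word A (drop (Suc m) (w @ [k']))) j q * v) else 0)"
      unfolding contract by (intro sum.cong) (auto simp: nth_append)
    finally have first: "(\<Sum>r\<in>UNIV. \<Sum>m<length w. if w ! m = k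
        then \<phi> (u * entry (word A (take m w)) p i) *
          \<phi> (entry (word A (drop (Suc m) w)) j r * (entry (A k') r q * v)) else 0) = \<dots>" .
    have second: "(\<Sum>r\<in>UNIV. if (r, q, k') = (i, j, k) then \<phi> (u * entry (word A w) p r) * \<phi> v else 0) =
      (if k' = k then \<phi> (u * entry (word A w) p i) * \<phi> (entry (1 :: ('h ^ 'd) bop) j q * v) else 0)"
    proof -
      have "(\<Sum>r\<in>UNIV. if (r, q, k') = (i, j, k) then \<phi> (u * entry (word A w) p r) * \<phi> v else 0) =
        (\<Sum>r\<in>UNIV. if r = i then (if q = j \<and> k' = k then \<phi> (u * entry (word A w) p i) * \<phi> v else 0) else 0)"
        by (intro sum.cong) auto
      also have "\<dots> = (if q = j \<and> k' = k then \<phi> (u * entry (word A w) p i) * \<phi> v else 0)" by simp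
      finally show ?thesis by (auto simp: entry_one state_zero)
    qed
    show ?thesis
      unfolding T(2)[OF uv] F_def sum.distrib first second by simp
  qed
  show ?case using der val by blast
qed


text \<open>
  The power \<open>d\<^sup>3\<close>: two factors come from the scaling of the entries by \<open>d\<close> in \<open>L\<close>, the third from the
  normalisation of \<open>mat_trace\<close>.
\<close>

lemma sum_ennreal_lim_norm2_entries:
  fixes X :: "'k::finite \<Rightarrow> nat \<Rightarrow> ('h ^ 'd::finite) bop"
  assumes X: "\<And>k. X k \<in> cauchy2 (mat_alg M) (mat_trace \<phi>)"
    and L: "\<And>i j k. L (i, j, k) = real CARD('d) * lim (\<lambda>n. norm2 \<phi> (entry (X k n) j i))"
  shows "(\<Sum>t\<in>UNIV. ennreal ((L t)\<^sup>2)) =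
    of_nat (CARD('d) ^ 3) * (\<Sum>k\<in>UNIV. ennreal ((lim (\<lambda>n. norm2 (mat_trace \<phi>) (X k n)))\<^sup>2))"
proof -
  let ?d = "real CARD('d)"
  have "(\<Sum>i\<in>UNIV. \<Sum>j\<in>UNIV. (L (i, j, k))\<^sup>2) =
      ?d ^ 3 * (lim (\<lambda>n. norm2 (mat_trace \<phi>) (X k n)))\<^sup>2" for k
  proof -
    have "(\<Sum>i\<in>UNIV. \<Sum>j\<in>UNIV. (L (i, j, k))\<^sup>2) =
        ?d\<^sup>2 * (\<Sum>j\<in>UNIV. \<Sum>i\<in>UNIV. (lim (\<lambda>n. norm2 \<phi> (entry (X k n) j i)))\<^sup>2)"
      by (subst sum.swap) (simp add: L power_mult_distrib sum_distrib_left)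
    also have "(\<Sum>j\<in>UNIV. \<Sum>i\<in>UNIV. (lim (\<lambda>n. norm2 \<phi> (entry (X k n) j i)))\<^sup>2) =
        ?d * (lim (\<lambda>n. norm2 (mat_trace \<phi>) (X k n)))\<^sup>2"
      by (simp add: lim_norm2_mat_power2[OF X])
    finally show ?thesis by (simp add: power3_eq_cube power2_eq_square)
  qed
  then have "(\<Sum>i\<in>UNIV. \<Sum>j\<in>UNIV. ennreal ((L (i, j, k))\<^sup>2)) =
      of_nat (CARD('d) ^ 3) * ennreal ((lim (\<lambda>n. norm2 (mat_trace \<phi>) (X k n)))\<^sup>2)" for k
    by (simp add: sum_nonneg ennreal_mult ennreal_of_nat_eq_real_of_nat ennreal_power[symmetric])
  moreover have "(\<lambda>t. ennreal ((L t)\<^sup>2)) = (\<lambda>(i, j, k). ennreal ((L (i, j, k))\<^sup>2))"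
    by auto
  ultimately show ?thesis
    unfolding sum_distrib_left by (simp only: sum_triples)
qed

lemma entries_family:
  fixes A :: "'k::finite \<Rightarrow> ('h ^ 'd::finite) bop"
  assumes "\<And>k. A k \<in> mat_alg M" "\<And>k. adj (A k) \<in> range A"
  shows "range (entries A) \<subseteq> M" "adj (entries A t) \<in> range (entries A)"
proof -
  show "range (entries A) \<subseteq> M" using assms(1) by (auto simp: mat_alg_def)
  obtain i j k where t: "t = (i, j, k)" by (cases t)
  obtain k' where "adj (A k) = A k'" using assms(2)[of k] by blast
  then have "adj (entries A t) = entries A (j, i, k')" unfolding t by (simp flip: entry_adj)
  then show "adj (entries A t) \<in> range (entries A)" by (rule range_eqI)
qed

section \<open>The inequality\<close>

theorem free_fisher_entries_ge:
  fixes A :: "'k::finite \<Rightarrow> ('h ^ 'd::finite) bop"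
  assumes A: "\<And>k. A k \<in> mat_alg M" "\<And>k. adj (A k) \<in> range A"
  shows "of_nat (CARD('d) ^ 3) * free_fisher (mat_alg M) (mat_trace \<phi>) A \<le> free_fisher M \<phi> (entries A)"
proof (cases "\<exists>X. conjugate_sequences M \<phi> (entries A) X")
  case False
  then have "free_fisher M \<phi> (entries A) = \<infinity>"
    using entries_family(1)[OF A] by (intro free_fisher_infinite) auto
  then show ?thesis by simp
next
  case True
  then obtain X where X: "conjugate_sequences M \<phi> (entries A) X" by blast
  interpret mat: tracial_star_algebra "mat_alg M :: ('h ^ 'd) bop set" "mat_trace \<phi>"
    by (rule tracial_mat_alg)
  let ?d = "of_nat CARD('d) :: complex"
  note entries = entries_family[OF A]
  have rangeA: "range A \<subseteq> mat_alg M" using A(1) by blast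
  have XC: "X t \<in> cauchy2 M \<phi>" for t using X unfolding conjugate_sequences_def by blast
  have wM: "word A w \<in> mat_alg M" for w
    using mat.alg_gen_subset[OF rangeA word_mem_alg_gen] by blast
  \<comment> \<open>the factor \<open>1/d\<close>: two unnormalised traces and one normalisation give \<open>d\<^sup>2 / d\<close> times the relation\<close>
  define \<Xi> :: "'k \<Rightarrow> nat \<Rightarrow> ('h ^ 'd) bop" where
    "\<Xi> k n = bop_of_matrix (\<lambda>i j. (1 / ?d) *\<^sub>C X (j, i, k) n)" for k n
  have entry_\<Xi>: "entry (\<Xi> k n) i j = (1 / ?d) *\<^sub>C X (j, i, k) n" for k n i j
    by (simp add: \<Xi>_def entry_bop_of_matrix)
  have \<Xi>C: "\<Xi> k \<in> cauchy2 (mat_alg M) (mat_trace \<phi>)" for k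
    by (rule cauchy2_mat) (simp add: entry_\<Xi> cauchy2_scaleC XC)
  have rel: "(\<lambda>n. mat_trace \<phi> (\<Xi> k n * word A w)) \<longlonglongrightarrow> word_derivative (mat_trace \<phi>) A k w 1 1" for k w
  proof -
    \<comment> \<open>paths from \<open>j\<close> to \<open>i\<close> split into a closed path at \<open>j\<close> and a closed path at \<open>i\<close>\<close>
    have lim: "(\<lambda>n. \<phi> (X (j, i, k) n * entry (word A w) j i)) \<longlonglongrightarrow> (\<Sum>m<length w. if w ! m = k
        then \<phi> (entry (word A (take m w)) j j) * \<phi> (entry (word A (drop (Suc m) w)) i i) else 0)" for i j
    proof -
      interpret variables M \<phi> "entries A" "(j, i, k)" by unfold_locales (rule entries(1))
      obtain T where T: "der (entry (word A w) j i) T" "T 1 1 = (\<Sum>m<length w. if w ! m = k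
          then \<phi> (1 * entry (word A (take m w)) j j) * \<phi> (entry (word A (drop (Suc m) w)) i i * 1) else 0)"
        using derivation_entry_word[where A = A and i = j and j = i and k = k and w = w and p = j and q = i, OF A(1)] one_mem
        by blast
      from derivation_conjugate_relation[OF X T(1)] show ?thesis
        unfolding T(2) mult_1_left mult_1_right .
    qed
    have "(\<lambda>n. (\<Sum>i\<in>UNIV. \<Sum>j\<in>UNIV. (1 / ?d) * \<phi> (X (j, i, k) n * entry (word A w) j i)) / ?d) \<longlonglongrightarrow>
      (\<Sum>i\<in>UNIV. \<Sum>j\<in>UNIV. (1 / ?d) * (\<Sum>m<length w. if w ! m = k
        then \<phi> (entry (word A (take m w)) j j) * \<phi> (entry (word A (drop (Suc m) w)) i i) else 0)) / ?d"
      by (intro tendsto_divide tendsto_sum tendsto_mult tendsto_const lim) simp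
    also have "(\<lambda>n. (\<Sum>i\<in>UNIV. \<Sum>j\<in>UNIV. (1 / ?d) * \<phi> (X (j, i, k) n * entry (word A w) j i)) / ?d) =
        (\<lambda>n. mat_trace \<phi> (\<Xi> k n * word A w))"
    proof
      fix n
      have "\<phi> ((1 / ?d) *\<^sub>C X (j, i, k) n * entry (word A w) j i) =
          (1 / ?d) * \<phi> (X (j, i, k) n * entry (word A w) j i)" for i j
        using cauchy2_mem[OF XC] wM[of w] by (simp add: mult_scaleC_left state_scaleC mult_mem mat_alg_def)
      then show "(\<Sum>i\<in>UNIV. \<Sum>j\<in>UNIV. (1 / ?d) * \<phi> (X (j, i, k) n * entry (word A w) j i)) / ?d =
          mat_trace \<phi> (\<Xi> k n * word A w)"
        by (simp add: mat_trace_mult[OF mat.cauchy2_mem[OF \<Xi>C] wM] entry_\<Xi>)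
    qed
    also have "(\<Sum>i\<in>UNIV. \<Sum>j\<in>UNIV. (1 / ?d) * (\<Sum>m<length w. if w ! m = k
        then \<phi> (entry (word A (take m w)) j j) * \<phi> (entry (word A (drop (Suc m) w)) i i) else 0)) / ?d =
      word_derivative (mat_trace \<phi>) A k w 1 1"
    proof -
      have "(\<Sum>i\<in>UNIV. \<Sum>j\<in>UNIV. (1 / ?d) * (\<Sum>m<length w. if w ! m = k
          then \<phi> (entry (word A (take m w)) j j) * \<phi> (entry (word A (drop (Suc m) w)) i i) else 0)) / ?d =
        (\<Sum>i\<in>UNIV. \<Sum>j\<in>UNIV. \<Sum>m<length w. if w ! m = k
          then (\<phi> (entry (word A (take m w)) j j) / ?d) * (\<phi> (entry (word A (drop (Suc m) w)) i i) / ?d) else 0)"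
        unfolding sum_distrib_left sum_divide_distrib by (intro sum.cong refl) simp
      also have "\<dots> = (\<Sum>m<length w. \<Sum>i\<in>UNIV. \<Sum>j\<in>UNIV. if w ! m = k
          then (\<phi> (entry (word A (take m w)) j j) / ?d) * (\<phi> (entry (word A (drop (Suc m) w)) i i) / ?d) else 0)"
        by (subst (2) sum.swap, subst sum.swap) (rule refl)
      also have "\<dots> = word_derivative (mat_trace \<phi>) A k w 1 1"
        unfolding word_derivative_one_one mat_trace_def
        by (intro sum.cong refl, subst sum.swap) (simp add: sum_divide_distrib sum_product)
      finally show ?thesis .
    qed
    finally show ?thesis .
  qed
  have adjA: "adj x \<in> alg_gen (range A)" if "x \<in> alg_gen (range A)" for x
    using that A(2) by (intro alg_gen_adj) auto
  have "\<exists>y. y \<in> cauchy2 (mat_alg M) (mat_trace \<phi>) \<and> range y \<subseteq> alg_gen (range A) \<and>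
      (\<forall>w. (\<lambda>n. mat_trace \<phi> (y n * word A w)) \<longlonglongrightarrow> word_derivative (mat_trace \<phi>) A k w 1 1) \<and>
      lim (\<lambda>n. norm2 (mat_trace \<phi>) (y n)) \<le> lim (\<lambda>n. norm2 (mat_trace \<phi>) (\<Xi> k n))" for k
  proof (rule mat.l2_projection[OF \<Xi>C[of k], of "alg_gen (range A)"])
    fix y
    assume "y \<in> cauchy2 (mat_alg M) (mat_trace \<phi>)" "range y \<subseteq> alg_gen (range A)"
      and lim: "\<And>v c. v \<in> alg_gen (range A) \<Longrightarrow> (\<lambda>n. mat_trace \<phi> (\<Xi> k n * v)) \<longlonglongrightarrow> c \<Longrightarrow>
        (\<lambda>n. mat_trace \<phi> (y n * v)) \<longlonglongrightarrow> c"
      and "lim (\<lambda>n. norm2 (mat_trace \<phi>) (y n)) \<le> lim (\<lambda>n. norm2 (mat_trace \<phi>) (\<Xi> k n))"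
    moreover have "(\<lambda>n. mat_trace \<phi> (y n * word A w)) \<longlonglongrightarrow> word_derivative (mat_trace \<phi>) A k w 1 1" for w
      by (intro lim rel word_mem_alg_gen)
    ultimately show ?thesis by blast
  qed (use mat.alg_gen_subset[OF rangeA] in \<open>auto intro: alg_gen.intros alg_gen_zero adjA\<close>)
  then obtain Y where Y: "\<And>k. Y k \<in> cauchy2 (mat_alg M) (mat_trace \<phi>)" "\<And>k. range (Y k) \<subseteq> alg_gen (range A)"
      "\<And>k w. (\<lambda>n. mat_trace \<phi> (Y k n * word A w)) \<longlonglongrightarrow> word_derivative (mat_trace \<phi>) A k w 1 1"
      "\<And>k. lim (\<lambda>n. norm2 (mat_trace \<phi>) (Y k n)) \<le> lim (\<lambda>n. norm2 (mat_trace \<phi>) (\<Xi> k n))" by metis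
  have "0 \<le> lim (\<lambda>n. norm2 (mat_trace \<phi>) (Y k n))" for k
    by (rule LIMSEQ_le_const[OF mat.norm2_tendsto_lim[OF Y(1)]])
      (auto intro!: mat.snorm_nonneg mat.cauchy2_mem[OF Y(1)])
  then have norms: "ennreal ((lim (\<lambda>n. norm2 (mat_trace \<phi>) (Y k n)))\<^sup>2)
      \<le> ennreal ((lim (\<lambda>n. norm2 (mat_trace \<phi>) (\<Xi> k n)))\<^sup>2)" for k
    by (intro ennreal_leI power_mono Y(4))
  have "conjugate_sequences (mat_alg M) (mat_trace \<phi>) A Y" using Y by (simp add: conjugate_sequences_def)
  then have "free_fisher (mat_alg M) (mat_trace \<phi>) A =
      (\<Sum>k\<in>UNIV. ennreal ((lim (\<lambda>n. norm2 (mat_trace \<phi>) (Y k n)))\<^sup>2))"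
    by (rule mat.free_fisher_eq[OF rangeA A(2)])
  also have "\<dots> \<le> (\<Sum>k\<in>UNIV. ennreal ((lim (\<lambda>n. norm2 (mat_trace \<phi>) (\<Xi> k n)))\<^sup>2))"
    by (intro sum_mono norms)
  finally have "of_nat (CARD('d) ^ 3) * free_fisher (mat_alg M) (mat_trace \<phi>) A \<le>
      of_nat (CARD('d) ^ 3) * (\<Sum>k\<in>UNIV. ennreal ((lim (\<lambda>n. norm2 (mat_trace \<phi>) (\<Xi> k n)))\<^sup>2))"
    by (intro mult_left_mono) simp_all
  also have "\<dots> = (\<Sum>t\<in>UNIV. ennreal ((lim (\<lambda>n. norm2 \<phi> (X t n)))\<^sup>2))"
    by (rule sum_ennreal_lim_norm2_entries[OF \<Xi>C, symmetric])
      (simp add: entry_\<Xi> lim_norm2_scaleC[OF XC] norm_divide)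
  also have "\<dots> = free_fisher M \<phi> (entries A)"
    by (rule free_fisher_eq[OF entries X, symmetric])
  finally show ?thesis .
qed

section \<open>Equality under freeness\<close>

lemma mat_trace_elementary:
  "mat_trace \<phi> (elementary i j x :: ('h ^ 'd::finite) bop) = (if i = j then \<phi> x / of_nat CARD('d) else 0)"
proof -
  have "(\<Sum>p\<in>UNIV. \<phi> (entry (elementary i j x :: ('h ^ 'd) bop) p p)) =
      (\<Sum>p\<in>UNIV. if p = i then (if i = j then \<phi> x else 0) else 0)"
    by (intro sum.cong) (auto simp: entry_elementary state_zero)
  then show ?thesis by (simp add: mat_trace_def)
qed

lemma mat_trace_mult_elementary:
  "mat_trace \<phi> (A * elementary i j x :: ('h ^ 'd::finite) bop) = \<phi> (entry A j i * x) / of_nat CARD('d)"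
proof -
  have "(\<Sum>p\<in>UNIV. \<phi> (entry (A * elementary i j x) p p)) =
      (\<Sum>p\<in>UNIV. if p = j then \<phi> (entry A j i * x) else 0)"
    by (intro sum.cong) (auto simp: entry_mult_elementary state_zero)
  then show ?thesis by (simp add: mat_trace_def)
qed

text \<open>
  A product of entries at the place \<open>(i, j)\<close> is a word in \<open>A\<close> and matrix units, by
  \<open>elementary_mult\<close>.  Its derivative with respect to \<open>A k\<close> cuts it at every letter that is an entry of
  \<open>A k\<close>, whatever the position \<open>(p, q)\<close> of that entry; the traces of the two halves select the position.
\<close>

lemma mixed_elementary_word:
  fixes A :: "'k::finite \<Rightarrow> ('h ^ 'd::finite) bop"
  assumes "free_variables (mat_alg M) (mat_trace \<phi>) A (scalar_matrices :: ('h ^ 'd) bop set)"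
  shows "free_variables.mixed (mat_alg M) (mat_trace \<phi>) A k scalar_matrices (elementary i j (word (entries A) w))
    (\<lambda>u v. \<Sum>m<length w. case w ! m of (p, q, k') \<Rightarrow> if k' = k
      then mat_trace \<phi> (u * elementary i p (word (entries A) (take m w))) *
        mat_trace \<phi> (elementary q j (word (entries A) (drop (Suc m) w)) * v) else 0)"
proof -
  interpret mat: tracial_star_algebra "mat_alg M :: ('h ^ 'd) bop set" "mat_trace \<phi>"
    by (rule tracial_mat_alg)
  interpret free_variables "mat_alg M" "mat_trace \<phi>" A k "scalar_matrices :: ('h ^ 'd) bop set"
    by (rule assms)
  have el: "elementary i j 1 \<in> B" for i j
    by (intro alg_gen_base elementary_one_in_scalar_matrices)
  show ?thesis
  proof (induction w arbitrary: j rule: rev_induct)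
    case Nil
    have "mixed (1 * elementary i j 1) (act_right (\<lambda>u v. 0) (elementary i j 1))"
      by (intro mixed_mult_free mixed.der derivation_one el)
    then show ?case by (auto intro: mixed.ext)
  next
    case (snoc t w)
    obtain p q k' where t: "t = (p, q, k')" by (cases t)
    let ?a = "entries A"
    have split: "elementary r p (word ?a w') * A k' * elementary q j 1 =
        elementary r j (word ?a (w' @ [t]))" for r w'
      by (simp add: elementary_mult t)
    from mixed_mult_free[OF mixed_mult_base[OF snoc.IH[of p], of k'] el[of q j]]
    have step: "mixed (elementary i p (word ?a w) * A k' * elementary q j 1)
      (act_right (\<lambda>u v. (\<Sum>m<length w. case w ! m of (p', q', l) \<Rightarrow> if l = k
        then mat_trace \<phi> (u * elementary i p' (word ?a (take m w))) *
          mat_trace \<phi> (elementary q' p (word ?a (drop (Suc m) w)) * (A k' * v)) else 0) +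
        (if k' = k then mat_trace \<phi> (u * elementary i p (word ?a w)) * mat_trace \<phi> v else 0))
        (elementary q j 1))" .
    have "(\<Sum>m<length (w @ [t]). case (w @ [t]) ! m of (p', q', l) \<Rightarrow> if l = k
        then mat_trace \<phi> (u * elementary i p' (word ?a (take m (w @ [t])))) *
          mat_trace \<phi> (elementary q' j (word ?a (drop (Suc m) (w @ [t]))) * v) else 0) =
      (\<Sum>m<length w. case w ! m of (p', q', l) \<Rightarrow> if l = k
        then mat_trace \<phi> (u * elementary i p' (word ?a (take m w))) *
          mat_trace \<phi> (elementary q' p (word ?a (drop (Suc m) w)) * (A k' * (elementary q j 1 * v))) else 0) +
        (if k' = k then mat_trace \<phi> (u * elementary i p (word ?a w)) * mat_trace \<phi> (elementary q j 1 * v) else 0)"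
      for u v
    proof -
      have "elementary q' p (word ?a w') * (A k' * (elementary q j 1 * v)) =
          elementary q' j (word ?a (w' @ [t])) * v" for q' w'
        by (simp only: split[symmetric] mult.assoc)
      then have "(\<Sum>m<length w. case w ! m of (p', q', l) \<Rightarrow> if l = k
        then mat_trace \<phi> (u * elementary i p' (word ?a (take m w))) *
          mat_trace \<phi> (elementary q' p (word ?a (drop (Suc m) w)) * (A k' * (elementary q j 1 * v))) else 0) =
        (\<Sum>m<length w. case (w @ [t]) ! m of (p', q', l) \<Rightarrow> if l = k
        then mat_trace \<phi> (u * elementary i p' (word ?a (take m (w @ [t])))) *
          mat_trace \<phi> (elementary q' j (word ?a (drop (Suc m) (w @ [t]))) * v) else 0)"
        by (intro sum.cong) (auto simp: nth_append split: prod.splits)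
      then show ?thesis by (simp add: t)
    qed
    with mixed.ext[OF step[unfolded split]] show ?case by simp
  qed
qed

theorem free_fisher_entries_eq:
  fixes A :: "'k::finite \<Rightarrow> ('h ^ 'd::finite) bop"
  assumes A: "\<And>k. A k \<in> mat_alg M" "\<And>k. adj (A k) \<in> range A"
    and free: "free_from (mat_trace \<phi>) (range A) scalar_matrices"
  shows "free_fisher M \<phi> (entries A) = of_nat (CARD('d) ^ 3) * free_fisher (mat_alg M) (mat_trace \<phi>) A"
proof (cases "\<exists>\<Xi>. conjugate_sequences (mat_alg M) (mat_trace \<phi>) A \<Xi>")
  case False
  interpret mat: tracial_star_algebra "mat_alg M :: ('h ^ 'd) bop set" "mat_trace \<phi>"
    by (rule tracial_mat_alg)
  have "free_fisher (mat_alg M) (mat_trace \<phi>) A = \<infinity>"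
    using False A(1) by (intro mat.free_fisher_infinite) auto
  then have "of_nat (CARD('d) ^ 3) * free_fisher (mat_alg M) (mat_trace \<phi>) A = \<infinity>"
    by (simp add: ennreal_mult_top)
  then show ?thesis using free_fisher_entries_ge[OF A] by (simp add: top_unique)
next
  case True
  then obtain \<Xi> where \<Xi>: "conjugate_sequences (mat_alg M) (mat_trace \<phi>) A \<Xi>" by blast
  interpret mat: tracial_star_algebra "mat_alg M :: ('h ^ 'd) bop set" "mat_trace \<phi>"
    by (rule tracial_mat_alg)
  let ?d = "of_nat CARD('d) :: complex"
  note entries = entries_family[OF A]
  have rangeA: "range A \<subseteq> mat_alg M" using A(1) by blast
  have scalar: "(scalar_matrices :: ('h ^ 'd) bop set) \<subseteq> mat_alg M"
  proof
    fix x :: "('h ^ 'd) bop" assume x: "x \<in> scalar_matrices"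
    have "entry x i j \<in> M" for i j
    proof -
      obtain c where "entry x i j = c *\<^sub>C 1" using x by (auto simp: scalar_matrices_def)
      then show ?thesis by (simp add: scaleC_mem one_mem)
    qed
    then show "x \<in> mat_alg M" by (simp add: mat_alg_def)
  qed
  have fv: "free_variables (mat_alg M) (mat_trace \<phi>) A (scalar_matrices :: ('h ^ 'd) bop set)"
    by unfold_locales (rule rangeA scalar free)+
  have \<Xi>C: "\<Xi> k \<in> cauchy2 (mat_alg M) (mat_trace \<phi>)" and \<Xi>P: "\<Xi> k n \<in> alg_gen (range A)" for k n
    using \<Xi> by (auto simp: conjugate_sequences_def)
  define X :: "'d \<times> 'd \<times> 'k \<Rightarrow> nat \<Rightarrow> 'h bop" where
    "X = (\<lambda>(i, j, k) n. ?d *\<^sub>C entry (\<Xi> k n) j i)"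
  have XC: "X (i, j, k) \<in> cauchy2 M \<phi>" for i j k
    unfolding X_def by (simp add: cauchy2_scaleC cauchy2_entry \<Xi>C)
  have wM: "word (entries A) w \<in> M" for w
    using alg_gen_subset[OF entries(1) word_mem_alg_gen] by blast
  have rel: "(\<lambda>n. \<phi> (X (i, j, k) n * word (entries A) w)) \<longlonglongrightarrow> word_derivative \<phi> (entries A) (i, j, k) w 1 1"
    for i j k w
  proof -
    interpret free_variables "mat_alg M" "mat_trace \<phi>" A k "scalar_matrices :: ('h ^ 'd) bop set"
      by (rule fv)
    \<comment> \<open>of the two factors \<open>d\<close>, one comes from \<open>X\<close> and one undoes the normalisation of the trace; on the
      right they cancel those of two traces, which are nonzero only if \<open>p = i\<close> and \<open>q = j\<close>\<close>
    have "(\<lambda>n. ?d\<^sup>2 * mat_trace \<phi> (\<Xi> k n * elementary i j (word (entries A) w))) \<longlonglongrightarrow>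
      ?d\<^sup>2 * (\<Sum>m<length w. case w ! m of (p, q, k') \<Rightarrow> if k' = k
      then mat_trace \<phi> (1 * elementary i p (word (entries A) (take m w))) *
        mat_trace \<phi> (elementary q j (word (entries A) (drop (Suc m) w)) * 1) else 0)"
      by (intro tendsto_mult_left mixed_conjugate_relation[OF \<Xi> mixed_elementary_word[OF fv]])
    also have "(\<lambda>n. ?d\<^sup>2 * mat_trace \<phi> (\<Xi> k n * elementary i j (word (entries A) w))) =
        (\<lambda>n. \<phi> (X (i, j, k) n * word (entries A) w))"
    proof
      fix n
      have "entry (\<Xi> k n) j i \<in> M" using mat.cauchy2_mem[OF \<Xi>C] by (simp add: mat_alg_def)
      then show "?d\<^sup>2 * mat_trace \<phi> (\<Xi> k n * elementary i j (word (entries A) w)) =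
          \<phi> (X (i, j, k) n * word (entries A) w)"
        using wM[of w]
        by (simp add: X_def mat_trace_mult_elementary mult_scaleC_left state_scaleC mult_mem power2_eq_square)
    qed
    also have "?d\<^sup>2 * (\<Sum>m<length w. case w ! m of (p, q, k') \<Rightarrow> if k' = k
      then mat_trace \<phi> (1 * elementary i p (word (entries A) (take m w))) *
        mat_trace \<phi> (elementary q j (word (entries A) (drop (Suc m) w)) * 1) else 0) =
      word_derivative \<phi> (entries A) (i, j, k) w 1 1"
      unfolding word_derivative_one_one sum_distrib_left mult_1_left mult_1_right mat_trace_elementary
      by (intro sum.cong) (auto simp: power2_eq_square split: prod.splits)
    finally show ?thesis .
  qed
  have X: "conjugate_sequences M \<phi> (entries A) X"
    unfolding conjugate_sequences_def
  proof (intro conjI allI)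
    fix t :: "'d \<times> 'd \<times> 'k" and w :: "('d \<times> 'd \<times> 'k) list"
    obtain i j k where t: "t = (i, j, k)" by (cases t)
    show "X t \<in> cauchy2 M \<phi>" unfolding t by (rule XC)
    show "range (X t) \<subseteq> alg_gen (range (entries A))"
      unfolding t X_def using entry_in_alg_gen_entries[OF \<Xi>P] by (auto intro: alg_gen_scaleC)
    show "(\<lambda>n. \<phi> (X t n * word (entries A) w)) \<longlonglongrightarrow> word_derivative \<phi> (entries A) t w 1 1"
      unfolding t by (rule rel)
  qed
  have "free_fisher M \<phi> (entries A) = (\<Sum>t\<in>UNIV. ennreal ((lim (\<lambda>n. norm2 \<phi> (X t n)))\<^sup>2))"
    by (rule free_fisher_eq[OF entries X])
  also have "\<dots> = of_nat (CARD('d) ^ 3) *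
      (\<Sum>k\<in>UNIV. ennreal ((lim (\<lambda>n. norm2 (mat_trace \<phi>) (\<Xi> k n)))\<^sup>2))"
    by (rule sum_ennreal_lim_norm2_entries[OF \<Xi>C])
      (simp add: X_def lim_norm2_scaleC[OF cauchy2_entry[OF \<Xi>C]])
  also have "(\<Sum>k\<in>UNIV. ennreal ((lim (\<lambda>n. norm2 (mat_trace \<phi>) (\<Xi> k n)))\<^sup>2)) =
      free_fisher (mat_alg M) (mat_trace \<phi>) A"
    by (rule mat.free_fisher_eq[OF rangeA A(2) \<Xi>, symmetric])
  finally show ?thesis .
qed

end

section \<open>Matrices and their entries\<close>

theorem theorem1p2:
  fixes M :: "'h::chilbert_space bop set" and \<phi> :: "'h bop \<Rightarrow> complex"
  assumes "wstar_probability_space M \<phi>"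
  shows "(\<forall>A :: ('h ^ 'd::finite) bop. A \<in> mat_alg M \<longrightarrow>
      free_fisher M \<phi> (\<lambda>(i :: 'd, j :: 'd, k :: bool). adj_pair (entry A i j) k)
        \<ge> of_nat (CARD('d) ^ 3) * free_fisher (mat_alg M) (mat_trace \<phi>) (adj_pair A) \<and>
      (free_from (mat_trace \<phi>) {A, adj A} scalar_matrices \<longrightarrow>
        free_fisher M \<phi> (\<lambda>(i :: 'd, j :: 'd, k :: bool). adj_pair (entry A i j) k)
          = of_nat (CARD('d) ^ 3) * free_fisher (mat_alg M) (mat_trace \<phi>) (adj_pair A)))
    \<and> (\<forall>B :: ('h ^ 'd) bop. B \<in> mat_alg M \<and> selfadjoint B \<longrightarrow>
      free_fisher M \<phi> (\<lambda>(i :: 'd, j :: 'd). entry B i j)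
        \<ge> of_nat (CARD('d) ^ 3) * free_fisher (mat_alg M) (mat_trace \<phi>) (\<lambda>_ :: unit. B) \<and>
      (free_from (mat_trace \<phi>) {B} scalar_matrices \<longrightarrow>
        free_fisher M \<phi> (\<lambda>(i :: 'd, j :: 'd). entry B i j)
          = of_nat (CARD('d) ^ 3) * free_fisher (mat_alg M) (mat_trace \<phi>) (\<lambda>_ :: unit. B)))"
proof -
  interpret wstar_probability_space M \<phi> by (rule assms)
  interpret tracial_star_algebra M \<phi> by (rule tracial_star_algebra)
  interpret mat: tracial_star_algebra "mat_alg M :: ('h ^ 'd) bop set" "mat_trace \<phi>"
    by (rule tracial_mat_alg)
  show ?thesis
  proof (intro conjI allI impI)
    fix A :: "('h ^ 'd) bop" assume A: "A \<in> mat_alg M"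
    have mem: "adj_pair A k \<in> mat_alg M" for k
      using A by (simp add: adj_pair_def mat.adj_mem)
    have range: "range (adj_pair A) = {A, adj A}" by (auto simp: adj_pair_def UNIV_bool)
    have adj: "adj (adj_pair A k) \<in> range (adj_pair A)" for k
      unfolding range by (simp add: adj_pair_def)
    \<comment> \<open>the entry of \<open>adj A\<close> at \<open>(i, j)\<close> is the adjoint of the entry of \<open>A\<close> at \<open>(j, i)\<close>\<close>
    define f :: "'d \<times> 'd \<times> bool \<Rightarrow> 'd \<times> 'd \<times> bool" where
      "f = (\<lambda>(i, j, k). if k then (i, j, k) else (j, i, k))"
    have "bij f" by (rule o_bij[of f]) (auto simp: f_def fun_eq_iff)
    then have "free_fisher M \<phi> (\<lambda>t. entries (adj_pair A) (f t)) = free_fisher M \<phi> (entries (adj_pair A))"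
      by (rule free_fisher_reindex[OF _ entries_family[OF mem adj]])
    also have "(\<lambda>t. entries (adj_pair A) (f t)) = (\<lambda>(i, j, k). adj_pair (entry A i j) k)"
      by (auto simp: fun_eq_iff f_def adj_pair_def entry_adj)
    finally have fisher: "free_fisher M \<phi> (\<lambda>(i, j, k). adj_pair (entry A i j) k) =
        free_fisher M \<phi> (entries (adj_pair A))" .
    show "free_fisher M \<phi> (\<lambda>(i, j, k). adj_pair (entry A i j) k)
        \<ge> of_nat (CARD('d) ^ 3) * free_fisher (mat_alg M) (mat_trace \<phi>) (adj_pair A)"
      unfolding fisher by (rule free_fisher_entries_ge[OF mem adj])
    assume "free_from (mat_trace \<phi>) {A, adj A} scalar_matrices"
    then show "free_fisher M \<phi> (\<lambda>(i, j, k). adj_pair (entry A i j) k)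
        = of_nat (CARD('d) ^ 3) * free_fisher (mat_alg M) (mat_trace \<phi>) (adj_pair A)"
      unfolding fisher by (intro free_fisher_entries_eq[OF mem adj]) (simp add: range)
  next
    fix B :: "('h ^ 'd) bop" assume B: "B \<in> mat_alg M \<and> selfadjoint B"
    let ?B = "\<lambda>_ :: unit. B"
    have mem: "?B k \<in> mat_alg M" and adj: "adj (?B k) \<in> range ?B" for k
      using B by (simp_all add: selfadjoint_def)
    have "bij_betw (\<lambda>(i, j). (i, j, ())) (UNIV :: ('d \<times> 'd) set) UNIV"
      by (rule bij_betwI[of _ _ _ "\<lambda>(i, j, k). (i, j)"]) auto
    then have "free_fisher M \<phi> (\<lambda>t. entries ?B (case t of (i, j) \<Rightarrow> (i, j, ()))) = free_fisher M \<phi> (entries ?B)"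
      by (rule free_fisher_reindex[OF _ entries_family[OF mem adj]])
    also have "(\<lambda>t. entries ?B (case t of (i, j) \<Rightarrow> (i, j, ()))) = (\<lambda>(i, j). entry B i j)"
      by (auto simp: fun_eq_iff)
    finally have fisher: "free_fisher M \<phi> (\<lambda>(i, j). entry B i j) = free_fisher M \<phi> (entries ?B)" .
    show "free_fisher M \<phi> (\<lambda>(i, j). entry B i j)
        \<ge> of_nat (CARD('d) ^ 3) * free_fisher (mat_alg M) (mat_trace \<phi>) ?B"
      unfolding fisher by (rule free_fisher_entries_ge[OF mem adj])
    assume "free_from (mat_trace \<phi>) {B} scalar_matrices"
    then show "free_fisher M \<phi> (\<lambda>(i, j). entry B i j)
        = of_nat (CARD('d) ^ 3) * free_fisher (mat_alg M) (mat_trace \<phi>) ?B"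
      unfolding fisher by (intro free_fisher_entries_eq[OF mem adj]) simp
  qed
qed

end
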